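(* Let $\Omega \subset \mathbb{C}$ be a domain. Then the following statements hold: 1. For $2 \le p < \infty$, $A^p(\Omega)$ is either trivial or it is an infinite-dimensional Banach space. 2. Let $2 < p < \infty$ and $\frac1p+\frac1q=1$. If $c_{2-q}(\Omega^c)>0$, then $A^p(\Omega)$ is non-trivial. 3. Suppose there exists a subharmonic function $\phi:\Omega\to[-\infty,0)$ such that $\phi-\varepsilon_0\|\cdot\|^2$ is subharmonic on $\Omega$ for some $\varepsilon_0>0$ and such that the set $\{z\in\Omega:\nu(\phi,z)=0\}$ contains a non-empty open subset of $\Omega$. Then for $1\le p<2$, $A^p(\Omega)$ is infinite dimensional.
   Context: A domain is an open connected set (non-empty here). For $1\le p<\infty$, $A^p(\Omega)$ is the space of holomorphic functions $f$ on $\Omega$ with $\int_\Omega |f|^p\,d\lambda<\infty$ ($\lambda$ = Lebesgue measure); it is called trivial if it equals $\{0\}$. $\Omega^c=\mathbb{C}\setminus\Omega$. For $\alpha\in(0,2)$ and $K\subset\Omega^c$ compact, let $\mathcal{P}(K)$ be the set of Borel probability measures supported on $K$. Put $I_\alpha(\mu)=\int_K\int_K |z-w|^{-\alpha}\,d\mu(z)\,d\mu(w)$, $c_\alpha(K)=\sup_{\mu\in\mathcal{P}(K)} \frac{1}{I_\alpha(\mu)}$, and $c_\alpha(\Omega^c)=\sup\{c_\alpha(K): K\subset\Omega^c,\ K\text{ compact}\}$. The Lelong number of a subharmonic function $\phi$ at $z$ is $\nu(\phi,z)=\liminf_{w\to z}\frac{\phi(w)}{\log|w-z|}$. *)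

theory Defs
  imports
    "HOL-Complex_Analysis.Complex_Analysis"
    "HOL-Probability.Probability"
    "HOL-Library.Function_Algebras"
begin

interpretation cfun: vector_space "\<lambda>(c::complex) (f::complex \<Rightarrow> complex) z. c * f z"
  by unfold_locales (auto simp: fun_eq_iff algebra_simps)

definition infinite_dimensional :: "(complex \<Rightarrow> complex) set \<Rightarrow> bool" where
  "infinite_dimensional V \<longleftrightarrow> cfun.subspace V \<and> (\<nexists>B. finite B \<and> V = cfun.span B)"

text \<open>The library's \<open>mcomplete\<close> is meaningful only for a genuine \<open>Metric_space\<close>, which is therefore
  required separately.\<close>

definition complex_banach_space ::
    "(complex \<Rightarrow> complex) set \<Rightarrow> ((complex \<Rightarrow> complex) \<Rightarrow> real) \<Rightarrow> bool" where
  "complex_banach_space V N \<longleftrightarrow>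
     cfun.subspace V \<and>
     (\<forall>f\<in>V. 0 \<le> N f \<and> (N f = 0 \<longleftrightarrow> f = 0)) \<and>
     (\<forall>c. \<forall>f\<in>V. N (\<lambda>z. c * f z) = norm c * N f) \<and>
     (\<forall>f\<in>V. \<forall>g\<in>V. N (f + g) \<le> N f + N g) \<and>
     Metric_space V (\<lambda>f g. N (f - g)) \<and>
     Metric_space.mcomplete V (\<lambda>f g. N (f - g))"

text \<open>Functions on \<open>\<Omega>\<close> are represented by their extension by zero to all of \<open>\<complex>\<close>, so that equality of
  elements of \<open>bergman \<Omega> p\<close> is equality on \<open>\<Omega>\<close>.\<close>

definition bergman :: "complex set \<Rightarrow> real \<Rightarrow> (complex \<Rightarrow> complex) set" where
  "bergman \<Omega> p = {f. f holomorphic_on \<Omega> \<and> (\<forall>z. z \<notin> \<Omega> \<longrightarrow> f z = 0) \<and>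
                     set_integrable lborel \<Omega> (\<lambda>z. norm (f z) powr p)}"

definition bergman_norm :: "complex set \<Rightarrow> real \<Rightarrow> (complex \<Rightarrow> complex) \<Rightarrow> real" where
  "bergman_norm \<Omega> p f = (LINT z:\<Omega>|lborel. norm (f z) powr p) powr (1 / p)"

definition borel_probs_on :: "complex set \<Rightarrow> complex measure set" where
  "borel_probs_on K = {\<mu>. prob_space \<mu> \<and> sets \<mu> = sets borel \<and> emeasure \<mu> (- K) = 0}"

text \<open>The case distinction is needed because \<open>0 powr (- \<alpha>) = 0\<close>, whereas the kernel is infinite on the
  diagonal.\<close>

definition riesz_kernel :: "real \<Rightarrow> complex \<Rightarrow> complex \<Rightarrow> ennreal" where
  "riesz_kernel \<alpha> z w = (if z = w then \<infinity> else ennreal (norm (z - w) powr (- \<alpha>)))"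

definition riesz_energy :: "real \<Rightarrow> complex set \<Rightarrow> complex measure \<Rightarrow> ennreal" where
  "riesz_energy \<alpha> K \<mu> = (\<integral>\<^sup>+z\<in>K. (\<integral>\<^sup>+w\<in>K. riesz_kernel \<alpha> z w \<partial>\<mu>) \<partial>\<mu>)"

definition riesz_capacity_compact :: "real \<Rightarrow> complex set \<Rightarrow> ennreal" where
  "riesz_capacity_compact \<alpha> K = (SUP \<mu>\<in>borel_probs_on K. 1 / riesz_energy \<alpha> K \<mu>)"

definition riesz_capacity :: "real \<Rightarrow> complex set \<Rightarrow> ennreal" where
  "riesz_capacity \<alpha> E = (SUP K\<in>{K. compact K \<and> K \<subseteq> E}. riesz_capacity_compact \<alpha> K)"

definition upper_semicontinuous_on :: "complex set \<Rightarrow> (complex \<Rightarrow> ereal) \<Rightarrow> bool" where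
  "upper_semicontinuous_on \<Omega> \<phi> \<longleftrightarrow> (\<forall>a. openin (top_of_set \<Omega>) {z\<in>\<Omega>. \<phi> z < a})"

text \<open>The mean over a circle as positive minus negative part (\<open>e2ennreal\<close> truncates negative values to
  \<open>0\<close>). For a function that is bounded above on the circle the first integral is finite, so the
  difference is never \<open>\<infinity> - \<infinity>\<close>.\<close>

definition circle_mean :: "(complex \<Rightarrow> ereal) \<Rightarrow> complex \<Rightarrow> real \<Rightarrow> ereal" where
  "circle_mean \<phi> z r =
     (enn2ereal (\<integral>\<^sup>+t\<in>{0..2*pi}. e2ennreal (\<phi> (z + rcis r t)) \<partial>lborel)
      - enn2ereal (\<integral>\<^sup>+t\<in>{0..2*pi}. e2ennreal (- \<phi> (z + rcis r t)) \<partial>lborel)) / ereal (2 * pi)"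

text \<open>The function that is identically \<open>-\<infinity>\<close> counts as subharmonic.\<close>

definition subharmonic_on :: "complex set \<Rightarrow> (complex \<Rightarrow> ereal) \<Rightarrow> bool" where
  "subharmonic_on \<Omega> \<phi> \<longleftrightarrow>
     (\<forall>z\<in>\<Omega>. \<phi> z < \<infinity>) \<and> upper_semicontinuous_on \<Omega> \<phi> \<and>
     (\<forall>z r. 0 < r \<and> cball z r \<subseteq> \<Omega> \<longrightarrow> \<phi> z \<le> circle_mean \<phi> z r)"

definition lelong_number :: "(complex \<Rightarrow> ereal) \<Rightarrow> complex \<Rightarrow> ereal" where
  "lelong_number \<phi> z = Liminf (at z) (\<lambda>w. \<phi> w / ereal (ln (norm (w - z))))"

end

theory Submission
  imports Defs "HOL-Real_Asymp.Real_Asymp"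
begin

text \<open>The elements of a Bergman space that the theorem calls for are Cauchy transforms
  \<open>C h (z) = \<integral> h(w) / (z - w)\<close> of functions or measures that live off the domain or are localised.

  For \<open>p \<ge> 2\<close> suppose that the space is finite-dimensional and contains \<open>g \<noteq> 0\<close>. If the complement of \<open>\<Omega>\<close> has
  positive measure, Cauchy transforms of densities on it give infinitely many independent elements
  (\<open>bergman_not_span_positive_complement\<close>). Otherwise \<open>\<Omega>\<close> is dense and \<open>g\<close> is localised: for a bump function
  \<open>\<kappa>\<close> with \<open>\<partial>\<close>-bar derivative \<open>\<partial>\<kappa>\<close>, the function \<open>\<kappa> g - C(g \<partial>\<kappa>) / \<pi>\<close> is holomorphic on \<open>\<Omega>\<close>, is \<open>p\<close>-integrable up to one
  linear condition (which makes it decay like \<open>1 / z\<^sup>2\<close> at infinity), and inherits only the singularities of \<open>g\<close> in the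
  support of \<open>\<kappa>\<close>. Finitely many dimensions leave room for finitely many singularities only
  (\<open>bergman_singular_set_finite\<close>), so \<open>g\<close> is holomorphic and \<open>p\<close>-integrable on the plane without finitely many
  points. For \<open>p \<ge> 2\<close> these points are removable, and an entire \<open>p\<close>-integrable function is \<open>0\<close>
  (\<open>holomorphic_Lp_cofinite_eq_0\<close>). Completeness follows from the boundedness of point evaluations
  (\<open>bergman_point_evaluation\<close>), itself obtained from the same localisation and Liouville's theorem.

  For \<open>p > 2\<close> and positive capacity of order \<open>2 - q\<close>, a suitable restriction \<open>\<nu>\<close> of a measure of finite energy has a
  bounded Riesz potential on its carrier. A Wolff-type estimate (\<open>newton_potential_Lp\<close>) shows that the potential
  \<open>\<integral> 1 / norm (z - w) d\<nu>(w)\<close> is \<open>p\<close>-integrable, and it dominates a Cauchy transform that does not vanish on \<open>\<Omega>\<close>.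

  For \<open>p < 2\<close> simple poles are locally \<open>p\<close>-integrable, so that an infinite complement is enough: three poles give
  sufficient decay at infinity (\<open>rational_mem_bergman\<close>). The complement is infinite because on the plane without
  finitely many points a negative, strictly subharmonic function that is not identically \<open>-\<infinity>\<close> would violate the maximum principle
  (\<open>no_negative_strictly_subharmonic_cofinite\<close>); the hypothesis on the Lelong number excludes
  the constant \<open>-\<infinity>\<close>.\<close>

section \<open>Lebesgue measure on the plane\<close>

lemma measurable_Complex[measurable (raw)]:
  assumes "f \<in> borel_measurable M" "g \<in> borel_measurable M"
  shows "(\<lambda>x. Complex (f x) (g x)) \<in> borel_measurable M"
  using assms unfolding Complex_eq by measurable

text \<open>Lebesgue measure on \<open>\<complex>\<close> is the image of the product of two copies of Lebesgue measure on \<open>\<real>\<close>;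
  every Fubini argument in Cartesian coordinates below rests on this.\<close>

lemma lborel_complex_eq:
  "(lborel :: complex measure) = distr (lborel \<Otimes>\<^sub>M lborel) borel (\<lambda>(x, y). Complex x y)"
proof (rule lborel_eqI)
  have m[measurable]: "(\<lambda>(x, y). Complex x y) \<in> borel_measurable (lborel \<Otimes>\<^sub>M lborel)"
    by (simp add: case_prod_beta)
  fix l u :: complex
  assume le: "\<And>b. b \<in> Basis \<Longrightarrow> l \<bullet> b \<le> u \<bullet> b"
  have le1: "Re l \<le> Re u" "Im l \<le> Im u"
    using le[of 1] le[of \<i>] by (auto simp: Basis_complex_def)
  have eq: "(\<lambda>(x, y). Complex x y) -` box l u \<inter> space (lborel \<Otimes>\<^sub>M lborel)
      = {Re l<..<Re u} \<times> {Im l<..<Im u}"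
    by (auto simp: in_box_complex_iff space_pair_measure)
  show "emeasure (distr (lborel \<Otimes>\<^sub>M lborel) borel (\<lambda>(x, y). Complex x y)) (box l u)
      = (\<Prod>b\<in>Basis. (u - l) \<bullet> b)"
    using le1 by (subst emeasure_distr)
      (simp_all add: eq lborel.emeasure_pair_measure_Times Basis_complex_def ennreal_mult)
qed simp

lemma nn_integral_complex_iterated:
  assumes [measurable]: "f \<in> borel_measurable borel"
  shows "(\<integral>\<^sup>+z. f z \<partial>(lborel :: complex measure)) = (\<integral>\<^sup>+x. \<integral>\<^sup>+y. f (Complex x y) \<partial>lborel \<partial>lborel)"
proof -
  have "(\<integral>\<^sup>+z. f z \<partial>(lborel :: complex measure))
      = (\<integral>\<^sup>+p. f (Complex (fst p) (snd p)) \<partial>(lborel \<Otimes>\<^sub>M lborel))"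
    unfolding lborel_complex_eq by (subst nn_integral_distr) (auto simp: case_prod_beta)
  also have "\<dots> = (\<integral>\<^sup>+x. \<integral>\<^sup>+y. f (Complex x y) \<partial>lborel \<partial>lborel)"
    by (subst lborel.nn_integral_fst[symmetric]) auto
  finally show ?thesis .
qed

lemma integral_complex_iterated:
  fixes f :: "complex \<Rightarrow> complex"
  assumes f: "integrable lborel f"
  shows "(\<integral>z. f z \<partial>lborel) = (\<integral>x. \<integral>y. f (Complex x y) \<partial>lborel \<partial>lborel)"
    and "(\<integral>z. f z \<partial>lborel) = (\<integral>y. \<integral>x. f (Complex x y) \<partial>lborel \<partial>lborel)"
proof -
  have [measurable]: "f \<in> borel_measurable borel"
    using f by auto
  have i: "integrable (lborel \<Otimes>\<^sub>M lborel) (\<lambda>(x, y). f (Complex x y))"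
    using f unfolding lborel_complex_eq by (subst (asm) integrable_distr_eq) (auto simp: case_prod_beta')
  have e: "(\<integral>z. f z \<partial>lborel) = (\<integral>p. (\<lambda>(x, y). f (Complex x y)) p \<partial>(lborel \<Otimes>\<^sub>M lborel))"
    unfolding lborel_complex_eq by (subst integral_distr) (auto simp: case_prod_beta')
  show "(\<integral>z. f z \<partial>lborel) = (\<integral>x. \<integral>y. f (Complex x y) \<partial>lborel \<partial>lborel)"
    unfolding e using lborel_pair.integral_fst'[OF i] by simp
  show "(\<integral>z. f z \<partial>lborel) = (\<integral>y. \<integral>x. f (Complex x y) \<partial>lborel \<partial>lborel)"
    unfolding e using lborel_pair.integral_snd[OF i] by simp
qed

lemma nn_integral_power_weight_real:
  fixes s t :: real
  assumes s: "0 \<le> s" "s < 1" and t: "0 \<le> t" "1 < s + t"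
  shows "(\<integral>\<^sup>+x. ennreal (\<bar>x\<bar> powr (-s) * (1 + x\<^sup>2) powr (-t/2)) \<partial>lborel) < \<infinity>"
proof -
  let ?f = "\<lambda>x::real. \<bar>x\<bar> powr (-s) * (1 + x\<^sup>2) powr (-t/2)"
  have bound: "?f x \<le> (if x \<le> 1 then x powr (-s) else x powr (-s-t))" if "x \<ge> 0" for x :: real
  proof (cases "x \<le> 1")
    case True
    have "(1 + x\<^sup>2) powr (-t/2) \<le> (1 + x\<^sup>2) powr 0"
      using t by (intro powr_mono) auto
    also have "\<dots> = 1"
      using sum_power2_eq_zero_iff[of 1 x] by simp
    finally show ?thesis using True that
      by (simp add: mult_left_le)
  next
    case False
    have "(1 + x\<^sup>2) powr (-t/2) \<le> (x\<^sup>2) powr (-t/2)"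
      using t False by (intro powr_mono2') auto
    also have "\<dots> = x powr (-t)"
      using False by (simp add: powr_powr flip: powr_numeral)
    finally have "?f x \<le> x powr (-s) * x powr (-t)"
      using that by (simp add: mult_left_mono)
    also have "\<dots> = x powr (-s-t)"
      using False by (simp flip: powr_add)
    finally show ?thesis using False by simp
  qed
  have pos: "(\<integral>\<^sup>+x\<in>{0..}. ennreal (?f x) \<partial>lborel) < \<infinity>"
  proof -
    have 1: "(\<integral>\<^sup>+x. ennreal (x powr (-s)) * indicator {0..1} x \<partial>lborel) = ennreal (1 powr (-s+1) / (-s+1))"
      using s has_integral_powr_from_0[of "-s" 1]
      by (intro nn_integral_has_integral_lebesgue') auto
    have 2: "(\<integral>\<^sup>+x. ennreal (x powr (-s-t)) * indicator {1..} x \<partial>lborel) = ennreal (-(1 powr (-s-t+1)) / (-s-t+1))"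
      using s t has_integral_powr_to_inf[of "-s-t" 1]
      by (intro nn_integral_has_integral_lebesgue') auto
    have "(\<integral>\<^sup>+x\<in>{0..}. ennreal (?f x) \<partial>lborel)
       \<le> (\<integral>\<^sup>+x. ennreal (x powr (-s)) * indicator {0..1} x + ennreal (x powr (-s-t)) * indicator {1..} x \<partial>lborel)"
    proof (intro nn_integral_mono)
      fix x :: real
      consider "x < 0" | "0 \<le> x" "x \<le> 1" | "1 < x" by linarith
      then show "ennreal (?f x) * indicator {0..} x
          \<le> ennreal (x powr (-s)) * indicator {0..1} x + ennreal (x powr (-s-t)) * indicator {1..} x"
      proof cases
        case 2
        then have "ennreal (?f x) \<le> ennreal (x powr (-s))"
          using bound[of x] by (intro ennreal_leI) auto
        with 2 show ?thesis by (intro add_increasing2) auto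
      next
        case 3
        then have "ennreal (?f x) \<le> ennreal (x powr (-s-t))"
          using bound[of x] by (intro ennreal_leI) auto
        with 3 show ?thesis by simp
      qed auto
    qed
    also have "\<dots> < \<infinity>"
      by (subst nn_integral_add) (auto simp: 1 2)
    finally show ?thesis .
  qed
  have neg: "(\<integral>\<^sup>+x\<in>{..0}. ennreal (?f x) \<partial>lborel) = (\<integral>\<^sup>+x\<in>{0..}. ennreal (?f x) \<partial>lborel)"
    by (subst nn_integral_real_affine[where c="-1" and t=0]) (auto simp: indicator_def intro!: nn_integral_cong)
  have "(\<integral>\<^sup>+x. ennreal (?f x) \<partial>lborel)
     \<le> (\<integral>\<^sup>+x. ennreal (?f x) * indicator {0..} x + ennreal (?f x) * indicator {..0} x \<partial>lborel)"
    by (intro nn_integral_mono) (auto simp: indicator_def)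
  also have "\<dots> = (\<integral>\<^sup>+x\<in>{0..}. ennreal (?f x) \<partial>lborel) + (\<integral>\<^sup>+x\<in>{..0}. ennreal (?f x) \<partial>lborel)"
    by (rule nn_integral_add) auto
  also have "\<dots> < \<infinity>"
    using pos unfolding neg by simp
  finally show ?thesis .
qed

text \<open>The one integrability fact about powers of \<open>norm z\<close> that is needed. It reduces to one dimension
  because, for \<open>z = x + \<i> y\<close>, both \<open>\<bar>x\<bar> \<bar>y\<bar> \<le> (norm z)\<^sup>2\<close> and
  \<open>(1 + x\<^sup>2) (1 + y\<^sup>2) \<le> (1 + (norm z)\<^sup>2)\<^sup>2\<close>, so that the weight is at most a product of a function
  of \<open>x\<close> and a function of \<open>y\<close>.\<close>

lemma nn_integral_power_weight:
  fixes a b :: real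
  assumes a: "0 \<le> a" "a < 2" and b: "0 \<le> b" "2 < a + b"
  shows "(\<integral>\<^sup>+z. ennreal (norm z powr (-a) * (1 + (norm z)\<^sup>2) powr (-b/2)) \<partial>(lborel :: complex measure)) < \<infinity>"
proof -
  let ?g = "\<lambda>x::real. \<bar>x\<bar> powr (-(a/2)) * (1 + x\<^sup>2) powr (-(b/2)/2)"
  have le: "norm (Complex x y) powr (-a) * (1 + (norm (Complex x y))\<^sup>2) powr (-b/2) \<le> ?g x * ?g y"
    if xy: "x \<noteq> 0" "y \<noteq> 0" for x y
  proof -
    let ?n = "norm (Complex x y)"
    have n2: "?n\<^sup>2 = x\<^sup>2 + y\<^sup>2"
      by (simp add: cmod_power2)
    have npos: "?n > 0"
      using xy by (simp add: complex_eq_iff)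
    have "2 * (\<bar>x\<bar> * \<bar>y\<bar>) \<le> ?n\<^sup>2"
      using sum_squares_bound[of "\<bar>x\<bar>" "\<bar>y\<bar>"] n2 by simp
    then have "\<bar>x\<bar> * \<bar>y\<bar> \<le> ?n\<^sup>2"
      using mult_nonneg_nonneg[of "\<bar>x\<bar>" "\<bar>y\<bar>"] by linarith
    then have "(?n\<^sup>2) powr (-(a/2)) \<le> (\<bar>x\<bar> * \<bar>y\<bar>) powr (-(a/2))"
      using xy a by (intro powr_mono2') auto
    moreover have "(?n\<^sup>2) powr (-(a/2)) = ?n powr (-a)"
      using npos by (simp add: powr_powr flip: powr_numeral)
    ultimately have 1: "?n powr (-a) \<le> \<bar>x\<bar> powr (-(a/2)) * \<bar>y\<bar> powr (-(a/2))"
      by (simp add: powr_mult)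
    have "(1 + x\<^sup>2) * (1 + y\<^sup>2) \<le> (1 + ?n\<^sup>2)\<^sup>2"
    proof -
      have "(1 + ?n\<^sup>2)\<^sup>2 - (1 + x\<^sup>2) * (1 + y\<^sup>2) = x\<^sup>2 + y\<^sup>2 + x\<^sup>2 * y\<^sup>2 + x^4 + y^4"
        unfolding n2 by (simp add: algebra_simps power2_eq_square power4_eq_xxxx)
      also have "\<dots> \<ge> 0" by simp
      finally show ?thesis by linarith
    qed
    then have "((1 + ?n\<^sup>2)\<^sup>2) powr (-(b/2)/2) \<le> ((1 + x\<^sup>2) * (1 + y\<^sup>2)) powr (-(b/2)/2)"
      using b by (intro powr_mono2') (auto intro!: mult_pos_pos add_pos_nonneg)
    moreover have "((1 + ?n\<^sup>2)\<^sup>2) powr (-(b/2)/2) = (1 + ?n\<^sup>2) powr (-b/2)"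
      by (simp add: powr_powr add_pos_nonneg flip: powr_numeral)
    ultimately have 2: "(1 + ?n\<^sup>2) powr (-b/2) \<le> (1 + x\<^sup>2) powr (-(b/2)/2) * (1 + y\<^sup>2) powr (-(b/2)/2)"
      by (simp add: powr_mult)
    have "?n powr (-a) * (1 + ?n\<^sup>2) powr (-b/2)
       \<le> (\<bar>x\<bar> powr (-(a/2)) * \<bar>y\<bar> powr (-(a/2))) * ((1 + x\<^sup>2) powr (-(b/2)/2) * (1 + y\<^sup>2) powr (-(b/2)/2))"
      by (intro mult_mono 1 2) auto
    then show ?thesis by (simp add: mult_ac)
  qed
  have ae: "AE x in lborel. (x::real) \<noteq> 0"
    by (rule AE_lborel_singleton)
  have "(\<integral>\<^sup>+z. ennreal (norm z powr (-a) * (1 + (norm z)\<^sup>2) powr (-b/2)) \<partial>(lborel :: complex measure))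
     = (\<integral>\<^sup>+x. \<integral>\<^sup>+y. ennreal (norm (Complex x y) powr (-a) * (1 + (norm (Complex x y))\<^sup>2) powr (-b/2)) \<partial>lborel \<partial>lborel)"
    by (rule nn_integral_complex_iterated) measurable
  also have "\<dots> \<le> (\<integral>\<^sup>+x. \<integral>\<^sup>+y. ennreal (?g x) * ennreal (?g y) \<partial>lborel \<partial>lborel)"
  proof (rule nn_integral_mono_AE)
    show "AE x in lborel. (\<integral>\<^sup>+y. ennreal (norm (Complex x y) powr (-a) * (1 + (norm (Complex x y))\<^sup>2) powr (-b/2)) \<partial>lborel)
        \<le> (\<integral>\<^sup>+y. ennreal (?g x) * ennreal (?g y) \<partial>lborel)"
      using ae
    proof eventually_elim
      case (elim x)
      show ?case
        apply (rule nn_integral_mono_AE)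
        using ae apply eventually_elim
        using le elim by (auto simp flip: ennreal_mult intro!: ennreal_leI)
    qed
  qed
  also have "\<dots> = (\<integral>\<^sup>+x. ennreal (?g x) \<partial>lborel) * (\<integral>\<^sup>+y. ennreal (?g y) \<partial>lborel)"
    by (simp add: nn_integral_cmult nn_integral_multc)
  also have "\<dots> < \<infinity>"
    using nn_integral_power_weight_real[of "a/2" "b/2"] a b
    by (auto simp: ennreal_mult_less_top)
  finally show ?thesis .
qed

section \<open>Cauchy transforms and linear algebra\<close>

text \<open>The Cauchy transform of the measure \<open>h dM\<close>, without the customary factor \<open>1 / \<pi>\<close>. Where the integrand is
  not integrable its value is \<open>0\<close>, the default of the Bochner integral.\<close>

definition cauchy_transform :: "complex measure \<Rightarrow> (complex \<Rightarrow> complex) \<Rightarrow> complex \<Rightarrow> complex" where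
  "cauchy_transform M h z = (\<integral>w. h w / (z - w) \<partial>M)"

lemma has_field_derivative_quadratic:
  fixes f :: "complex \<Rightarrow> complex"
  assumes "0 < r" and b: "\<And>z. z \<in> ball a r \<Longrightarrow> norm (f z - f a - (z - a) * d) \<le> K * (norm (z - a))\<^sup>2"
  shows "(f has_field_derivative d) (at a)"
proof -
  have "((\<lambda>z. (f z - f a) / (z - a) - d) \<longlongrightarrow> 0) (at a)"
  proof (rule Lim_null_comparison)
    show "\<forall>\<^sub>F z in at a. norm ((f z - f a) / (z - a) - d) \<le> K * norm (z - a)"
      unfolding eventually_at
    proof (intro exI conjI ballI impI)
      show "0 < r" by fact
      fix z assume z: "z \<noteq> a \<and> dist z a < r"
      have "(f z - f a) / (z - a) - d = (f z - f a - (z - a) * d) / (z - a)"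
        using z by (simp add: diff_divide_distrib)
      also have "norm \<dots> \<le> K * (norm (z - a))\<^sup>2 / norm (z - a)"
        using z b[of z] by (simp add: norm_divide divide_right_mono dist_commute)
      also have "\<dots> = K * norm (z - a)"
        using z by (simp add: power2_eq_square)
      finally show "norm ((f z - f a) / (z - a) - d) \<le> K * norm (z - a)" .
    qed
    have "((\<lambda>z. K * norm (z - a)) \<longlongrightarrow> K * norm (a - a)) (at a)"
      by (intro tendsto_mult tendsto_norm tendsto_diff tendsto_const tendsto_ident_at)
    then show "((\<lambda>z. K * norm (z - a)) \<longlongrightarrow> 0) (at a)" by simp
  qed
  then show ?thesis
    unfolding has_field_derivative_iff by (rule LIM_zero_cancel)
qed

lemma integrable_cauchy_kernel:
  fixes M :: "complex measure"
  assumes h: "integrable M h" and s: "sets M = sets borel" and "0 < \<rho>"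
    and far: "\<And>w. h w \<noteq> 0 \<Longrightarrow> \<rho> \<le> norm (z - w)"
  shows "integrable M (\<lambda>w. h w / (z - w))"
proof (rule Bochner_Integration.integrable_bound)
  show "integrable M (\<lambda>w. h w / of_real \<rho>)"
    using h by simp
  have [measurable]: "h \<in> borel_measurable M" "M \<in> space (subprob_algebra borel) \<Longrightarrow> True"
    using h by auto
  have [measurable]: "(\<lambda>w. z - w) \<in> borel_measurable M"
    unfolding measurable_cong_sets[OF s refl] by measurable
  show "(\<lambda>w. h w / (z - w)) \<in> borel_measurable M"
    by measurable
  show "AE w in M. norm (h w / (z - w)) \<le> norm (h w / of_real \<rho>)"
  proof (rule AE_I2)
    fix w
    show "norm (h w / (z - w)) \<le> norm (h w / of_real \<rho>)"
    proof (cases "h w = 0")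
      case False
      then show ?thesis using far[of w] \<open>0 < \<rho>\<close>
        by (simp add: norm_divide frac_le)
    qed simp
  qed
qed

text \<open>The derivative is \<open>- \<integral> h(w) / (a - w)\<^sup>2 dM(w)\<close>; the remainder of the difference quotient of the kernel
  is explicit and quadratically small as long as \<open>w\<close> stays away from \<open>a\<close>.\<close>

lemma cauchy_transform_holomorphic:
  assumes h: "integrable M h" and s: "sets M = sets borel" and D: "open D"
    and z: "\<And>w. w \<in> D \<Longrightarrow> h w = 0"
  shows "cauchy_transform M h holomorphic_on D"
proof -
  have "\<exists>d. (cauchy_transform M h has_field_derivative d) (at a)" if "a \<in> D" for a
  proof -
    obtain \<rho>0 where \<rho>0: "\<rho>0 > 0" "ball a \<rho>0 \<subseteq> D"
      using D \<open>a \<in> D\<close> openE by blast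
    define \<rho> where "\<rho> = \<rho>0 / 2"
    have \<rho>: "\<rho> > 0" using \<rho>0 by (simp add: \<rho>_def)
    have far: "\<rho> \<le> norm (x - w)" if "h w \<noteq> 0" "x \<in> ball a \<rho>" for x w
    proof -
      have "w \<notin> ball a \<rho>0" using z[of w] that \<rho>0 by auto
      then have "\<rho>0 \<le> dist a w" by simp
      also have "\<dots> \<le> dist a x + dist x w" by (rule dist_triangle)
      finally show ?thesis using that by (simp add: \<rho>_def dist_norm)
    qed
    have [measurable]: "h \<in> borel_measurable M"
      using h by auto
    have [measurable]: "(\<lambda>w. x - w) \<in> borel_measurable M" for x
      unfolding measurable_cong_sets[OF s refl] by measurable
    have i1: "integrable M (\<lambda>w. h w / (x - w))" if "x \<in> ball a \<rho>" for x
      by (rule integrable_cauchy_kernel[OF h s \<rho>]) (use far that in auto)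
    have i2: "integrable M (\<lambda>w. h w / (a - w)\<^sup>2)"
    proof -
      have "integrable M (\<lambda>w. (h w / (a - w)) / (a - w))"
        by (rule integrable_cauchy_kernel[OF i1 s \<rho>]) (use far \<rho> in auto)
      then show ?thesis by (simp add: power2_eq_square)
    qed
    show ?thesis
    proof (intro exI has_field_derivative_quadratic)
      show "0 < \<rho>" by fact
      fix x assume x: "x \<in> ball a \<rho>"
      have eq: "h w / (x - w) - h w / (a - w) - (x - a) * (- h w / (a - w)\<^sup>2)
          = h w * (x - a)\<^sup>2 / ((x - w) * (a - w)\<^sup>2)" if "w \<in> space M" for w
      proof (cases "h w = 0")
        case False
        then have "x - w \<noteq> 0" "a - w \<noteq> 0"
          using far[of w x] far[of w a] x \<rho> by auto
        then show ?thesis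
          by (simp add: divide_simps) (simp add: algebra_simps power2_eq_square)
      qed simp
      have "cauchy_transform M h x - cauchy_transform M h a - (x - a) * (\<integral>w. - h w / (a - w)\<^sup>2 \<partial>M)
         = (\<integral>w. h w / (x - w) - h w / (a - w) - (x - a) * (- h w / (a - w)\<^sup>2) \<partial>M)"
        unfolding cauchy_transform_def
        using i1[OF x] i1[of a] integrable_mult_right[OF i2, of "x - a"] i2 \<rho>
        by (simp add: Bochner_Integration.integral_add flip: times_divide_eq_right)
      also have "\<dots> = (\<integral>w. h w * (x - a)\<^sup>2 / ((x - w) * (a - w)\<^sup>2) \<partial>M)"
        by (rule Bochner_Integration.integral_cong[OF refl eq])
      finally have e: "norm (cauchy_transform M h x - cauchy_transform M h a - (x - a) * (\<integral>w. - h w / (a - w)\<^sup>2 \<partial>M))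
         = norm (\<integral>w. h w * (x - a)\<^sup>2 / ((x - w) * (a - w)\<^sup>2) \<partial>M)" by simp
      also have "\<dots> \<le> (\<integral>w. norm (h w) * (norm (x - a))\<^sup>2 / \<rho>^3 \<partial>M)"
      proof (rule Bochner_Integration.integral_norm_bound_integral)
        have "integrable M (\<lambda>w. h w / (x - w) - h w / (a - w) - (x - a) * (- h w / (a - w)\<^sup>2))"
          using i1[OF x] i1[of a] i2 \<rho> by (intro Bochner_Integration.integrable_diff integrable_mult_right) auto
        then show "integrable M (\<lambda>w. h w * (x - a)\<^sup>2 / ((x - w) * (a - w)\<^sup>2))"
          using eq by (subst (asm) Bochner_Integration.integrable_cong[OF refl eq]) auto
        show "integrable M (\<lambda>w. norm (h w) * (norm (x - a))\<^sup>2 / \<rho>^3)"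
          using h by simp
        fix w
        show "norm (h w * (x - a)\<^sup>2 / ((x - w) * (a - w)\<^sup>2)) \<le> norm (h w) * (norm (x - a))\<^sup>2 / \<rho>^3"
        proof (cases "h w = 0")
          case False
          have "\<rho>^3 \<le> norm (x - w) * (norm (a - w))\<^sup>2"
            unfolding power3_eq_cube power2_eq_square mult.assoc using far[of w x] far[of w a] x \<rho> False
            by (intro mult_mono) auto
          then show ?thesis using \<rho>
            by (simp add: norm_mult norm_divide norm_power frac_le)
        qed simp
      qed
      also have "\<dots> = (\<integral>w. norm (h w) \<partial>M) / \<rho>^3 * (norm (x - a))\<^sup>2"
        using h by simp
      finally show "norm (cauchy_transform M h x - cauchy_transform M h a - (x - a) * (\<integral>w. - h w / (a - w)\<^sup>2 \<partial>M))
        \<le> (\<integral>w. norm (h w) \<partial>M) / \<rho>^3 * (norm (x - a))\<^sup>2" .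
    qed
  qed
  then show ?thesis
    using D by (auto simp: holomorphic_on_open)
qed

lemma partial_fractions_independent:
  fixes a c :: "'i \<Rightarrow> complex"
  assumes J: "finite J" "inj_on a J" and Z: "infinite Z"
    and eq: "\<And>z. z \<in> Z \<Longrightarrow> z \<notin> a ` J \<Longrightarrow> (\<Sum>j\<in>J. c j / (z - a j)) = 0"
    and "k \<in> J"
  shows "c k = 0"
proof -
  define q where "q = (\<Sum>j\<in>J. smult (c j) (\<Prod>i\<in>J - {j}. [:- a i, 1:]))"
  have pq: "poly q z = (\<Sum>j\<in>J. c j * (\<Prod>i\<in>J - {j}. z - a i))" for z
    by (simp add: q_def poly_sum poly_prod)
  have "poly q z = 0" if "z \<in> Z - a ` J" for z
  proof -
    have "poly q z = (\<Sum>j\<in>J. (\<Prod>i\<in>J. z - a i) * (c j / (z - a j)))"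
      unfolding pq
    proof (rule sum.cong[OF refl])
      fix j assume j: "j \<in> J"
      then have "z - a j \<noteq> 0" using that by auto
      then show "c j * (\<Prod>i\<in>J - {j}. z - a i) = (\<Prod>i\<in>J. z - a i) * (c j / (z - a j))"
        using prod.remove[OF J(1) j, of "\<lambda>i. z - a i"] by simp
    qed
    also have "\<dots> = (\<Prod>i\<in>J. z - a i) * (\<Sum>j\<in>J. c j / (z - a j))"
      by (simp only: sum_distrib_left)
    also have "\<dots> = 0" using eq[of z] that by simp
    finally show ?thesis .
  qed
  then have "Z - a ` J \<subseteq> {z. poly q z = 0}" by auto
  moreover have "infinite (Z - a ` J)"
    using Z J by (simp add: Diff_infinite_finite)
  ultimately have "q = 0"
    using poly_roots_finite[of q] finite_subset by blast
  then have "0 = poly q (a k)" by simp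
  also have "\<dots> = (\<Sum>j\<in>J. if j = k then c k * (\<Prod>i\<in>J - {k}. a k - a i) else 0)"
    unfolding pq
  proof (rule sum.cong[OF refl])
    fix j assume "j \<in> J"
    show "c j * (\<Prod>i\<in>J - {j}. a k - a i) = (if j = k then c k * (\<Prod>i\<in>J - {k}. a k - a i) else 0)"
      using \<open>k \<in> J\<close> J(1) by (auto simp: prod_zero_iff)
  qed
  also have "\<dots> = c k * (\<Prod>i\<in>J - {k}. a k - a i)"
    using \<open>k \<in> J\<close> J(1) by simp
  finally have "c k * (\<Prod>i\<in>J - {k}. a k - a i) = 0" by simp
  moreover have "(\<Prod>i\<in>J - {k}. a k - a i) \<noteq> 0"
    using J \<open>k \<in> J\<close> by (auto simp: inj_on_def)
  ultimately show ?thesis by simp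
qed

lemma sum_fun_apply: "(\<Sum>i\<in>A. F i) z = (\<Sum>i\<in>A. F i (z :: complex) :: complex)"
  by (induction A rule: infinite_finite_induct) auto

lemma cfun_span_dependent:
  assumes B: "finite B" and F: "\<And>i. i < Suc (card B) \<Longrightarrow> F i \<in> cfun.span B"
  shows "\<exists>c. (\<exists>i<Suc (card B). c i \<noteq> 0) \<and> (\<forall>z. (\<Sum>i<Suc (card B). c i * F i z) = 0)"
proof (cases "inj_on F {..<Suc (card B)}")
  case True
  let ?S = "F ` {..<Suc (card B)}"
  have "cfun.dependent ?S"
    using cfun.independent_span_bound[OF B, of ?S] F card_image[OF True] by fastforce
  then obtain u where u: "\<exists>v\<in>?S. u v \<noteq> 0" "(\<Sum>v\<in>?S. (\<lambda>z. u v * v z)) = 0"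
    using cfun.dependent_finite[of ?S] by auto
  have "(\<Sum>i<Suc (card B). u (F i) * F i z) = 0" for z
  proof -
    have "(\<Sum>i<Suc (card B). u (F i) * F i z) = (\<Sum>v\<in>?S. u v * v z)"
      by (simp only: sum.reindex[OF True] o_def)
    also have "\<dots> = (\<Sum>v\<in>?S. (\<lambda>z. u v * v z)) z"
      by (simp add: sum_fun_apply)
    finally show ?thesis by (simp only: u(2) zero_fun_apply)
  qed
  then show ?thesis using u(1) by (intro exI[of _ "\<lambda>i. u (F i)"]) auto
next
  case False
  then obtain i j where ij: "i < Suc (card B)" "j < Suc (card B)" "i \<noteq> j" "F i = F j"
    by (auto simp: inj_on_def)
  have "(\<Sum>k<Suc (card B). (if k = i then 1 else if k = j then -1 else 0) * F k z) = 0" for z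
  proof -
    have "(\<Sum>k<Suc (card B). (if k = i then 1 else if k = j then -1 else 0) * F k z)
        = (\<Sum>k<Suc (card B). (if k = i then F i z else 0) + (if k = j then - F j z else 0))"
      using ij by (intro sum.cong) auto
    also have "\<dots> = 0"
      using ij by (simp only: sum.distrib sum.delta finite_lessThan) simp
    finally show ?thesis .
  qed
  then show ?thesis using ij
    by (intro exI[of _ "\<lambda>k. if k = i then 1 else if k = j then -1 else 0"]) auto
qed

text \<open>If linear combinations of the \<open>F i\<close> lie in a finite-dimensional space as soon as one linear condition on
  the coefficients holds, then twice as many functions as its dimension permits are still dependent, with a
  relation that satisfies the condition: each pair \<open>F (2 k), F (2 k + 1)\<close> has a nontrivial combination
  satisfying it, and these combinations are dependent.\<close>

lemma finite_span_relation:
  fixes m :: "nat \<Rightarrow> complex" and F :: "nat \<Rightarrow> complex \<Rightarrow> complex"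
  assumes B: "finite B" and N: "N = 2 * Suc (card B)"
    and mem: "\<And>c. (\<Sum>i<N. c i * m i) = 0 \<Longrightarrow> (\<lambda>z. \<Sum>i<N. c i * F i z) \<in> cfun.span B"
  obtains c j where "j < N" "c j \<noteq> 0" "(\<Sum>i<N. c i * m i) = 0" "\<And>z. (\<Sum>i<N. c i * F i z) = 0"
proof -
  \<comment> \<open>\<open>\<alpha> k F (2 k) + \<beta> k F (2 k + 1)\<close> satisfies the linear condition\<close>
  define \<alpha> where "\<alpha> k = (if m (2*k) = 0 \<and> m (2*k+1) = 0 then 1 else m (2*k+1))" for k
  define \<beta> where "\<beta> k = (if m (2*k) = 0 \<and> m (2*k+1) = 0 then 0 else - m (2*k))" for k
  define \<gamma> where "\<gamma> k i = (if i = 2*k then \<alpha> k else 0) + (if i = 2*k+1 then \<beta> k else 0)" for k i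
  have sum\<gamma>: "(\<Sum>i<N. \<gamma> k i * x i) = \<alpha> k * x (2*k) + \<beta> k * x (2*k+1)"
    if "k < Suc (card B)" for k and x :: "nat \<Rightarrow> complex"
  proof -
    have "(\<Sum>i<N. \<gamma> k i * x i) = (\<Sum>i<N. (if i = 2*k then \<alpha> k * x (2*k) else 0) + (if i = 2*k+1 then \<beta> k * x (2*k+1) else 0))"
      by (intro sum.cong) (auto simp: \<gamma>_def)
    also have "\<dots> = \<alpha> k * x (2*k) + \<beta> k * x (2*k+1)"
      unfolding sum.distrib using that N by (simp add: sum.delta)
    finally show ?thesis .
  qed
  have m0: "(\<Sum>i<N. \<gamma> k i * m i) = 0" if "k < Suc (card B)" for k
    unfolding sum\<gamma>[OF that] by (simp add: \<alpha>_def \<beta>_def)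
  obtain d where d: "\<exists>k<Suc (card B). d k \<noteq> 0"
      "\<And>z. (\<Sum>k<Suc (card B). d k * (\<Sum>i<N. \<gamma> k i * F i z)) = 0"
    using cfun_span_dependent[OF B, of "\<lambda>k z. \<Sum>i<N. \<gamma> k i * F i z"] mem m0 by blast
  define c where "c i = (\<Sum>k<Suc (card B). d k * \<gamma> k i)" for i
  have swap: "(\<Sum>i<N. c i * x i) = (\<Sum>k<Suc (card B). d k * (\<Sum>i<N. \<gamma> k i * x i))" for x
    unfolding c_def sum_distrib_left sum_distrib_right
    by (subst sum.swap) (simp only: mult.assoc)
  obtain k where k: "k < Suc (card B)" "d k \<noteq> 0" using d by blast
  have odd_even: "2*i \<noteq> Suc (2*l)" "Suc (2*l) \<noteq> 2*i" for i l :: nat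
    by presburger+
  have ge: "\<gamma> l (2*i) = (if l = i then \<alpha> i else 0)" for l i
    using odd_even by (simp add: \<gamma>_def)
  have go: "\<gamma> l (Suc (2*i)) = (if l = i then \<beta> i else 0)" for l i
    using odd_even by (simp add: \<gamma>_def)
  have ce: "c (2*k) = d k * \<alpha> k"
  proof -
    have "c (2*k) = (\<Sum>l<Suc (card B). if l = k then d k * \<alpha> k else 0)"
      unfolding c_def by (intro sum.cong refl) (simp add: ge)
    then show ?thesis using k by simp
  qed
  have co: "c (2*k+1) = d k * \<beta> k"
  proof -
    have "c (2*k+1) = (\<Sum>l<Suc (card B). if l = k then d k * \<beta> k else 0)"
      unfolding c_def by (intro sum.cong refl) (simp add: go)
    then show ?thesis using k by simp
  qed
  have "\<alpha> k \<noteq> 0 \<or> \<beta> k \<noteq> 0"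
    by (auto simp: \<alpha>_def \<beta>_def)
  then have "\<exists>j<N. c j \<noteq> 0"
  proof
    assume "\<alpha> k \<noteq> 0" then show ?thesis using ce k N by (intro exI[of _ "2*k"]) auto
  next
    assume "\<beta> k \<noteq> 0" then show ?thesis using co k N by (intro exI[of _ "2*k+1"]) auto
  qed
  then obtain j where "j < N" "c j \<noteq> 0" by blast
  then show ?thesis
  proof (rule that)
    show "(\<Sum>i<N. c i * m i) = 0"
      unfolding swap using m0 by simp
    show "(\<Sum>i<N. c i * F i z) = 0" for z
      unfolding swap using d(2) by simp
  qed
qed

section \<open>Integrability of Cauchy transforms of functions\<close>

lemma sets_borel_ball [measurable]: "ball (a :: complex) r \<in> sets borel"
  by simp

lemma nn_integral_lborel_reflect:
  fixes z :: complex
  assumes [measurable]: "f \<in> borel_measurable borel"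
  shows "(\<integral>\<^sup>+w. f (z - w) \<partial>lborel) = (\<integral>\<^sup>+w. f w \<partial>lborel)"
proof -
  have "(\<integral>\<^sup>+w. f w \<partial>lborel) = (\<integral>\<^sup>+w. f w \<partial>density (distr lborel borel (\<lambda>x::complex. z + (-1) *\<^sub>R x)) (\<lambda>_. ennreal (\<bar>-1\<bar>^DIM(complex))))"
    by (subst lborel_affine[of "-1" z]) auto
  also have "\<dots> = (\<integral>\<^sup>+w. f (z - w) \<partial>lborel)"
    by (subst nn_integral_density) (auto simp: nn_integral_distr)
  finally show ?thesis by simp
qed

text \<open>The kernel \<open>1 / norm (z - w)\<close> is integrable over bounded sets, uniformly in \<open>z\<close>.\<close>

lemma newton_kernel_bound:
  obtains A where "0 < A"
    "\<And>z. (\<integral>\<^sup>+w. ennreal (1 / norm (z - w)) * indicator (ball 0 R) w \<partial>(lborel :: complex measure)) \<le> ennreal A"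
proof -
  let ?k = "\<lambda>w::complex. ennreal (1 / norm w) * indicator (ball 0 1) w"
  have "(\<integral>\<^sup>+w. ?k w \<partial>lborel)
    \<le> (\<integral>\<^sup>+w. 2 * ennreal (norm w powr (-1) * (1 + (norm w)\<^sup>2) powr (-2/2)) \<partial>(lborel :: complex measure))"
  proof (rule nn_integral_mono)
    fix w :: complex
    show "?k w \<le> 2 * ennreal (norm w powr (-1) * (1 + (norm w)\<^sup>2) powr (-2/2))"
    proof (cases "norm w < 1 \<and> w \<noteq> 0")
      case True
      have "(norm w)\<^sup>2 \<le> 1" using True by (simp add: power_le_one)
      then have "1 / norm w \<le> 2 * (norm w powr (-1) * (1 + (norm w)\<^sup>2) powr (-2/2))"
        using True by (simp add: powr_minus field_simps add_pos_nonneg)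
      then have "ennreal (1 / norm w) \<le> ennreal (2 * (norm w powr (-1) * (1 + (norm w)\<^sup>2) powr (-2/2)))"
        by (rule ennreal_leI)
      also have "\<dots> = 2 * ennreal (norm w powr (-1) * (1 + (norm w)\<^sup>2) powr (-2/2))"
        by (subst ennreal_mult) auto
      finally show ?thesis using True by simp
    qed auto
  qed
  also have "\<dots> = 2 * (\<integral>\<^sup>+w. ennreal (norm w powr (-1) * (1 + (norm w)\<^sup>2) powr (-2/2)) \<partial>(lborel :: complex measure))"
    by (rule nn_integral_cmult) measurable
  also have "\<dots> < \<infinity>"
    using nn_integral_power_weight[of 1 2] by (auto simp: ennreal_mult_less_top)
  finally have fin: "(\<integral>\<^sup>+w. ?k w \<partial>lborel) < \<infinity>" .
  define S where "S = (\<integral>\<^sup>+w. ?k w \<partial>lborel) + emeasure lborel (ball (0::complex) R)"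
  have Sfin: "S < \<infinity>"
    using fin emeasure_lborel_ball_finite[of "0::complex" R] by (simp add: S_def)
  have b: "(\<integral>\<^sup>+w. ennreal (1 / norm (z - w)) * indicator (ball 0 R) w \<partial>lborel) \<le> S" for z :: complex
  proof -
    have "(\<integral>\<^sup>+w. ennreal (1 / norm (z - w)) * indicator (ball 0 R) w \<partial>lborel)
       \<le> (\<integral>\<^sup>+w. ?k (z - w) + indicator (ball 0 R) w \<partial>lborel)"
    proof (rule nn_integral_mono)
      fix w
      show "ennreal (1 / norm (z - w)) * indicator (ball 0 R) w \<le> ?k (z - w) + indicator (ball 0 R) w"
      proof (cases "norm (z - w) < 1")
        case True
        then show ?thesis by (auto simp: indicator_def)
      next
        case False
        then have "ennreal (1 / norm (z - w)) \<le> 1"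
          by (simp flip: ennreal_1 add: divide_le_eq_1 ennreal_leI del: ennreal_1)
        then show ?thesis by (auto simp: indicator_def)
      qed
    qed
    also have "\<dots> = (\<integral>\<^sup>+w. ?k (z - w) \<partial>lborel) + (\<integral>\<^sup>+w. indicator (ball 0 R) w \<partial>(lborel :: complex measure))"
      by (rule nn_integral_add) measurable
    also have "(\<integral>\<^sup>+w. ?k (z - w) \<partial>lborel) = (\<integral>\<^sup>+w. ?k w \<partial>lborel)"
      by (rule nn_integral_lborel_reflect) measurable
    finally show ?thesis by (simp add: S_def)
  qed
  show ?thesis
  proof (rule that[of "enn2real S + 1"])
    show "0 < enn2real S + 1" by (simp add: add_nonneg_pos)
    fix z :: complex
    have "S = ennreal (enn2real S)" using Sfin by simp
    also have "\<dots> \<le> ennreal (enn2real S + 1)" by (rule ennreal_leI) simp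
    finally show "(\<integral>\<^sup>+w. ennreal (1 / norm (z - w)) * indicator (ball 0 R) w \<partial>lborel) \<le> ennreal (enn2real S + 1)"
      using b[of z] by (rule order_trans[rotated])
  qed
qed

lemma integrable_cauchy_kernel_bounded_near:
  fixes h :: "complex \<Rightarrow> complex"
  assumes h: "integrable lborel h" and \<rho>: "0 < \<rho>" and K: "\<And>w. w \<in> ball z \<rho> \<Longrightarrow> norm (h w) \<le> K"
  shows "integrable lborel (\<lambda>w. h w / (z - w))"
proof -
  have [measurable]: "h \<in> borel_measurable borel" using h by auto
  define R where "R = norm z + \<rho>"
  obtain A where A: "\<And>z::complex. (\<integral>\<^sup>+w. ennreal (1 / norm (z - w)) * indicator (ball 0 R) w \<partial>lborel) \<le> ennreal A"
    using newton_kernel_bound[of R] by blast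
  have K0: "K \<ge> 0" using order_trans[OF norm_ge_zero K[of z]] \<rho> by simp
  have near: "integrable lborel (\<lambda>w. (indicator (ball z \<rho>) w *\<^sub>R h w) / (z - w))"
  proof (rule integrableI_bounded)
    have "(\<integral>\<^sup>+w. ennreal (norm ((indicator (ball z \<rho>) w *\<^sub>R h w) / (z - w))) \<partial>lborel)
       \<le> (\<integral>\<^sup>+w. ennreal K * (ennreal (1 / norm (z - w)) * indicator (ball 0 R) w) \<partial>lborel)"
    proof (rule nn_integral_mono)
      fix w
      show "ennreal (norm ((indicator (ball z \<rho>) w *\<^sub>R h w) / (z - w))) \<le> ennreal K * (ennreal (1 / norm (z - w)) * indicator (ball 0 R) w)"
      proof (cases "w \<in> ball z \<rho>")
        case True
        then have "norm w < R" using norm_triangle_ineq2[of w z] by (simp add: R_def dist_norm norm_minus_commute)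
        then show ?thesis using True K[OF True] K0
          by (simp add: norm_divide divide_right_mono ennreal_leI flip: ennreal_mult)
      qed simp
    qed
    also have "\<dots> = ennreal K * (\<integral>\<^sup>+w. ennreal (1 / norm (z - w)) * indicator (ball 0 R) w \<partial>lborel)"
      by (rule nn_integral_cmult) measurable
    also have "\<dots> \<le> ennreal K * ennreal A"
      by (intro mult_left_mono A) auto
    finally show "(\<integral>\<^sup>+w. ennreal (norm ((indicator (ball z \<rho>) w *\<^sub>R h w) / (z - w))) \<partial>lborel) < \<infinity>"
      by (rule order_le_less_trans) (simp add: ennreal_mult_less_top)
  qed measurable
  have far: "integrable lborel (\<lambda>w. (indicator (- ball z \<rho>) w *\<^sub>R h w) / (z - w))"
  proof (rule integrable_cauchy_kernel[OF _ _ \<rho>])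
    show "integrable lborel (\<lambda>w. indicator (- ball z \<rho>) w *\<^sub>R h w)"
      using h by (intro integrable_mult_indicator) auto
  qed (auto simp: indicator_def dist_norm split: if_splits)
  have "(\<lambda>w. (indicator (ball z \<rho>) w *\<^sub>R h w) / (z - w) + (indicator (- ball z \<rho>) w *\<^sub>R h w) / (z - w)) = (\<lambda>w. h w / (z - w))"
    by (auto simp: fun_eq_iff indicator_def)
  then show ?thesis
    using Bochner_Integration.integrable_add[OF near far] by simp
qed

text \<open>This inequality, for all \<open>t > 0\<close>, together with the next lemma, which optimises over \<open>t\<close>, takes the
  place of the inequalities of Hoelder and Jensen.\<close>

lemma le_add_powr:
  fixes x t p :: real
  assumes "0 \<le> x" "0 < t" "1 \<le> p"
  shows "x \<le> t + t powr (1 - p) * x powr p"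
proof (cases "x \<le> t")
  case False
  then have "x = x powr (1 - p) * x powr p"
    using assms by (simp flip: powr_add)
  also have "\<dots> \<le> t powr (1 - p) * x powr p"
    using assms False by (intro mult_right_mono powr_mono2') auto
  finally show ?thesis using assms by simp
qed (use assms in \<open>simp add: add_increasing2\<close>)

lemma powr_le_of_family_bound:
  fixes x A j p :: real
  assumes A: "0 < A" and j: "0 \<le> j" and p: "1 \<le> p" and x: "0 \<le> x"
    and b: "\<And>t. 0 < t \<Longrightarrow> x \<le> t * A + t powr (1 - p) * j"
  shows "x powr p \<le> 2 powr p * A powr (p - 1) * j"
proof (cases "j = 0")
  case True
  have "x \<le> 0 + e" if "0 < e" for e
    using b[of "e / A"] A that True by simp
  then have "x \<le> 0" by (rule field_le_epsilon)
  then have "x = 0" using x by simp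
  then show ?thesis using True by simp
next
  case False
  then have j: "j > 0" using j by simp
  \<comment> \<open>both summands of the bound are equal for this \<open>t\<close>\<close>
  define t where "t = (j / A) powr (1 / p)"
  have t: "t > 0" using j A by (simp add: t_def)
  have 1: "t * A = j powr (1/p) * A powr (1 - 1/p)"
    using j A by (simp add: t_def powr_divide powr_diff)
  have "t powr (1 - p) * j = t * (t powr (-p) * j)"
    using t by (simp add: powr_diff powr_minus field_simps)
  also have "t powr (-p) = A / j"
    using j A p by (simp add: t_def powr_powr powr_minus)
  finally have 2: "t powr (1 - p) * j = t * A" using j by simp
  have "x \<le> 2 * (j powr (1/p) * A powr (1 - 1/p))"
    using b[OF t] unfolding 2 1 by simp
  then have "x powr p \<le> (2 * (j powr (1/p) * A powr (1 - 1/p))) powr p"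
    using x p by (intro powr_mono2) auto
  also have "\<dots> = 2 powr p * (j powr (1/p * p) * A powr ((1 - 1/p) * p))"
    using j A by (simp add: powr_mult powr_powr)
  also have "(1 - 1/p) * p = p - 1"
    using p by (simp add: field_simps)
  also have "2 powr p * (j powr (1/p * p) * A powr (p - 1)) = 2 powr p * A powr (p - 1) * j"
    using j p by simp
  finally show ?thesis .
qed

lemma integrable_of_Lp:
  fixes h :: "complex \<Rightarrow> complex"
  assumes p: "1 \<le> p" and [measurable]: "h \<in> borel_measurable borel"
    and supp: "\<And>w. R \<le> norm w \<Longrightarrow> h w = 0"
    and Lp: "(\<integral>\<^sup>+w. ennreal (norm (h w) powr p) \<partial>lborel) < \<infinity>"
  shows "integrable lborel h"
proof (rule integrableI_bounded)
  have "(\<integral>\<^sup>+w. ennreal (norm (h w)) \<partial>lborel)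
     \<le> (\<integral>\<^sup>+w. indicator (ball 0 R) w + ennreal (norm (h w) powr p) \<partial>lborel)"
  proof (rule nn_integral_mono)
    fix w
    show "ennreal (norm (h w)) \<le> indicator (ball 0 R) w + ennreal (norm (h w) powr p)"
    proof (cases "norm w < R")
      case True
      have "ennreal (norm (h w)) \<le> ennreal (1 + norm (h w) powr p)"
        using le_add_powr[of "norm (h w)" 1 p] p by (intro ennreal_leI) simp
      then show ?thesis using True by simp
    qed (use supp in auto)
  qed
  also have "\<dots> = (\<integral>\<^sup>+w. indicator (ball 0 R) w \<partial>(lborel :: complex measure)) + (\<integral>\<^sup>+w. ennreal (norm (h w) powr p) \<partial>lborel)"
    by (rule nn_integral_add) measurable
  also have "\<dots> < \<infinity>"
    using Lp emeasure_lborel_ball_finite[of "0::complex" R] by simp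
  finally show "(\<integral>\<^sup>+w. ennreal (norm (h w)) \<partial>lborel) < \<infinity>" .
qed simp

lemma measurable_cauchy_transform[measurable]:
  assumes [measurable]: "h \<in> borel_measurable borel"
  shows "cauchy_transform lborel h \<in> borel_measurable borel"
  unfolding cauchy_transform_def by measurable

lemma norm_cauchy_transform_le:
  "ennreal (norm (cauchy_transform M h z)) \<le> (\<integral>\<^sup>+w. ennreal (norm (h w) / norm (z - w)) \<partial>M)"
  using integral_norm_bound_ennreal[of M "\<lambda>w. h w / (z - w)"]
  by (cases "integrable M (\<lambda>w. h w / (z - w))")
     (simp_all add: cauchy_transform_def norm_divide not_integrable_integral_eq)

text \<open>Local integrability of the \<open>p\<close>-th power: the estimate \<open>norm (C h) ^ p \<le> K \<integral> norm (h w) ^ p / norm (z - w)\<close>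
  followed by an application of Tonelli's theorem.\<close>

lemma cauchy_transform_Lp_local:
  fixes h :: "complex \<Rightarrow> complex"
  assumes p: "1 \<le> p" and [measurable]: "h \<in> borel_measurable borel"
    and supp: "\<And>w. R \<le> norm w \<Longrightarrow> h w = 0"
    and Lp: "(\<integral>\<^sup>+w. ennreal (norm (h w) powr p) \<partial>lborel) < \<infinity>"
  shows "(\<integral>\<^sup>+z\<in>ball 0 r. ennreal (norm (cauchy_transform lborel h z) powr p) \<partial>lborel) < \<infinity>"
proof -
  obtain A where A: "0 < A" "\<And>z::complex. (\<integral>\<^sup>+w. ennreal (1 / norm (z - w)) * indicator (ball 0 R) w \<partial>lborel) \<le> ennreal A"
    using newton_kernel_bound[of R] by blast
  obtain A' where A': "0 < A'" "\<And>z::complex. (\<integral>\<^sup>+w. ennreal (1 / norm (z - w)) * indicator (ball 0 r) w \<partial>lborel) \<le> ennreal A'"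
    using newton_kernel_bound[of r] by blast
  define J where "J z = (\<integral>\<^sup>+w. ennreal (norm (h w) powr p / norm (z - w)) \<partial>lborel)" for z :: complex
  have [measurable]: "J \<in> borel_measurable borel"
    unfolding J_def by measurable
  define K where "K = 2 powr p * A powr (p - 1)"
  have K: "K > 0" using A by (simp add: K_def)
  have bound: "ennreal (norm (cauchy_transform lborel h z) powr p) \<le> ennreal K * J z" for z
  proof (cases "J z")
    case top
    then show ?thesis using K by (simp add: ennreal_mult_top)
  next
    case (real j)
    have "norm (cauchy_transform lborel h z) powr p \<le> 2 powr p * A powr (p - 1) * j"
    proof (rule powr_le_of_family_bound)
      fix t :: real assume t: "0 < t"
      have "ennreal (norm (cauchy_transform lborel h z)) \<le> (\<integral>\<^sup>+w. ennreal (norm (h w) / norm (z - w)) \<partial>lborel)"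
        by (rule norm_cauchy_transform_le)
      also have "\<dots> \<le> (\<integral>\<^sup>+w. ennreal t * (ennreal (1 / norm (z - w)) * indicator (ball 0 R) w)
           + ennreal (t powr (1 - p)) * ennreal (norm (h w) powr p / norm (z - w)) \<partial>lborel)"
      proof (rule nn_integral_mono)
        fix w
        show "ennreal (norm (h w) / norm (z - w)) \<le> ennreal t * (ennreal (1 / norm (z - w)) * indicator (ball 0 R) w)
           + ennreal (t powr (1 - p)) * ennreal (norm (h w) powr p / norm (z - w))"
        proof (cases "norm w < R")
          case True
          have "norm (h w) / norm (z - w) \<le> (t + t powr (1 - p) * norm (h w) powr p) / norm (z - w)"
            using le_add_powr[of "norm (h w)" t p] p t by (intro divide_right_mono) auto
          also have "\<dots> = t * (1 / norm (z - w)) + t powr (1 - p) * (norm (h w) powr p / norm (z - w))"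
            by (simp add: add_divide_distrib)
          finally have "ennreal (norm (h w) / norm (z - w)) \<le> ennreal (t * (1 / norm (z - w)) + t powr (1 - p) * (norm (h w) powr p / norm (z - w)))"
            by (rule ennreal_leI)
          also have "\<dots> = ennreal t * ennreal (1 / norm (z - w)) + ennreal (t powr (1 - p)) * ennreal (norm (h w) powr p / norm (z - w))"
            using t by (simp only: ennreal_plus ennreal_mult mult_nonneg_nonneg divide_nonneg_nonneg norm_ge_zero powr_ge_zero less_imp_le zero_le_one)
          finally show ?thesis using True by simp
        qed (use supp in auto)
      qed
      also have "\<dots> = ennreal t * (\<integral>\<^sup>+w. ennreal (1 / norm (z - w)) * indicator (ball 0 R) w \<partial>lborel) + ennreal (t powr (1 - p)) * J z"
        unfolding J_def by (subst nn_integral_add) (measurable, simp add: nn_integral_cmult)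
      also have "\<dots> \<le> ennreal t * ennreal A + ennreal (t powr (1 - p)) * ennreal j"
        using A(2)[of z] unfolding real by (intro add_mono mult_left_mono) auto
      also have "\<dots> = ennreal (t * A + t powr (1 - p) * j)"
        using t A real by (simp add: ennreal_mult ennreal_plus)
      finally show "norm (cauchy_transform lborel h z) \<le> t * A + t powr (1 - p) * j"
        using t A real by (subst (asm) ennreal_le_iff) auto
    qed (use A p real in auto)
    then have "ennreal (norm (cauchy_transform lborel h z) powr p) \<le> ennreal (K * j)"
      by (intro ennreal_leI) (simp add: K_def)
    then show ?thesis using real K by (simp add: ennreal_mult)
  qed
  have "(\<integral>\<^sup>+z\<in>ball 0 r. ennreal (norm (cauchy_transform lborel h z) powr p) \<partial>lborel)
     \<le> (\<integral>\<^sup>+z. ennreal K * (J z * indicator (ball 0 r) z) \<partial>lborel)"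
    unfolding mult.assoc[symmetric] by (intro nn_integral_mono mult_right_mono bound) auto
  also have "\<dots> = ennreal K * (\<integral>\<^sup>+z. J z * indicator (ball 0 r) z \<partial>lborel)"
    by (rule nn_integral_cmult) measurable
  also have "(\<integral>\<^sup>+z. J z * indicator (ball 0 r) z \<partial>lborel)
     = (\<integral>\<^sup>+z. \<integral>\<^sup>+w. ennreal (norm (h w) powr p / norm (z - w)) * indicator (ball 0 r) z \<partial>lborel \<partial>lborel)"
    unfolding J_def by (intro nn_integral_cong nn_integral_multc[symmetric]) measurable
  also have "\<dots> = (\<integral>\<^sup>+w. \<integral>\<^sup>+z. ennreal (norm (h w) powr p / norm (z - w)) * indicator (ball 0 r) z \<partial>lborel \<partial>lborel)"
    by (rule lborel_pair.Fubini') measurable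
  also have "\<dots> = (\<integral>\<^sup>+w. \<integral>\<^sup>+z. ennreal (norm (h w) powr p) * (ennreal (1 / norm (w - z)) * indicator (ball 0 r) z) \<partial>lborel \<partial>lborel)"
    by (intro nn_integral_cong) (simp add: norm_minus_commute mult.assoc[symmetric] flip: ennreal_mult)
  also have "\<dots> \<le> (\<integral>\<^sup>+w. ennreal (norm (h w) powr p) * ennreal A' \<partial>lborel)"
    by (intro nn_integral_mono, subst nn_integral_cmult) (auto intro!: mult_left_mono A'(2))
  also have "\<dots> = (\<integral>\<^sup>+w. ennreal (norm (h w) powr p) \<partial>lborel) * ennreal A'"
    by (rule nn_integral_multc) measurable
  finally have "(\<integral>\<^sup>+z\<in>ball 0 r. ennreal (norm (cauchy_transform lborel h z) powr p) \<partial>lborel)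
     \<le> ennreal K * ((\<integral>\<^sup>+w. ennreal (norm (h w) powr p) \<partial>lborel) * ennreal A')"
    by (simp add: mult_left_mono)
  also have "\<dots> < \<infinity>"
    using Lp by (simp add: ennreal_mult_less_top)
  finally show ?thesis .
qed

text \<open>If \<open>h\<close> has integral \<open>0\<close>, the term of order \<open>1 / z\<close> in the expansion at infinity vanishes.\<close>

lemma cauchy_transform_decay:
  assumes h: "integrable lborel h" and supp: "\<And>w. R \<le> norm w \<Longrightarrow> h w = 0" and R: "0 < R"
    and mean: "(\<integral>w. h w \<partial>lborel) = 0" and z: "2 * R \<le> norm z"
  shows "norm (cauchy_transform lborel h z) \<le> 2 * R * (\<integral>w. norm (h w) \<partial>lborel) / (norm z)\<^sup>2"
proof -
  have z0: "z \<noteq> 0" using z R by auto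
  have far: "norm z / 2 \<le> norm (z - w)" if "h w \<noteq> 0" for w
  proof -
    have "norm w < R" using supp[of w] that by force
    then show ?thesis using norm_triangle_ineq2[of z w] z by linarith
  qed
  have i: "integrable lborel (\<lambda>w. h w / (z - w))"
    by (rule integrable_cauchy_kernel[OF h, of "norm z / 2"]) (use z0 far in auto)
  have "cauchy_transform lborel h z = (\<integral>w. h w / (z - w) \<partial>lborel) - (\<integral>w. h w / z \<partial>lborel)"
    using mean by (simp add: cauchy_transform_def)
  also have "\<dots> = (\<integral>w. h w / (z - w) - h w / z \<partial>lborel)"
    using h i by (simp add: Bochner_Integration.integral_diff)
  also have "norm \<dots> \<le> (\<integral>w. norm (h w) * (2 * R / (norm z)\<^sup>2) \<partial>lborel)"
  proof (rule Bochner_Integration.integral_norm_bound_integral)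
    show "integrable lborel (\<lambda>w. h w / (z - w) - h w / z)" using h i by simp
    show "integrable lborel (\<lambda>w. norm (h w) * (2 * R / (norm z)\<^sup>2))" using h by simp
    fix w
    show "norm (h w / (z - w) - h w / z) \<le> norm (h w) * (2 * R / (norm z)\<^sup>2)"
    proof (cases "h w = 0")
      case False
      have zw: "z \<noteq> w" using far[OF False] z0 by auto
      have "norm w \<le> R" using supp[of w] False by force
      have "h w / (z - w) - h w / z = h w * (w / ((z - w) * z))"
        using z0 zw by (simp add: field_simps)
      then have "norm (h w / (z - w) - h w / z) = norm (h w) * (norm w / (norm (z - w) * norm z))"
        by (simp add: norm_mult norm_divide)
      also have "\<dots> \<le> norm (h w) * (R / (norm z / 2 * norm z))"
        using \<open>norm w \<le> R\<close> far[OF False] z0 R by (intro mult_left_mono frac_le mult_right_mono) auto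
      also have "\<dots> = norm (h w) * (2 * R / (norm z)\<^sup>2)"
        by (simp add: power2_eq_square)
      finally show ?thesis .
    qed simp
  qed
  finally show ?thesis using h by (simp add: mult_ac)
qed

text \<open>Decay of order \<open>1 / (norm z)\<^sup>2\<close> makes the \<open>p\<close>-th power integrable at infinity; for \<open>p = 2\<close> the decay of
  order \<open>1 / norm z\<close> that is available without the condition on the mean would not be enough.\<close>

lemma cauchy_transform_Lp:
  fixes h :: "complex \<Rightarrow> complex"
  assumes p: "2 \<le> p" and [measurable]: "h \<in> borel_measurable borel"
    and supp: "\<And>w. R \<le> norm w \<Longrightarrow> h w = 0"
    and Lp: "(\<integral>\<^sup>+w. ennreal (norm (h w) powr p) \<partial>lborel) < \<infinity>"
    and mean: "(\<integral>w. h w \<partial>lborel) = 0"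
  shows "(\<integral>\<^sup>+z. ennreal (norm (cauchy_transform lborel h z) powr p) \<partial>lborel) < \<infinity>"
proof -
  define R' where "R' = max 1 R"
  have R': "R' \<ge> 1" and supp': "\<And>w. R' \<le> norm w \<Longrightarrow> h w = 0"
    using supp by (auto simp: R'_def)
  have h: "integrable lborel h"
    using integrable_of_Lp[OF _ _ supp Lp] p by simp
  define K where "K = 2 * R' * (\<integral>w. norm (h w) \<partial>lborel)"
  have K: "K \<ge> 0" using R' by (simp add: K_def)
  have far: "ennreal (norm (cauchy_transform lborel h z) powr p)
     \<le> ennreal (4 * K powr p) * ennreal (norm z powr (-0) * (1 + (norm z)\<^sup>2) powr (-4/2))"
    if "z \<notin> ball 0 (2 * R')" for z
  proof -
    have z: "1 \<le> norm z" "2 * R' \<le> norm z" using that R' by auto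
    have "norm (cauchy_transform lborel h z) powr p \<le> (K / (norm z)\<^sup>2) powr p"
      using cauchy_transform_decay[OF h supp' _ mean z(2)] R' p by (intro powr_mono2) (auto simp: K_def)
    also have "\<dots> = K powr p * (norm z) powr (- 2 * p)"
      using K z by (simp add: powr_divide powr_powr powr_minus_divide flip: powr_numeral)
    also have "\<dots> \<le> K powr p * norm z powr (- 4)"
      using z p by (intro mult_left_mono powr_mono) auto
    also have "\<dots> \<le> K powr p * (4 * (1 + (norm z)\<^sup>2) powr (-2))"
    proof (rule mult_left_mono)
      have "norm z powr (- 4) = 4 * (2 * (norm z)\<^sup>2) powr (-2)"
        using z by (simp add: powr_minus powr_mult powr_powr flip: powr_numeral)
      also have "(2 * (norm z)\<^sup>2) powr (-2) \<le> (1 + (norm z)\<^sup>2) powr (-2)"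
        using z by (intro powr_mono2') (auto simp: add_pos_nonneg)
      finally show "norm z powr (- 4) \<le> 4 * (1 + (norm z)\<^sup>2) powr (-2)" by simp
    qed simp
    also have "\<dots> = (4 * K powr p) * (norm z powr (-0) * (1 + (norm z)\<^sup>2) powr (-4/2))"
      using z by auto
    finally have "norm (cauchy_transform lborel h z) powr p
      \<le> (4 * K powr p) * (norm z powr (-0) * (1 + (norm z)\<^sup>2) powr (-4/2))" .
    then show ?thesis by (simp add: ennreal_leI flip: ennreal_mult)
  qed
  have "(\<integral>\<^sup>+z. ennreal (norm (cauchy_transform lborel h z) powr p) \<partial>lborel)
    \<le> (\<integral>\<^sup>+z. ennreal (norm (cauchy_transform lborel h z) powr p) * indicator (ball 0 (2 * R')) z
        + ennreal (4 * K powr p) * ennreal (norm z powr (-0) * (1 + (norm z)\<^sup>2) powr (-4/2)) \<partial>lborel)"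
  proof (rule nn_integral_mono)
    fix z
    show "ennreal (norm (cauchy_transform lborel h z) powr p)
       \<le> ennreal (norm (cauchy_transform lborel h z) powr p) * indicator (ball 0 (2 * R')) z
        + ennreal (4 * K powr p) * ennreal (norm z powr (-0) * (1 + (norm z)\<^sup>2) powr (-4/2))"
    proof (cases "z \<in> ball 0 (2 * R')")
      case False
      show ?thesis
        using far[OF False] unfolding indicator_simps(2)[OF False] by (simp only: mult_zero_right add_0)
    qed simp
  qed
  also have "\<dots> = (\<integral>\<^sup>+z\<in>ball 0 (2 * R'). ennreal (norm (cauchy_transform lborel h z) powr p) \<partial>lborel)
      + (\<integral>\<^sup>+z. ennreal (4 * K powr p) * ennreal (norm z powr (-0) * (1 + (norm z)\<^sup>2) powr (-4/2)) \<partial>(lborel :: complex measure))"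
    by (rule nn_integral_add) measurable
  also have "(\<integral>\<^sup>+z. ennreal (4 * K powr p) * ennreal (norm z powr (-0) * (1 + (norm z)\<^sup>2) powr (-4/2)) \<partial>(lborel :: complex measure))
     = ennreal (4 * K powr p) * (\<integral>\<^sup>+z. ennreal (norm z powr (-0) * (1 + (norm z)\<^sup>2) powr (-4/2)) \<partial>(lborel :: complex measure))"
    by (rule nn_integral_cmult) measurable
  also have "(\<integral>\<^sup>+z\<in>ball 0 (2 * R'). ennreal (norm (cauchy_transform lborel h z) powr p) \<partial>lborel)
     + ennreal (4 * K powr p) * (\<integral>\<^sup>+z. ennreal (norm z powr (-0) * (1 + (norm z)\<^sup>2) powr (-4/2)) \<partial>(lborel :: complex measure)) < \<infinity>"
    using cauchy_transform_Lp_local[of p h R, OF _ _ supp Lp, of "2 * R'"] nn_integral_power_weight[of 0 4] p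
    by (auto simp: ennreal_mult_less_top)
  finally show ?thesis .
qed

section \<open>Boundary integrals over rectangles\<close>

text \<open>The contour integral of \<open>f\<close> along the positively oriented boundary of the rectangle with lower left corner
  \<open>a\<close> and upper right corner \<open>b\<close>, written as four one-dimensional integrals. The orientation is right only if
  \<open>Re a \<le> Re b\<close> and \<open>Im a \<le> Im b\<close>.\<close>

definition rectangle_integral :: "complex \<Rightarrow> complex \<Rightarrow> (complex \<Rightarrow> complex) \<Rightarrow> complex" where
  "rectangle_integral a b f =
     integral {Re a..Re b} (\<lambda>x. f (Complex x (Im a)))
     + \<i> * integral {Im a..Im b} (\<lambda>y. f (Complex (Re b) y))
     - integral {Re a..Re b} (\<lambda>x. f (Complex x (Im b)))
     - \<i> * integral {Im a..Im b} (\<lambda>y. f (Complex (Re a) y))"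

lemma contour_integral_linepath_horizontal:
  assumes ab: "a < b"
  shows "contour_integral (linepath (Complex a c) (Complex b c)) f = integral {a..b} (\<lambda>x. f (Complex x c))"
proof -
  have "contour_integral (linepath (Complex a c) (Complex b c)) f
      = of_real (b - a) * integral {0..1} (\<lambda>t. f (Complex (a + (b - a) * t) c))"
  proof -
    have "linepath (Complex a c) (Complex b c) t = Complex (a + (b - a) * t) c" for t
      by (simp add: linepath_def complex_eq_iff algebra_simps)
    moreover have "Complex b c - Complex a c = of_real (b - a)"
      by (simp add: complex_eq_iff)
    moreover have "contour_integral (linepath A B) f = (B - A) * integral {0..1} (\<lambda>t. f (linepath A B t))" for A B
      by (simp add: contour_integral_integral)
    ultimately show ?thesis
      by simp
  qed
  also have "integral {0..1} (\<lambda>t. f (Complex (a + (b - a) * t) c))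
      = integral ((\<lambda>x. x / (b - a)) ` {0..b - a}) (\<lambda>t. f (Complex (a + (b - a) * t) c))"
    using ab by simp
  also have "\<dots> = integral {a - a..b - a} (\<lambda>x. f (Complex (x + a) c)) / of_real (b - a)"
    using ab by (subst integral_stretch_real) (auto simp: scaleR_conv_of_real add_ac)
  also have "\<dots> = integral {a..b} (\<lambda>x. f (Complex x c)) / of_real (b - a)"
    by (subst integral_shift_real_ivl) (rule refl)
  finally show ?thesis using ab by simp
qed

lemma contour_integral_rectpath:
  assumes ab: "Re a < Re b" "Im a < Im b"
    and f: "continuous_on (path_image (rectpath a b)) f"
  shows "contour_integral (rectpath a b) f = rectangle_integral a b f"
proof -
  let ?a2 = "Complex (Re b) (Im a)" and ?a4 = "Complex (Re a) (Im b)"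
  have img: "path_image (rectpath a b) =
      closed_segment a ?a2 \<union> closed_segment ?a2 b \<union> closed_segment b ?a4 \<union> closed_segment ?a4 a"
    by (simp add: rectpath_def Let_def path_image_join Un_assoc)
  have c: "f contour_integrable_on linepath a ?a2" "f contour_integrable_on linepath ?a2 b"
      "f contour_integrable_on linepath b ?a4" "f contour_integrable_on linepath ?a4 a"
    by (rule contour_integrable_continuous_linepath, rule continuous_on_subset[OF f], force simp: img)+
  have "contour_integral (rectpath a b) f
     = contour_integral (linepath a ?a2) f + contour_integral (linepath ?a2 b) f
       + contour_integral (linepath b ?a4) f + contour_integral (linepath ?a4 a) f"
    using c by (simp add: rectpath_def Let_def contour_integral_join contour_integrable_joinI)
  also have "contour_integral (linepath b ?a4) f = - contour_integral (linepath ?a4 b) f"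
    by (rule contour_integral_reverse_linepath)
      (rule continuous_on_subset[OF f], auto simp: img closed_segment_commute)
  also have "contour_integral (linepath ?a4 a) f = - contour_integral (linepath a ?a4) f"
    by (rule contour_integral_reverse_linepath)
      (rule continuous_on_subset[OF f], auto simp: img closed_segment_commute)
  also have "contour_integral (linepath a ?a2) f = integral {Re a..Re b} (\<lambda>x. f (Complex x (Im a)))"
    using contour_integral_linepath_horizontal[OF ab(1), of "Im a" f] by simp
  also have "contour_integral (linepath ?a4 b) f = integral {Re a..Re b} (\<lambda>x. f (Complex x (Im b)))"
    using contour_integral_linepath_horizontal[OF ab(1), of "Im b" f] by simp
  also have "contour_integral (linepath ?a2 b) f = \<i> * integral {Im a..Im b} (\<lambda>y. f (Complex (Re b) y))"
    by (rule contour_integral_linepath_same_Re) (use ab in auto)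
  also have "contour_integral (linepath a ?a4) f = \<i> * integral {Im a..Im b} (\<lambda>y. f (Complex (Re a) y))"
    by (rule contour_integral_linepath_same_Re) (use ab in auto)
  finally show ?thesis by (simp add: rectangle_integral_def)
qed

lemma rectangle_integral_cauchy_kernel:
  assumes ab: "Re a < Re b" "Im a < Im b" and w: "w \<notin> cbox a b - box a b"
  shows "rectangle_integral a b (\<lambda>z. 1 / (z - w)) = 2 * of_real pi * \<i> * indicator (box a b) w"
proof -
  have w': "w \<notin> path_image (rectpath a b)"
    using w ab by (simp add: path_image_rectpath_cbox_minus_box)
  have "winding_number (rectpath a b) w = 1 / (2 * pi * \<i>) * contour_integral (rectpath a b) (\<lambda>z. 1 / (z - w))"
    by (rule winding_number_valid_path) (use w' in auto)
  also have "contour_integral (rectpath a b) (\<lambda>z. 1 / (z - w)) = rectangle_integral a b (\<lambda>z. 1 / (z - w))"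
    by (rule contour_integral_rectpath[OF ab]) (use w' in \<open>auto intro!: continuous_intros\<close>)
  finally have "rectangle_integral a b (\<lambda>z. 1 / (z - w)) = 2 * of_real pi * \<i> * winding_number (rectpath a b) w"
    by (simp add: field_simps)
  moreover have "winding_number (rectpath a b) w = indicator (box a b) w"
    using w winding_number_rectpath[of w a b] winding_number_rectpath_outside[of a b w] ab
    by (auto simp: indicator_def)
  ultimately show ?thesis by simp
qed

lemma integral_segment_cauchy_transform:
  fixes k :: "complex \<Rightarrow> complex" and l :: "real \<Rightarrow> complex"
  assumes [measurable]: "k \<in> borel_measurable borel" and K: "\<And>w. norm (k w) \<le> K"
    and supp: "\<And>w. R \<le> norm w \<Longrightarrow> k w = 0"
    and cont: "continuous_on UNIV (cauchy_transform lborel k)"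
    and l: "continuous_on UNIV l"
  shows "integral {c..d} (\<lambda>t. cauchy_transform lborel k (l t))
           = (\<integral>w. k w * (LINT t:{c..d}|lborel. 1 / (l t - w)) \<partial>lborel)" (is ?eq)
    and "integrable lborel (\<lambda>w. k w * (LINT t:{c..d}|lborel. 1 / (l t - w)))" (is ?int)
proof -
  have [measurable]: "l \<in> borel_measurable borel"
    using l by (rule borel_measurable_continuous_onI)
  obtain A where A: "0 < A" "\<And>z::complex. (\<integral>\<^sup>+w. ennreal (1 / norm (z - w)) * indicator (ball 0 R) w \<partial>lborel) \<le> ennreal A"
    using newton_kernel_bound[of R] by blast
  have K0: "K \<ge> 0" using K[of 0] norm_ge_zero order_trans by blast
  let ?f = "\<lambda>t w. indicator {c..d} t *\<^sub>R (k w / (l t - w))"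
  have int: "integrable (lborel \<Otimes>\<^sub>M lborel) (case_prod ?f)"
  proof (rule integrableI_bounded)
    have "(\<integral>\<^sup>+p. ennreal (norm (case_prod ?f p)) \<partial>(lborel \<Otimes>\<^sub>M lborel))
       = (\<integral>\<^sup>+t. \<integral>\<^sup>+w. ennreal (norm (?f t w)) \<partial>lborel \<partial>lborel)"
      by (subst lborel.nn_integral_fst[symmetric]) auto
    also have "\<dots> \<le> (\<integral>\<^sup>+t. ennreal (K * A) * indicator {c..d} t \<partial>lborel)"
    proof (rule nn_integral_mono)
      fix t
      have "(\<integral>\<^sup>+w. ennreal (norm (?f t w)) \<partial>lborel)
         \<le> (\<integral>\<^sup>+w. (ennreal K * indicator {c..d} t) * (ennreal (1 / norm (l t - w)) * indicator (ball 0 R) w) \<partial>lborel)"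
      proof (rule nn_integral_mono)
        fix w
        show "ennreal (norm (?f t w)) \<le> (ennreal K * indicator {c..d} t) * (ennreal (1 / norm (l t - w)) * indicator (ball 0 R) w)"
        proof (cases "norm w < R \<and> t \<in> {c..d}")
          case True
          then show ?thesis using K[of w] K0
            by (simp add: norm_divide divide_right_mono ennreal_leI flip: ennreal_mult)
        qed (use supp[of w] in \<open>auto simp: indicator_def\<close>)
      qed
      also have "\<dots> = (ennreal K * indicator {c..d} t) * (\<integral>\<^sup>+w. ennreal (1 / norm (l t - w)) * indicator (ball 0 R) w \<partial>lborel)"
        by (rule nn_integral_cmult) measurable
      also have "\<dots> \<le> (ennreal K * indicator {c..d} t) * ennreal A"
        by (intro mult_left_mono A) auto
      finally show "(\<integral>\<^sup>+w. ennreal (norm (?f t w)) \<partial>lborel) \<le> ennreal (K * A) * indicator {c..d} t"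
        using K0 A by (simp add: ennreal_mult mult_ac)
    qed
    also have "\<dots> < \<infinity>"
      by (simp add: nn_integral_cmult_indicator ennreal_mult_less_top emeasure_lborel_Icc_eq)
    finally show "(\<integral>\<^sup>+p. ennreal (norm (case_prod ?f p)) \<partial>(lborel \<Otimes>\<^sub>M lborel)) < \<infinity>" .
  qed (auto simp: case_prod_beta')
  have inner: "(\<integral>t. ?f t w \<partial>lborel) = k w * (LINT t:{c..d}|lborel. 1 / (l t - w))" for w
  proof -
    have "(\<integral>t. ?f t w \<partial>lborel) = (\<integral>t. k w * (indicator {c..d} t *\<^sub>R (1 / (l t - w))) \<partial>lborel)"
      by (intro Bochner_Integration.integral_cong) (auto simp: scaleR_conv_of_real)
    then show ?thesis
      by (simp only: set_lebesgue_integral_def integral_mult_right_zero)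
  qed
  have outer: "(\<integral>w. ?f t w \<partial>lborel) = indicator {c..d} t *\<^sub>R cauchy_transform lborel k (l t)" for t
    by (simp add: cauchy_transform_def)
  have "continuous_on {c..d} (\<lambda>t. cauchy_transform lborel k (l t))"
    by (rule continuous_on_compose2[OF cont continuous_on_subset[OF l]]) auto
  then have "set_integrable lborel {c..d} (\<lambda>t. cauchy_transform lborel k (l t))"
    by (rule borel_integrable_atLeastAtMost')
  then have "integral {c..d} (\<lambda>t. cauchy_transform lborel k (l t)) = (\<integral>t. \<integral>w. ?f t w \<partial>lborel \<partial>lborel)"
    unfolding outer by (subst set_borel_integral_eq_integral(2)[symmetric]) (auto simp: set_lebesgue_integral_def)
  also have "\<dots> = (\<integral>w. \<integral>t. ?f t w \<partial>lborel \<partial>lborel)"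
    using lborel_pair.Fubini_integral[OF int] by simp
  finally show ?eq unfolding inner .
  show ?int
    using lborel_pair.integrable_snd[OF int] unfolding inner .
qed

text \<open>In distributional language: the \<open>\<partial>\<close>-bar derivative of \<open>C k\<close> is \<open>\<pi> k\<close>. The contour integral and the area
  integral are exchanged, and the contour integral of the kernel is \<open>2 \<pi> \<i>\<close> times a winding number.\<close>

lemma rectangle_integral_cauchy_transform:
  fixes k :: "complex \<Rightarrow> complex"
  assumes ab: "Re a < Re b" "Im a < Im b"
    and m[measurable]: "k \<in> borel_measurable borel" and K: "\<And>w. norm (k w) \<le> K"
    and supp: "\<And>w. R \<le> norm w \<Longrightarrow> k w = 0"
    and cont: "continuous_on UNIV (cauchy_transform lborel k)"
  shows "rectangle_integral a b (cauchy_transform lborel k)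
     = 2 * of_real pi * \<i> * (LINT w:cbox a b|lborel. k w)"
proof -
  let ?L = "\<lambda>c d l w. LINT t:{c..d}|lborel. 1 / (l t - w :: complex)"
  define L1 where "L1 = ?L (Re a) (Re b) (\<lambda>x. Complex x (Im a))"
  define L2 where "L2 = ?L (Im a) (Im b) (\<lambda>y. Complex (Re b) y)"
  define L3 where "L3 = ?L (Re a) (Re b) (\<lambda>x. Complex x (Im b))"
  define L4 where "L4 = ?L (Im a) (Im b) (\<lambda>y. Complex (Re a) y)"
  have cH: "continuous_on UNIV (\<lambda>x. Complex x c)" and cV: "continuous_on UNIV (\<lambda>y. Complex c y)" for c
    by (auto simp: Complex_eq intro!: continuous_intros)
  note segH = integral_segment_cauchy_transform[OF m K supp cont cH]
  note segV = integral_segment_cauchy_transform[OF m K supp cont cV]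
  have i: "integrable lborel (\<lambda>w. k w * L1 w)" "integrable lborel (\<lambda>w. k w * L2 w)"
      "integrable lborel (\<lambda>w. k w * L3 w)" "integrable lborel (\<lambda>w. k w * L4 w)"
    unfolding L1_def L2_def L3_def L4_def by (intro segH(2) segV(2); assumption)+
  have "rectangle_integral a b (cauchy_transform lborel k)
     = (\<integral>w. k w * L1 w \<partial>lborel) + \<i> * (\<integral>w. k w * L2 w \<partial>lborel)
       - (\<integral>w. k w * L3 w \<partial>lborel) - \<i> * (\<integral>w. k w * L4 w \<partial>lborel)"
    unfolding rectangle_integral_def L1_def L2_def L3_def L4_def by (simp add: segH(1) segV(1))
  also have "\<dots> = (\<integral>w. k w * L1 w + \<i> * (k w * L2 w) - k w * L3 w - \<i> * (k w * L4 w) \<partial>lborel)"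
    using i by simp
  also have "\<dots> = (\<integral>w. 2 * of_real pi * \<i> * (indicator (cbox a b) w *\<^sub>R k w) \<partial>lborel)"
  proof (rule integral_cong_AE)
    have null: "cbox a b - box a b \<in> null_sets lborel"
    proof -
      have "emeasure lborel (cbox a b - box a b) = emeasure lborel (cbox a b) - emeasure lborel (box a b)"
        by (rule emeasure_Diff) (auto simp: box_subset_cbox emeasure_lborel_box_eq)
      also have "\<dots> = 0"
        by (simp add: emeasure_lborel_box_eq emeasure_lborel_cbox_eq)
      finally show ?thesis by (simp add: null_sets_def)
    qed
    show "AE w in lborel. k w * L1 w + \<i> * (k w * L2 w) - k w * L3 w - \<i> * (k w * L4 w)
        = 2 * of_real pi * \<i> * (indicator (cbox a b) w *\<^sub>R k w)"
      using AE_not_in[OF null]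
    proof eventually_elim
      case (elim w)
      have e: "?L c d l w = integral {c..d} (\<lambda>t. 1 / (l t - w))"
        if "continuous_on UNIV l" "\<And>t. t \<in> {c..d} \<Longrightarrow> l t \<noteq> w" for c d :: real and l
      proof -
        have "continuous_on {c..d} (\<lambda>t. 1 / (l t - w))"
          using that(2) by (intro continuous_intros continuous_on_subset[OF that(1)]) auto
        then show ?thesis
          by (intro set_borel_integral_eq_integral(2) borel_integrable_atLeastAtMost')
      qed
      have "L1 w = integral {Re a..Re b} (\<lambda>x. 1 / (Complex x (Im a) - w))"
           "L2 w = integral {Im a..Im b} (\<lambda>y. 1 / (Complex (Re b) y - w))"
           "L3 w = integral {Re a..Re b} (\<lambda>x. 1 / (Complex x (Im b) - w))"
           "L4 w = integral {Im a..Im b} (\<lambda>y. 1 / (Complex (Re a) y - w))"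
        unfolding L1_def L2_def L3_def L4_def using elim ab
        by (intro e cH cV; force simp: in_cbox_complex_iff in_box_complex_iff)+
      then have "L1 w + \<i> * L2 w - L3 w - \<i> * L4 w = rectangle_integral a b (\<lambda>z. 1 / (z - w))"
        by (simp add: rectangle_integral_def)
      also have "\<dots> = 2 * of_real pi * \<i> * indicator (box a b) w"
        by (rule rectangle_integral_cauchy_kernel[OF ab elim])
      also have "indicator (box a b) w = (indicator (cbox a b) w :: complex)"
        using elim box_subset_cbox[of a b] by (auto simp: indicator_def)
      finally have "k w * (L1 w + \<i> * L2 w - L3 w - \<i> * L4 w) = k w * (2 * of_real pi * \<i> * indicator (cbox a b) w)"
        by simp
      then show ?case
        by (simp add: algebra_simps scaleR_conv_of_real of_real_indicator)
    qed
  qed (use i in measurable)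
  finally show ?thesis
    by (simp only: set_lebesgue_integral_def integral_mult_right_zero)
qed

lemma continuous_on_cauchy_transform:
  fixes k :: "complex \<Rightarrow> complex"
  assumes k: "continuous_on UNIV k" and supp: "\<And>w. R \<le> norm w \<Longrightarrow> k w = 0" and K: "\<And>w. norm (k w) \<le> K"
  shows "continuous_on UNIV (cauchy_transform lborel k)"
proof -
  have [measurable]: "k \<in> borel_measurable borel"
    using k by (rule borel_measurable_continuous_onI)
  have K0: "K \<ge> 0" using K[of 0] norm_ge_zero order_trans by blast
  have shift: "cauchy_transform lborel k z = (\<integral>w. k (z - w) / w \<partial>lborel)" for z
  proof -
    have "cauchy_transform lborel k z = (\<integral>w. k w / (z - w) \<partial>density (distr lborel borel (\<lambda>x::complex. z + (-1) *\<^sub>R x)) (\<lambda>_. ennreal (\<bar>-1\<bar>^DIM(complex))))"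
      unfolding cauchy_transform_def by (subst lborel_affine[of "-1" z]) auto
    also have "\<dots> = (\<integral>w. k (z - w) / w \<partial>lborel)"
      by (simp add: density_1 integral_distr)
    finally show ?thesis .
  qed
  have "((\<lambda>n. cauchy_transform lborel k (x n)) \<longlongrightarrow> cauchy_transform lborel k z) sequentially"
    if x: "x \<longlonglongrightarrow> z" for x z
  proof -
    obtain B where B: "\<And>n. norm (x n) \<le> B"
      using convergent_imp_bounded[OF x] by (auto simp: bounded_iff)
    have zB: "norm z \<le> B"
      using B by (intro LIMSEQ_le_const2[OF tendsto_norm[OF x]]) auto
    let ?w = "\<lambda>w::complex. K * (1 / norm w * indicator (ball 0 (R + B)) w)"
    show ?thesis
      unfolding shift
    proof (rule integral_dominated_convergence)
      have "integrable lborel (\<lambda>w::complex. 1 / norm w * indicator (ball 0 (R + B)) w)"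
      proof (rule integrableI_bounded)
        obtain A where "\<And>z::complex. (\<integral>\<^sup>+w. ennreal (1 / norm (z - w)) * indicator (ball 0 (R + B)) w \<partial>lborel) \<le> ennreal A"
          using newton_kernel_bound[of "R + B"] by blast
        from this[of 0] have "(\<integral>\<^sup>+w. ennreal (1 / norm w) * indicator (ball 0 (R + B)) w \<partial>(lborel :: complex measure)) \<le> ennreal A"
          by simp
        moreover have "(\<integral>\<^sup>+w. ennreal (norm (1 / norm w * indicator (ball 0 (R + B)) w)) \<partial>(lborel :: complex measure))
           = (\<integral>\<^sup>+w. ennreal (1 / norm w) * indicator (ball 0 (R + B)) w \<partial>(lborel :: complex measure))"
          by (intro nn_integral_cong) (auto simp: indicator_def)
        ultimately show "(\<integral>\<^sup>+w. ennreal (norm (1 / norm w * indicator (ball 0 (R + B)) w)) \<partial>(lborel :: complex measure)) < \<infinity>"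
          using ennreal_less_top[of A] by (simp add: order_le_less_trans)
      qed measurable
      then show "integrable lborel ?w"
        by (rule integrable_mult_right)
      show "AE w in lborel. (\<lambda>n. k (x n - w) / w) \<longlonglongrightarrow> k (z - w) / w"
      proof (rule AE_I2)
        fix w :: complex
        have "isCont k (z - w)"
          using k by (simp add: continuous_on_eq_continuous_at)
        then have "(\<lambda>n. k (x n - w)) \<longlonglongrightarrow> k (z - w)"
          by (rule isCont_tendsto_compose) (intro tendsto_intros x)
        then show "(\<lambda>n. k (x n - w) / w) \<longlonglongrightarrow> k (z - w) / w"
          unfolding divide_inverse by (intro tendsto_intros)
      qed
      show "AE w in lborel. norm (k (x n - w) / w) \<le> ?w w" for n
      proof (rule AE_I2)
        fix w :: complex
        show "norm (k (x n - w) / w) \<le> ?w w"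
        proof (cases "R \<le> norm (x n - w)")
          case True
          then show ?thesis using supp K0 by simp
        next
          case False
          then have "norm w < R + B"
            using B[of n] norm_triangle_ineq4[of "x n" "x n - w"] by simp
          then show ?thesis
            using K[of "x n - w"] by (simp add: norm_divide divide_right_mono)
        qed
      qed
    qed measurable
  qed
  then show ?thesis
    by (auto simp: continuous_on_sequentially comp_def)
qed

section \<open>The theorems of Green and Morera, and localisation of singularities\<close>

text \<open>Green's theorem in complex form on a rectangle.\<close>

lemma green_rectangle:
  fixes u ux uy :: "complex \<Rightarrow> complex"
  assumes ab: "Re a \<le> Re b" "Im a \<le> Im b"
    and cx: "continuous_on (cbox a b) ux" and cy: "continuous_on (cbox a b) uy"
    and dx: "\<And>x y. Complex x y \<in> cbox a b \<Longrightarrow>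
        ((\<lambda>x. u (Complex x y)) has_vector_derivative ux (Complex x y)) (at x)"
    and dy: "\<And>x y. Complex x y \<in> cbox a b \<Longrightarrow>
        ((\<lambda>y. u (Complex x y)) has_vector_derivative uy (Complex x y)) (at y)"
  shows "rectangle_integral a b u = \<i> * (LINT z:cbox a b|lborel. ux z + \<i> * uy z)"
proof -
  have ix: "set_integrable lborel (cbox a b) ux" and iy: "set_integrable lborel (cbox a b) uy"
    unfolding set_integrable_def by (intro borel_integrable_compact cx cy compact_cbox)+
  have cH: "continuous_on S (\<lambda>x. Complex x c)" and cV: "continuous_on S (\<lambda>y. Complex c y)" for c S
    by (auto simp: Complex_eq intro!: continuous_intros)
  have FTC: "(\<integral>x. indicator {c..d} x *\<^sub>R f' x \<partial>lborel) = f d - f c" "f' integrable_on {c..d}"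
      "continuous_on {c..d} f"
    if "c \<le> d" "\<And>x. x \<in> {c..d} \<Longrightarrow> (f has_vector_derivative f' x) (at x)" "continuous_on {c..d} f'"
    for c d :: real and f f' :: "real \<Rightarrow> complex"
  proof -
    show "(\<integral>x. indicator {c..d} x *\<^sub>R f' x \<partial>lborel) = f d - f c"
      by (rule integral_FTC_atLeastAtMost) (use that in \<open>auto intro: has_vector_derivative_at_within\<close>)
    show "continuous_on {c..d} f"
      by (rule continuous_on_vector_derivative) (use that in \<open>auto intro: has_vector_derivative_at_within\<close>)
    show "f' integrable_on {c..d}"
      using that by (intro integrable_continuous_real)
  qed
  have conv: "(\<integral>y. indicator {c..d} y *\<^sub>R (f y - g y) \<partial>lborel) = integral {c..d} f - integral {c..d} g"
    if "continuous_on {c..d} f" "continuous_on {c..d} g" for c d :: real and f g :: "real \<Rightarrow> complex"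
  proof -
    have "(\<integral>y. indicator {c..d} y *\<^sub>R (f y - g y) \<partial>lborel) = (LINT y:{c..d}|lborel. f y - g y)"
      by (simp add: set_lebesgue_integral_def)
    also have "\<dots> = integral {c..d} (\<lambda>y. f y - g y)"
      by (intro set_borel_integral_eq_integral borel_integrable_atLeastAtMost' continuous_intros that)
    also have "\<dots> = integral {c..d} f - integral {c..d} g"
      by (intro Henstock_Kurzweil_Integration.integral_diff integrable_continuous_real that)
    finally show ?thesis .
  qed
  have cu: "continuous_on {Im a..Im b} (\<lambda>y. u (Complex x y))" if "x \<in> {Re a..Re b}" for x
    by (rule FTC(3)[where f' = "\<lambda>y. uy (Complex x y)"])
      (use ab that in \<open>auto intro!: dy continuous_on_compose2[OF cy cV] simp: in_cbox_complex_iff\<close>)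
  have cu': "continuous_on {Re a..Re b} (\<lambda>x. u (Complex x y))" if "y \<in> {Im a..Im b}" for y
    by (rule FTC(3)[where f' = "\<lambda>x. ux (Complex x y)"])
      (use ab that in \<open>auto intro!: dx continuous_on_compose2[OF cx cH] simp: in_cbox_complex_iff\<close>)
  have ind: "indicator (cbox a b) (Complex x y) = (indicator {Re a..Re b} x * indicator {Im a..Im b} y :: real)" for x y
    by (auto simp: indicator_def in_cbox_complex_iff)
  have X: "(LINT z:cbox a b|lborel. ux z)
     = integral {Im a..Im b} (\<lambda>y. u (Complex (Re b) y)) - integral {Im a..Im b} (\<lambda>y. u (Complex (Re a) y))"
  proof -
    have "(LINT z:cbox a b|lborel. ux z)
       = (\<integral>y. \<integral>x. indicator (cbox a b) (Complex x y) *\<^sub>R ux (Complex x y) \<partial>lborel \<partial>lborel)"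
      unfolding set_lebesgue_integral_def
      by (rule integral_complex_iterated(2)) (use ix in \<open>simp add: set_integrable_def\<close>)
    also have "\<dots> = (\<integral>y. indicator {Im a..Im b} y *\<^sub>R (u (Complex (Re b) y) - u (Complex (Re a) y)) \<partial>lborel)"
    proof (intro Bochner_Integration.integral_cong refl)
      fix y
      show "(\<integral>x. indicator (cbox a b) (Complex x y) *\<^sub>R ux (Complex x y) \<partial>lborel)
          = indicator {Im a..Im b} y *\<^sub>R (u (Complex (Re b) y) - u (Complex (Re a) y))"
      proof (cases "y \<in> {Im a..Im b}")
        case True
        have "(\<integral>x. indicator {Re a..Re b} x *\<^sub>R ux (Complex x y) \<partial>lborel) = u (Complex (Re b) y) - u (Complex (Re a) y)"
          by (rule FTC(1)[where f = "\<lambda>x. u (Complex x y)"])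
            (use ab True in \<open>auto intro!: dx continuous_on_compose2[OF cx cH] simp: in_cbox_complex_iff\<close>)
        then show ?thesis using True by (simp add: ind)
      qed (simp add: ind)
    qed
    also have "\<dots> = integral {Im a..Im b} (\<lambda>y. u (Complex (Re b) y)) - integral {Im a..Im b} (\<lambda>y. u (Complex (Re a) y))"
      using ab by (intro conv cu) auto
    finally show ?thesis .
  qed
  have Y: "(LINT z:cbox a b|lborel. uy z)
     = integral {Re a..Re b} (\<lambda>x. u (Complex x (Im b))) - integral {Re a..Re b} (\<lambda>x. u (Complex x (Im a)))"
  proof -
    have "(LINT z:cbox a b|lborel. uy z)
       = (\<integral>x. \<integral>y. indicator (cbox a b) (Complex x y) *\<^sub>R uy (Complex x y) \<partial>lborel \<partial>lborel)"
      unfolding set_lebesgue_integral_def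
      by (rule integral_complex_iterated(1)) (use iy in \<open>simp add: set_integrable_def\<close>)
    also have "\<dots> = (\<integral>x. indicator {Re a..Re b} x *\<^sub>R (u (Complex x (Im b)) - u (Complex x (Im a))) \<partial>lborel)"
    proof (intro Bochner_Integration.integral_cong refl)
      fix x
      show "(\<integral>y. indicator (cbox a b) (Complex x y) *\<^sub>R uy (Complex x y) \<partial>lborel)
          = indicator {Re a..Re b} x *\<^sub>R (u (Complex x (Im b)) - u (Complex x (Im a)))"
      proof (cases "x \<in> {Re a..Re b}")
        case True
        have "(\<integral>y. indicator {Im a..Im b} y *\<^sub>R uy (Complex x y) \<partial>lborel) = u (Complex x (Im b)) - u (Complex x (Im a))"
          by (rule FTC(1)[where f = "\<lambda>y. u (Complex x y)"])
            (use ab True in \<open>auto intro!: dy continuous_on_compose2[OF cy cV] simp: in_cbox_complex_iff\<close>)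
        then show ?thesis using True by (simp add: ind)
      qed (simp add: ind)
    qed
    also have "\<dots> = integral {Re a..Re b} (\<lambda>x. u (Complex x (Im b))) - integral {Re a..Re b} (\<lambda>x. u (Complex x (Im a)))"
      using ab by (intro conv cu') auto
    finally show ?thesis .
  qed
  have "(LINT z:cbox a b|lborel. ux z + \<i> * uy z) = (LINT z:cbox a b|lborel. ux z) + \<i> * (LINT z:cbox a b|lborel. uy z)"
    using ix iy by (subst set_integral_add) auto
  then show ?thesis
    by (simp only: X Y rectangle_integral_def) (simp add: algebra_simps)
qed

text \<open>Morera's theorem, for rectangles with a fixed lower left corner \<open>a\<close>. The primitive is defined by integration
  along the two sides from \<open>a\<close> to \<open>z\<close>; the hypothesis says that both orders of the sides give the same value,
  which yields both partial derivatives.\<close>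

lemma morera_rectangle:
  fixes F :: "complex \<Rightarrow> complex"
  assumes F: "continuous_on (cbox a b) F"
    and z0: "\<And>z. z \<in> box a b \<Longrightarrow> rectangle_integral a z F = 0"
  shows "F holomorphic_on box a b"
proof -
  define P where "P x y = integral {Re a..x} (\<lambda>t. F (Complex t (Im a))) + \<i> * integral {Im a..y} (\<lambda>s. F (Complex x s))" for x y
  have cH: "continuous_on S (\<lambda>x. Complex x c)" and cV: "continuous_on S (\<lambda>y. Complex c y)" for c S
    by (auto simp: Complex_eq intro!: continuous_intros)
  define X where "X = {Re a<..<Re b}"
  define Y where "Y = {Im a<..<Im b}"
  have P2: "P x y = integral {Re a..x} (\<lambda>t. F (Complex t y)) + \<i> * integral {Im a..y} (\<lambda>s. F (Complex (Re a) s))"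
    if "x \<in> X" "y \<in> Y" for x y
    using z0[of "Complex x y"] that
    by (auto simp: X_def Y_def rectangle_integral_def P_def in_box_complex_iff algebra_simps)
  have dX: "((\<lambda>x. P x y) has_vector_derivative F (Complex x y)) (at x)" if "x \<in> X" "y \<in> Y" for x y
  proof -
    have "continuous_on {Re a..Re b} (\<lambda>t. F (Complex t y))"
      by (rule continuous_on_compose2[OF F cH]) (use that in \<open>auto simp: X_def Y_def in_cbox_complex_iff\<close>)
    then have "((\<lambda>x. integral {Re a..x} (\<lambda>t. F (Complex t y))) has_vector_derivative F (Complex x y)) (at x within {Re a..Re b})"
      by (rule integral_has_vector_derivative) (use that in \<open>auto simp: X_def\<close>)
    then have "((\<lambda>x. integral {Re a..x} (\<lambda>t. F (Complex t y))) has_vector_derivative F (Complex x y)) (at x)"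
      using that by (simp add: at_within_Icc_at X_def)
    then have "((\<lambda>x. integral {Re a..x} (\<lambda>t. F (Complex t y)) + \<i> * integral {Im a..y} (\<lambda>s. F (Complex (Re a) s))) has_vector_derivative F (Complex x y) + 0) (at x)"
      by (intro has_vector_derivative_add has_vector_derivative_const)
    then have "((\<lambda>x. integral {Re a..x} (\<lambda>t. F (Complex t y)) + \<i> * integral {Im a..y} (\<lambda>s. F (Complex (Re a) s))) has_vector_derivative F (Complex x y)) (at x)"
      by simp
    then show ?thesis
      by (rule has_vector_derivative_transform_within_open[where S = X])
        (use that P2 in \<open>auto simp: X_def\<close>)
  qed
  have dY: "((\<lambda>y. P x y) has_vector_derivative \<i> * F (Complex x y)) (at y)" if "x \<in> X" "y \<in> Y" for x y
  proof -
    have "continuous_on {Im a..Im b} (\<lambda>s. F (Complex x s))"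
      by (rule continuous_on_compose2[OF F cV]) (use that in \<open>auto simp: X_def Y_def in_cbox_complex_iff\<close>)
    then have "((\<lambda>y. integral {Im a..y} (\<lambda>s. F (Complex x s))) has_vector_derivative F (Complex x y)) (at y within {Im a..Im b})"
      by (rule integral_has_vector_derivative) (use that in \<open>auto simp: Y_def\<close>)
    then have "((\<lambda>y. integral {Im a..y} (\<lambda>s. F (Complex x s))) has_vector_derivative F (Complex x y)) (at y)"
      using that by (simp add: at_within_Icc_at Y_def)
    then have "((\<lambda>y. integral {Re a..x} (\<lambda>t. F (Complex t (Im a))) + \<i> * integral {Im a..y} (\<lambda>s. F (Complex x s))) has_vector_derivative 0 + \<i> * F (Complex x y)) (at y)"
      by (intro has_vector_derivative_add has_vector_derivative_const has_vector_derivative_mult_right)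
    then show ?thesis
      by (simp add: P_def)
  qed
  have cXY: "continuous_on (X \<times> Y) (\<lambda>(x, y). F (Complex x y))"
    unfolding case_prod_beta
    by (rule continuous_on_compose2[OF F])
      (auto simp: Complex_eq X_def Y_def in_cbox_complex_iff intro!: continuous_intros)
  define Q where "Q z = P (Re z) (Im z)" for z
  have dQ: "(Q has_field_derivative F z) (at z)" if z: "z \<in> box a b" for z
  proof -
    have zXY: "Re z \<in> X" "Im z \<in> Y" using z by (auto simp: X_def Y_def in_box_complex_iff)
    have op: "open (X \<times> Y)" by (simp add: X_def Y_def open_Times)
    have "((\<lambda>(x, y). P x y) has_derivative (\<lambda>(tx, ty). tx *\<^sub>R F (Complex (Re z) (Im z))
        + blinfun_apply (blinfun_scaleR_left (\<i> * F (Complex (Re z) (Im z)))) ty)) (at (Re z, Im z) within X \<times> Y)"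
    proof (rule has_derivative_partialsI)
      show "((\<lambda>x. P x (Im z)) has_derivative (\<lambda>t. t *\<^sub>R F (Complex (Re z) (Im z)))) (at (Re z) within X)"
        using dX[OF zXY] by (auto simp: has_vector_derivative_def intro: has_derivative_at_withinI)
      show "((\<lambda>y. P x y) has_derivative blinfun_apply (blinfun_scaleR_left (\<i> * F (Complex x y)))) (at y within Y)"
        if "x \<in> X" "y \<in> Y" for x y
        using dY[OF that] by (auto simp: has_vector_derivative_def intro: has_derivative_at_withinI)
      have "continuous_on (X \<times> Y) (\<lambda>(x, y). blinfun_scaleR_left (\<i> * F (Complex x y)))"
        using cXY unfolding case_prod_beta
        by (intro bounded_linear.continuous_on[OF bounded_linear_blinfun_scaleR_left] continuous_intros)
      then show "continuous (at (Re z, Im z) within X \<times> Y) (\<lambda>(x, y). blinfun_scaleR_left (\<i> * F (Complex x y)))"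
        using zXY by (auto simp: continuous_on_eq_continuous_within)
      show "convex Y" by (simp add: Y_def)
    qed (fact zXY)
    then have d: "((\<lambda>(x, y). P x y) has_derivative (\<lambda>(tx, ty). tx *\<^sub>R F z + ty *\<^sub>R (\<i> * F z))) (at (Re z, Im z))"
      using zXY by (simp add: at_within_open[OF _ op])
    have "((\<lambda>w. (Re w, Im w)) has_derivative (\<lambda>h. (Re h, Im h))) (at z)"
      by (auto intro!: derivative_eq_intros)
    from diff_chain_at[OF this d]
    have "(Q has_derivative (\<lambda>h. Re h *\<^sub>R F z + Im h *\<^sub>R (\<i> * F z))) (at z)"
      by (simp add: Q_def[abs_def] o_def)
    moreover have "Re h *\<^sub>R F z + Im h *\<^sub>R (\<i> * F z) = F z * h" for h
      by (subst (5) complex_eq) (simp add: scaleR_conv_of_real algebra_simps)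
    ultimately show ?thesis
      by (simp add: has_field_derivative_def)
  qed
  have "Q holomorphic_on box a b"
    using dQ by (auto simp: holomorphic_on_open open_box)
  then have "deriv Q holomorphic_on box a b"
    by (intro holomorphic_deriv open_box)
  then show ?thesis
    by (rule holomorphic_transform) (use dQ DERIV_imp_deriv in blast)
qed

text \<open>A continuously differentiable function on the plane, together with its partial derivatives with respect to
  the real and the imaginary part, which are carried along as arguments.\<close>

definition continuous_partials :: "(complex \<Rightarrow> complex) \<Rightarrow> (complex \<Rightarrow> complex) \<Rightarrow> (complex \<Rightarrow> complex) \<Rightarrow> bool" where
  "continuous_partials \<kappa> \<kappa>x \<kappa>y \<longleftrightarrow>
     continuous_on UNIV \<kappa> \<and> continuous_on UNIV \<kappa>x \<and> continuous_on UNIV \<kappa>y \<and>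
     (\<forall>x y. ((\<lambda>x. \<kappa> (Complex x y)) has_vector_derivative \<kappa>x (Complex x y)) (at x)) \<and>
     (\<forall>x y. ((\<lambda>y. \<kappa> (Complex x y)) has_vector_derivative \<kappa>y (Complex x y)) (at y))"

text \<open>The Wirtinger derivative with respect to \<open>cnj z\<close>, in terms of the two partial derivatives.\<close>

definition dbar :: "(complex \<Rightarrow> complex) \<Rightarrow> (complex \<Rightarrow> complex) \<Rightarrow> complex \<Rightarrow> complex" where
  "dbar \<kappa>x \<kappa>y z = (\<kappa>x z + \<i> * \<kappa>y z) / 2"

lemma holomorphic_on_if_locally:
  assumes "\<And>z. z \<in> S \<Longrightarrow> \<exists>U. open U \<and> z \<in> U \<and> f holomorphic_on U"
  shows "f holomorphic_on S"
  unfolding holomorphic_on_def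
proof
  fix z assume "z \<in> S"
  then obtain U where "open U" "z \<in> U" "f holomorphic_on U"
    using assms by blast
  then have "f field_differentiable at z"
    using holomorphic_on_imp_differentiable_at by blast
  then show "f field_differentiable at z within S"
    by (rule field_differentiable_at_within)
qed

text \<open>Localisation of the singularities of \<open>g\<close> (Vitushkin): multiplication by \<open>\<kappa>\<close> destroys holomorphy, and
  subtracting the Cauchy transform of the \<open>\<partial>\<close>-bar derivative \<open>g \<partial>\<kappa>\<close> restores it. The result has the singularities
  of \<open>g\<close> only where \<open>\<kappa>\<close> does not vanish.\<close>

lemma localized_cauchy_transform_holomorphic:
  assumes S: "open S" and g: "g holomorphic_on S" and \<kappa>: "continuous_partials \<kappa> \<kappa>x \<kappa>y"
    and h: "integrable lborel (\<lambda>w. g w * dbar \<kappa>x \<kappa>y w)"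
  shows "(\<lambda>z. \<kappa> z * g z - cauchy_transform lborel (\<lambda>w. g w * dbar \<kappa>x \<kappa>y w) z / of_real pi) holomorphic_on S"
proof (rule holomorphic_on_if_locally)
  fix z0 assume "z0 \<in> S"
  let ?h = "\<lambda>w. g w * dbar \<kappa>x \<kappa>y w"
  let ?F = "\<lambda>z. \<kappa> z * g z - cauchy_transform lborel ?h z / of_real pi"
  have c\<kappa>: "continuous_on UNIV \<kappa>" "continuous_on UNIV \<kappa>x" "continuous_on UNIV \<kappa>y"
    using \<kappa> by (auto simp: continuous_partials_def)
  obtain r0 where r0: "r0 > 0" "ball z0 r0 \<subseteq> S"
    using S \<open>z0 \<in> S\<close> openE by blast
  define r where "r = r0 / 3"
  have r: "r > 0" "ball z0 (3 * r) \<subseteq> S" using r0 by (auto simp: r_def)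
  \<comment> \<open>cutting off turns the density into a continuous function with compact support; the rest of the density
    vanishes near \<open>z0\<close> and contributes a holomorphic function there\<close>
  define \<psi> :: "complex \<Rightarrow> complex" where "\<psi> w = of_real (max 0 (min 1 (2 - dist z0 w / r)))" for w
  have \<psi>1: "\<psi> w = 1" if "w \<in> ball z0 r" for w
    using that r by (simp add: \<psi>_def field_simps min_def max_def)
  have \<psi>0: "\<psi> w = 0" if "w \<notin> ball z0 (2 * r)" for w
    using that r by (simp add: \<psi>_def field_simps min_def max_def)
  define k where "k w = \<psi> w * ?h w" for w
  have gc: "continuous_on S g" using g by (rule holomorphic_on_imp_continuous_on)
  have kc: "continuous_on UNIV k"
  proof -
    have "continuous_on (ball z0 (3 * r)) k"
      unfolding k_def \<psi>_def dbar_def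
      by (intro continuous_intros continuous_on_subset[OF gc r(2)] continuous_on_subset[OF c\<kappa>(2)] continuous_on_subset[OF c\<kappa>(3)]) (use r in auto)
    moreover have "continuous_on (- cball z0 (2 * r)) k"
      by (rule continuous_on_eq[of _ "\<lambda>_. 0"]) (auto simp: k_def \<psi>0)
    ultimately have "continuous_on (ball z0 (3 * r) \<union> - cball z0 (2 * r)) k"
      by (intro continuous_on_open_Un) auto
    moreover have "ball z0 (3 * r) \<union> - cball z0 (2 * r) = UNIV"
      using r by auto
    ultimately show ?thesis by simp
  qed
  have [measurable]: "k \<in> borel_measurable borel"
    using kc by (rule borel_measurable_continuous_onI)
  define R where "R = norm z0 + 2 * r"
  have ksupp: "k w = 0" if "R \<le> norm w" for w
  proof -
    have "2 * r \<le> dist z0 w"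
      using that norm_triangle_ineq2[of w z0] by (simp add: R_def dist_norm norm_minus_commute)
    then show ?thesis by (simp add: k_def \<psi>0)
  qed
  obtain K where K: "norm (k w) \<le> K" for w
  proof -
    have "bounded (k ` cball 0 R)"
      by (intro compact_imp_bounded compact_continuous_image continuous_on_subset[OF kc]) auto
    then obtain K0 where "\<forall>w\<in>cball 0 R. norm (k w) \<le> K0"
      by (auto simp: bounded_iff)
    then have "norm (k w) \<le> max K0 0" for w
      using ksupp[of w] by (cases "norm w \<le> R") (auto simp: le_max_iff_disj)
    then show ?thesis by (rule that)
  qed
  have kint: "integrable lborel k"
  proof -
    have "integrable lborel (\<lambda>w. indicator (cball 0 R) w *\<^sub>R k w)"
      by (intro borel_integrable_compact compact_cball continuous_on_subset[OF kc]) auto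
    moreover have "(\<lambda>w. indicator (cball 0 R) w *\<^sub>R k w) = k"
      using ksupp by (auto simp: fun_eq_iff indicator_def)
    ultimately show ?thesis by simp
  qed
  have Ck: "continuous_on UNIV (cauchy_transform lborel k)"
    by (rule continuous_on_cauchy_transform[OF kc ksupp K])
  have kC: "integrable lborel (\<lambda>w. k w / (z - w))" for z
    by (rule integrable_cauchy_kernel_bounded_near[OF kint zero_less_one K])
  let ?e = "\<lambda>w. ?h w - k w"
  have eint: "integrable lborel ?e" using h kint by simp
  have e0: "?e w = 0" if "w \<in> ball z0 r" for w
    using \<psi>1[OF that] by (simp add: k_def)
  have Chol: "cauchy_transform lborel ?e holomorphic_on ball z0 r"
    by (rule cauchy_transform_holomorphic[OF eint _ _ e0]) auto
  have split: "cauchy_transform lborel ?h z = cauchy_transform lborel k z + cauchy_transform lborel ?e z"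
    if z: "z \<in> ball z0 r" for z
  proof -
    obtain \<rho> where \<rho>: "\<rho> > 0" "ball z \<rho> \<subseteq> ball z0 r"
      using z open_ball openE by blast
    have "\<rho> \<le> norm (z - w)" if "?e w \<noteq> 0" for w
      using e0[of w] that \<rho>(2) by (force simp: dist_norm)
    then have "integrable lborel (\<lambda>w. ?e w / (z - w))"
      by (rule integrable_cauchy_kernel[OF eint _ \<rho>(1), rotated]) auto
    then have "cauchy_transform lborel k z + cauchy_transform lborel ?e z
       = (\<integral>w. k w / (z - w) + ?e w / (z - w) \<partial>lborel)"
      unfolding cauchy_transform_def by (intro Bochner_Integration.integral_add[symmetric] kC)
    also have "\<dots> = cauchy_transform lborel ?h z"
      unfolding cauchy_transform_def
      by (intro Bochner_Integration.integral_cong) (auto simp: diff_divide_distrib)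
    finally show ?thesis by simp
  qed
  have "z0 \<in> ball z0 r" using r by simp
  then obtain a b where ab: "cbox a b \<subseteq> ball z0 r" "z0 \<in> box a b"
    by (rule open_contains_cbox[OF open_ball])
  let ?u = "\<lambda>z. \<kappa> z * g z"
  let ?G = "\<lambda>z. ?u z - cauchy_transform lborel k z / of_real pi"
  have bS: "ball z0 r \<subseteq> S" using r by (intro order_trans[OF _ r(2)]) auto
  have uc: "continuous_on (cbox a b) ?u"
    by (intro continuous_intros continuous_on_subset[OF c\<kappa>(1)] continuous_on_subset[OF gc]) (use ab bS in auto)
  have "?G holomorphic_on box a b"
  proof (rule morera_rectangle)
    show "continuous_on (cbox a b) ?G"
      by (intro continuous_intros uc continuous_on_subset[OF Ck]) auto
    fix z assume z: "z \<in> box a b"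
    have az: "Re a < Re z" "Im a < Im z" using z by (auto simp: in_box_complex_iff)
    have sub: "cbox a z \<subseteq> cbox a b"
      using z by (auto simp: in_box_complex_iff in_cbox_complex_iff)
    have subS: "w \<in> S" if "w \<in> cbox a z" for w using that sub ab bS by auto
    have g': "(g has_field_derivative deriv g w) (at w)" if "w \<in> cbox a z" for w
      using holomorphic_derivI[OF g S subS[OF that]] .
    have cg': "continuous_on S (deriv g)"
      by (intro holomorphic_on_imp_continuous_on holomorphic_deriv g S)
    have dXg: "((\<lambda>x. g (Complex x y)) has_vector_derivative deriv g (Complex x y)) (at x)"
      if "Complex x y \<in> cbox a z" for x y
    proof -
      have "((\<lambda>x. Complex x y) has_vector_derivative 1) (at x)"
        unfolding Complex_eq by (auto intro!: derivative_eq_intros)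
      from field_vector_diff_chain_at[OF this g'[OF that]] show ?thesis
        by (simp add: o_def)
    qed
    have dYg: "((\<lambda>y. g (Complex x y)) has_vector_derivative \<i> * deriv g (Complex x y)) (at y)"
      if "Complex x y \<in> cbox a z" for x y
    proof -
      have "((\<lambda>y. Complex x y) has_vector_derivative \<i>) (at y)"
        unfolding Complex_eq by (auto intro!: derivative_eq_intros)
      from field_vector_diff_chain_at[OF this g'[OF that]] show ?thesis
        by (simp add: o_def)
    qed
    have "rectangle_integral a z ?u = \<i> * (LINT w:cbox a z|lborel.
        (\<kappa> w * deriv g w + \<kappa>x w * g w) + \<i> * (\<kappa> w * (\<i> * deriv g w) + \<kappa>y w * g w))"
    proof (rule green_rectangle)
      show "continuous_on (cbox a z) (\<lambda>w. \<kappa> w * deriv g w + \<kappa>x w * g w)"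
           "continuous_on (cbox a z) (\<lambda>w. \<kappa> w * (\<i> * deriv g w) + \<kappa>y w * g w)"
        by (intro continuous_intros continuous_on_subset[OF c\<kappa>(1)] continuous_on_subset[OF c\<kappa>(2)]
            continuous_on_subset[OF c\<kappa>(3)] continuous_on_subset[OF gc] continuous_on_subset[OF cg']; use subS in auto)+
      show "((\<lambda>x. ?u (Complex x y)) has_vector_derivative
          \<kappa> (Complex x y) * deriv g (Complex x y) + \<kappa>x (Complex x y) * g (Complex x y)) (at x)"
        if "Complex x y \<in> cbox a z" for x y
        using \<kappa> by (intro has_vector_derivative_mult dXg that) (auto simp: continuous_partials_def)
      show "((\<lambda>y. ?u (Complex x y)) has_vector_derivative
          \<kappa> (Complex x y) * (\<i> * deriv g (Complex x y)) + \<kappa>y (Complex x y) * g (Complex x y)) (at y)"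
        if "Complex x y \<in> cbox a z" for x y
        using \<kappa> by (intro has_vector_derivative_mult dYg that) (auto simp: continuous_partials_def)
    qed (use az in auto)
    also have "(LINT w:cbox a z|lborel.
        (\<kappa> w * deriv g w + \<kappa>x w * g w) + \<i> * (\<kappa> w * (\<i> * deriv g w) + \<kappa>y w * g w))
        = (LINT w:cbox a z|lborel. 2 * k w)"
    proof (rule set_lebesgue_integral_cong)
      show "\<forall>w. w \<in> cbox a z \<longrightarrow> \<kappa> w * deriv g w + \<kappa>x w * g w + \<i> * (\<kappa> w * (\<i> * deriv g w) + \<kappa>y w * g w) = 2 * k w"
      proof (intro allI impI)
        fix w assume "w \<in> cbox a z"
        then have "\<psi> w = 1" using \<psi>1 sub ab by blast
        then show "\<kappa> w * deriv g w + \<kappa>x w * g w + \<i> * (\<kappa> w * (\<i> * deriv g w) + \<kappa>y w * g w) = 2 * k w"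
          by (simp add: k_def dbar_def algebra_simps)
      qed
    qed simp
    finally have ru: "rectangle_integral a z ?u = 2 * \<i> * (LINT w:cbox a z|lborel. k w)" by simp
    have rk: "rectangle_integral a z (cauchy_transform lborel k) = 2 * of_real pi * \<i> * (LINT w:cbox a z|lborel. k w)"
      by (rule rectangle_integral_cauchy_transform[OF az _ K ksupp Ck]) auto
    have cH: "continuous_on T (\<lambda>x. Complex x c)" and cV: "continuous_on T (\<lambda>y. Complex c y)" for c T
      by (auto simp: Complex_eq intro!: continuous_intros)
    have i: "integral {c..d} (\<lambda>t. ?u (l t) - cauchy_transform lborel k (l t) / of_real pi)
        = integral {c..d} (\<lambda>t. ?u (l t)) - integral {c..d} (\<lambda>t. cauchy_transform lborel k (l t)) / of_real pi"
      if "continuous_on {c..d} l" "l ` {c..d} \<subseteq> cbox a b" for c d :: real and l :: "real \<Rightarrow> complex"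
    proof -
      have 1: "continuous_on {c..d} (\<lambda>t. ?u (l t))"
        by (rule continuous_on_compose2[OF uc that])
      have "continuous_on {c..d} (\<lambda>t. cauchy_transform lborel k (l t))"
        by (rule continuous_on_compose2[OF Ck that(1)]) auto
      then have 2: "continuous_on {c..d} (\<lambda>t. cauchy_transform lborel k (l t) / of_real pi)"
        by (intro continuous_intros) auto
      show ?thesis
        using Henstock_Kurzweil_Integration.integral_diff[OF integrable_continuous_real[OF 1] integrable_continuous_real[OF 2]]
        by simp
    qed
    have "rectangle_integral a z ?G = rectangle_integral a z ?u - rectangle_integral a z (cauchy_transform lborel k) / of_real pi"
    proof -
      note [simp] = in_cbox_complex_iff in_box_complex_iff
      have i4: "integral {Re a..Re z} (\<lambda>x. ?G (Complex x (Im a))) = integral {Re a..Re z} (\<lambda>x. ?u (Complex x (Im a))) - integral {Re a..Re z} (\<lambda>x. cauchy_transform lborel k (Complex x (Im a))) / of_real pi"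
         "integral {Re a..Re z} (\<lambda>x. ?G (Complex x (Im z))) = integral {Re a..Re z} (\<lambda>x. ?u (Complex x (Im z))) - integral {Re a..Re z} (\<lambda>x. cauchy_transform lborel k (Complex x (Im z))) / of_real pi"
         "integral {Im a..Im z} (\<lambda>x. ?G (Complex (Re a) x)) = integral {Im a..Im z} (\<lambda>x. ?u (Complex (Re a) x)) - integral {Im a..Im z} (\<lambda>x. cauchy_transform lborel k (Complex (Re a) x)) / of_real pi"
         "integral {Im a..Im z} (\<lambda>x. ?G (Complex (Re z) x)) = integral {Im a..Im z} (\<lambda>x. ?u (Complex (Re z) x)) - integral {Im a..Im z} (\<lambda>x. cauchy_transform lborel k (Complex (Re z) x)) / of_real pi"
        by (intro i cH cV, use z az in force)+
      show ?thesis
        unfolding rectangle_integral_def i4 by (simp add: algebra_simps add_divide_distrib diff_divide_distrib)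
    qed
    then show "rectangle_integral a z ?G = 0"
      by (simp add: ru rk)
  qed
  moreover have "(\<lambda>z. cauchy_transform lborel ?e z / of_real pi) holomorphic_on box a b"
    using ab box_subset_cbox[of a b]
    by (intro holomorphic_on_divide holomorphic_on_const holomorphic_on_subset[OF Chol]) auto
  ultimately have "(\<lambda>z. ?G z - cauchy_transform lborel ?e z / of_real pi) holomorphic_on box a b"
    by (rule holomorphic_on_diff)
  then have "?F holomorphic_on box a b"
    by (rule holomorphic_transform)
      (use ab box_subset_cbox[of a b] split in \<open>auto simp: add_divide_distrib subset_iff\<close>)
  then show "\<exists>U. open U \<and> z0 \<in> U \<and> ?F holomorphic_on U"
    using ab open_box by blast
qed

section \<open>Estimates for integrable holomorphic functions\<close>

lemma DERIV_max0_square: "((\<lambda>x::real. (max 0 x)\<^sup>2) has_real_derivative 2 * max 0 x) (at x)"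
proof -
  consider "x < 0" | "x = 0" | "x > 0" by linarith
  then show ?thesis
  proof cases
    case 1
    have "((\<lambda>x::real. 0) has_real_derivative 0) (at x)" by simp
    then have "((\<lambda>x::real. (max 0 x)\<^sup>2) has_real_derivative 0) (at x)"
      by (rule has_field_derivative_transform_within_open[where S = "{..<0}"]) (use 1 in auto)
    then show ?thesis using 1 by simp
  next
    case 2
    have "((\<lambda>h::real. (max 0 h)\<^sup>2 / h) \<longlongrightarrow> 0) (at 0)"
    proof (rule Lim_null_comparison)
      show "\<forall>\<^sub>F h in at 0. norm ((max 0 h)\<^sup>2 / h) \<le> \<bar>h\<bar>"
        by (auto simp: eventually_at max_def power2_eq_square intro!: exI[of _ 1])
      show "((\<lambda>h::real. \<bar>h\<bar>) \<longlongrightarrow> 0) (at 0)"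
        using tendsto_rabs_zero[OF tendsto_ident_at] by simp
    qed
    then show ?thesis using 2 by (simp add: DERIV_def)
  next
    case 3
    have "((\<lambda>x::real. x\<^sup>2) has_real_derivative 2 * x) (at x)"
      by (auto intro!: derivative_eq_intros)
    then have "((\<lambda>x::real. (max 0 x)\<^sup>2) has_real_derivative 2 * x) (at x)"
      by (rule has_field_derivative_transform_within_open[where S = "{0<..}"]) (use 3 in auto)
    then show ?thesis using 3 by simp
  qed
qed

text \<open>The derivative of the step is the tent function \<open>4 s\<^sub>+ - 8 (s - 1/2)\<^sub>+ + 4 (s - 1)\<^sub>+\<close>, which has integral \<open>1\<close>.\<close>

lemma cutoff_step:
  obtains \<sigma> \<sigma>' :: "real \<Rightarrow> real" where
    "\<And>s. (\<sigma> has_real_derivative \<sigma>' s) (at s)" "continuous_on UNIV \<sigma>'"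
    "\<And>s. \<bar>\<sigma> s\<bar> \<le> 1" "\<And>s. \<bar>\<sigma>' s\<bar> \<le> 2"
    "\<And>s. s \<le> 0 \<Longrightarrow> \<sigma> s = 0 \<and> \<sigma>' s = 0" "\<And>s. 1 \<le> s \<Longrightarrow> \<sigma> s = 1 \<and> \<sigma>' s = 0"
proof -
  define \<sigma> where "\<sigma> s = 2 * (max 0 s)\<^sup>2 - 4 * (max 0 (s - 1/2))\<^sup>2 + 2 * (max 0 (s - 1))\<^sup>2" for s :: real
  define \<sigma>' where "\<sigma>' s = 4 * max 0 s - 8 * max 0 (s - 1/2) + 4 * max 0 (s - 1)" for s :: real
  have d: "((\<lambda>s. (max 0 (s - c))\<^sup>2) has_real_derivative 2 * max 0 (s - c)) (at s)" for c s :: real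
    by (rule DERIV_cong[OF DERIV_chain2[of "\<lambda>x. (max 0 x)\<^sup>2" _ "\<lambda>s. s - c", OF DERIV_max0_square]])
      (auto intro!: derivative_eq_intros)
  have 1: "(\<sigma> has_real_derivative \<sigma>' s) (at s)" for s
    unfolding \<sigma>_def \<sigma>'_def
    by (rule derivative_eq_intros d DERIV_max0_square refl)+ simp
  have 2: "continuous_on UNIV \<sigma>'"
    unfolding \<sigma>'_def by (intro continuous_intros)
  have 3: "s \<le> 0 \<Longrightarrow> \<sigma> s = 0 \<and> \<sigma>' s = 0" for s
    by (simp add: \<sigma>_def \<sigma>'_def)
  have 4: "1 \<le> s \<Longrightarrow> \<sigma> s = 1 \<and> \<sigma>' s = 0" for s
    by (simp add: \<sigma>_def \<sigma>'_def power2_eq_square algebra_simps)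
  have 5: "\<bar>\<sigma>' s\<bar> \<le> 2" for s
    unfolding \<sigma>'_def by (simp add: max_def)
  have 6: "\<bar>\<sigma> s\<bar> \<le> 1" for s
  proof -
    consider "s \<le> 0" | "0 \<le> s" "s \<le> 1/2" | "1/2 \<le> s" "s \<le> 1" | "1 \<le> s" by linarith
    then show ?thesis
    proof cases
      case 2
      then have "\<sigma> s = 2 * s\<^sup>2" by (simp add: \<sigma>_def)
      moreover have "s\<^sup>2 \<le> (1/2)\<^sup>2" using 2 by (intro power_mono) auto
      ultimately show ?thesis by (simp add: power2_eq_square)
    next
      case 3
      then have "\<sigma> s = 1 - 2 * (1 - s)\<^sup>2" by (simp add: \<sigma>_def power2_eq_square algebra_simps)
      moreover have "(1 - s)\<^sup>2 \<le> (1/2)\<^sup>2" using 3 by (intro power_mono) auto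
      ultimately show ?thesis by (simp add: power2_eq_square)
    qed (use 3 4 in auto)
  qed
  show ?thesis using that[OF 1 2 6 5 3 4] .
qed

text \<open>The bump is a product of a function of the real part and one of the imaginary part, so it is \<open>1\<close> on a square
  of side \<open>2 r\<close> and \<open>0\<close> outside one of side \<open>4 r\<close>; the radius \<open>3 r\<close> exceeds half of the diagonal of the latter.\<close>

lemma bump_function:
  fixes a :: complex and r :: real
  assumes r: "0 < r"
  obtains \<kappa> \<kappa>x \<kappa>y where "continuous_partials \<kappa> \<kappa>x \<kappa>y"
    "\<And>z. norm (\<kappa> z) \<le> 1" "\<And>z. norm (dbar \<kappa>x \<kappa>y z) \<le> 4 / r"
    "\<And>z. norm (z - a) \<le> r \<Longrightarrow> \<kappa> z = 1 \<and> dbar \<kappa>x \<kappa>y z = 0"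
    "\<And>z. 3 * r \<le> norm (z - a) \<Longrightarrow> \<kappa> z = 0 \<and> dbar \<kappa>x \<kappa>y z = 0"
proof -
  obtain \<sigma> \<sigma>' :: "real \<Rightarrow> real" where \<sigma>:
    "\<And>s. (\<sigma> has_real_derivative \<sigma>' s) (at s)" "continuous_on UNIV \<sigma>'"
    "\<And>s. \<bar>\<sigma> s\<bar> \<le> 1" "\<And>s. \<bar>\<sigma>' s\<bar> \<le> 2"
    "\<And>s. s \<le> 0 \<Longrightarrow> \<sigma> s = 0 \<and> \<sigma>' s = 0" "\<And>s. 1 \<le> s \<Longrightarrow> \<sigma> s = 1 \<and> \<sigma>' s = 0"
    using cutoff_step by metis
  define \<tau> where "\<tau> c t = \<sigma> (2 - (t - c) / r) * \<sigma> (2 + (t - c) / r)" for c t :: real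
  define \<tau>' where "\<tau>' c t = (\<sigma> (2 - (t - c) / r) * \<sigma>' (2 + (t - c) / r) - \<sigma>' (2 - (t - c) / r) * \<sigma> (2 + (t - c) / r)) / r" for c t :: real
  have \<tau>d: "(\<tau> c has_real_derivative \<tau>' c t) (at t)" for c t
  proof -
    have "((\<lambda>t. \<sigma> (2 - (t - c) / r)) has_real_derivative \<sigma>' (2 - (t - c) / r) * (- 1 / r)) (at t)"
      by (rule DERIV_chain2[OF \<sigma>(1)]) (use r in \<open>auto intro!: derivative_eq_intros\<close>)
    moreover have "((\<lambda>t. \<sigma> (2 + (t - c) / r)) has_real_derivative \<sigma>' (2 + (t - c) / r) * (1 / r)) (at t)"
      by (rule DERIV_chain2[OF \<sigma>(1)]) (use r in \<open>auto intro!: derivative_eq_intros\<close>)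
    ultimately show ?thesis
      unfolding \<tau>_def[abs_def] \<tau>'_def
      by (rule DERIV_cong[OF DERIV_mult]) (simp add: diff_divide_distrib)
  qed
  have c\<sigma>: "continuous_on UNIV \<sigma>"
    using \<sigma>(1) by (meson DERIV_isCont continuous_at_imp_continuous_on)
  have c\<tau>: "continuous_on UNIV (\<tau> c)" "continuous_on UNIV (\<tau>' c)" for c
    unfolding \<tau>_def[abs_def] \<tau>'_def[abs_def]
    by (intro continuous_intros continuous_on_compose2[OF c\<sigma>] continuous_on_compose2[OF \<sigma>(2)]; use r in auto)+
  have b\<tau>: "\<bar>\<tau> c t\<bar> \<le> 1" for c t
    unfolding \<tau>_def abs_mult using \<sigma>(3) by (intro mult_le_one) auto
  have b\<tau>': "\<bar>\<tau>' c t\<bar> \<le> 4 / r" for c t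
  proof -
    have "\<bar>\<sigma> (2 - (t - c) / r) * \<sigma>' (2 + (t - c) / r) - \<sigma>' (2 - (t - c) / r) * \<sigma> (2 + (t - c) / r)\<bar>
      \<le> \<bar>\<sigma> (2 - (t - c) / r)\<bar> * \<bar>\<sigma>' (2 + (t - c) / r)\<bar> + \<bar>\<sigma>' (2 - (t - c) / r)\<bar> * \<bar>\<sigma> (2 + (t - c) / r)\<bar>"
      unfolding abs_mult[symmetric] by (rule abs_triangle_ineq4)
    also have "\<dots> \<le> 1 * 2 + 2 * 1"
      using \<sigma>(3,4) by (intro add_mono mult_mono) auto
    finally show ?thesis using r by (simp add: \<tau>'_def divide_right_mono)
  qed
  have in\<tau>: "\<tau> c t = 1" "\<tau>' c t = 0" if "\<bar>t - c\<bar> \<le> r" for c t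
  proof -
    have "1 \<le> 2 - (t - c) / r" "1 \<le> 2 + (t - c) / r"
      using that r by (auto simp: field_simps abs_le_iff)
    then show "\<tau> c t = 1" "\<tau>' c t = 0"
      using \<sigma>(6) by (simp_all add: \<tau>_def \<tau>'_def)
  qed
  have out\<tau>: "\<tau> c t = 0" "\<tau>' c t = 0" if "2 * r \<le> \<bar>t - c\<bar>" for c t
  proof -
    have "2 - (t - c) / r \<le> 0 \<or> 2 + (t - c) / r \<le> 0"
      using that r by (auto simp: field_simps abs_if split: if_splits)
    then show "\<tau> c t = 0" "\<tau>' c t = 0"
      using \<sigma>(5) by (auto simp: \<tau>_def \<tau>'_def)
  qed
  define \<kappa> :: "complex \<Rightarrow> complex" where "\<kappa> z = of_real (\<tau> (Re a) (Re z) * \<tau> (Im a) (Im z))" for z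
  define \<kappa>x :: "complex \<Rightarrow> complex" where "\<kappa>x z = of_real (\<tau>' (Re a) (Re z) * \<tau> (Im a) (Im z))" for z
  define \<kappa>y :: "complex \<Rightarrow> complex" where "\<kappa>y z = of_real (\<tau> (Re a) (Re z) * \<tau>' (Im a) (Im z))" for z
  have "continuous_partials \<kappa> \<kappa>x \<kappa>y"
    unfolding continuous_partials_def
  proof (intro conjI allI)
    show "continuous_on UNIV \<kappa>" "continuous_on UNIV \<kappa>x" "continuous_on UNIV \<kappa>y"
      unfolding \<kappa>_def \<kappa>x_def \<kappa>y_def
      by (intro continuous_intros continuous_on_compose2[OF c\<tau>(1)] continuous_on_compose2[OF c\<tau>(2)]; simp)+
    fix x y
    have "((\<lambda>x. \<tau> (Re a) x * \<tau> (Im a) y) has_real_derivative \<tau>' (Re a) x * \<tau> (Im a) y) (at x)"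
      by (rule DERIV_cmult_right[OF \<tau>d])
    then show "((\<lambda>x. \<kappa> (Complex x y)) has_vector_derivative \<kappa>x (Complex x y)) (at x)"
      unfolding \<kappa>_def \<kappa>x_def complex.sel
      by (intro has_vector_derivative_of_real) (simp add: has_real_derivative_iff_has_vector_derivative)
    have "((\<lambda>y. \<tau> (Re a) x * \<tau> (Im a) y) has_real_derivative \<tau> (Re a) x * \<tau>' (Im a) y) (at y)"
      by (rule DERIV_cmult[OF \<tau>d])
    then show "((\<lambda>y. \<kappa> (Complex x y)) has_vector_derivative \<kappa>y (Complex x y)) (at y)"
      unfolding \<kappa>_def \<kappa>y_def complex.sel
      by (intro has_vector_derivative_of_real) (simp add: has_real_derivative_iff_has_vector_derivative)
  qed
  moreover have "norm (\<kappa> z) \<le> 1" for z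
    unfolding \<kappa>_def norm_of_real abs_mult using b\<tau> by (intro mult_le_one) auto
  moreover have "norm (dbar \<kappa>x \<kappa>y z) \<le> 4 / r" for z
  proof -
    have "norm (\<kappa>x z) \<le> 4 / r * 1" "norm (\<kappa>y z) \<le> 1 * (4 / r)"
      unfolding \<kappa>x_def \<kappa>y_def norm_of_real abs_mult
      using b\<tau> b\<tau>' r by (intro mult_mono; simp)+
    then have "norm (\<kappa>x z + \<i> * \<kappa>y z) \<le> 4 / r + 4 / r"
      by (intro norm_triangle_le) (simp add: norm_mult)
    then show ?thesis by (simp add: dbar_def norm_divide)
  qed
  moreover have "\<kappa> z = 1 \<and> dbar \<kappa>x \<kappa>y z = 0" if "norm (z - a) \<le> r" for z
  proof -
    have "\<bar>Re z - Re a\<bar> \<le> r" "\<bar>Im z - Im a\<bar> \<le> r"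
      using abs_Re_le_cmod[of "z - a"] abs_Im_le_cmod[of "z - a"] that by auto
    then show ?thesis
      using in\<tau> by (simp add: \<kappa>_def \<kappa>x_def \<kappa>y_def dbar_def)
  qed
  moreover have "\<kappa> z = 0 \<and> dbar \<kappa>x \<kappa>y z = 0" if z: "3 * r \<le> norm (z - a)" for z
  proof -
    have "2 * r \<le> \<bar>Re z - Re a\<bar> \<or> 2 * r \<le> \<bar>Im z - Im a\<bar>"
    proof (rule ccontr)
      assume "\<not> ?thesis"
      then have "(Re z - Re a)\<^sup>2 \<le> (2 * r)\<^sup>2" "(Im z - Im a)\<^sup>2 \<le> (2 * r)\<^sup>2"
        using r abs_le_square_iff[of "Re z - Re a" "2 * r"] abs_le_square_iff[of "Im z - Im a" "2 * r"] by auto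
      then have "(norm (z - a))\<^sup>2 \<le> 8 * r\<^sup>2"
        by (simp add: cmod_power2 power_mult_distrib)
      moreover have "(3 * r)\<^sup>2 \<le> (norm (z - a))\<^sup>2"
        using z r by (intro power_mono) auto
      moreover have "(3 * r)\<^sup>2 = 9 * r\<^sup>2" by (simp add: power_mult_distrib)
      moreover have "0 < r\<^sup>2" using r by simp
      ultimately show False by linarith
    qed
    then show ?thesis
      using out\<tau> by (auto simp: \<kappa>_def \<kappa>x_def \<kappa>y_def dbar_def)
  qed
  ultimately show ?thesis by (rule that)
qed

lemma continuous_on_dbar:
  assumes "continuous_partials \<kappa> \<kappa>x \<kappa>y"
  shows "continuous_on UNIV (dbar \<kappa>x \<kappa>y)"
  using assms unfolding continuous_partials_def dbar_def by (auto intro!: continuous_intros)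

text \<open>With a bump \<open>\<kappa>\<close> at \<open>a\<close>, the function \<open>\<kappa> g - C(g \<partial>\<kappa>) / \<pi>\<close> is entire and vanishes at infinity. By
  Liouville's theorem \<open>g(a) = C(g \<partial>\<kappa>)(a) / \<pi>\<close>, and \<open>\<partial>\<kappa>\<close> is of size \<open>1 / r\<close> and lives at distance at least \<open>r\<close>
  from \<open>a\<close>.\<close>

lemma holomorphic_norm_le_mean:
  assumes S: "open S" and g: "g holomorphic_on S" and r: "0 < r" and sub: "cball a (3 * r) \<subseteq> S"
  shows "ennreal (norm (g a)) \<le> ennreal (4 / r\<^sup>2) * (\<integral>\<^sup>+w\<in>cball a (3 * r). ennreal (norm (g w)) \<partial>lborel)"
proof -
  obtain \<kappa> \<kappa>x \<kappa>y where \<kappa>: "continuous_partials \<kappa> \<kappa>x \<kappa>y"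
    "\<And>z. norm (\<kappa> z) \<le> 1" "\<And>z. norm (dbar \<kappa>x \<kappa>y z) \<le> 4 / r"
    "\<And>z. norm (z - a) \<le> r \<Longrightarrow> \<kappa> z = 1 \<and> dbar \<kappa>x \<kappa>y z = 0"
    "\<And>z. 3 * r \<le> norm (z - a) \<Longrightarrow> \<kappa> z = 0 \<and> dbar \<kappa>x \<kappa>y z = 0"
    using bump_function[OF r, of a] by blast
  define h where "h w = g w * dbar \<kappa>x \<kappa>y w" for w
  have h0: "h w = 0" if "w \<notin> cball a (3 * r)" for w
    using \<kappa>(5)[of w] that by (simp add: h_def dist_norm norm_minus_commute)
  have hint: "integrable lborel h"
  proof -
    have "integrable lborel (\<lambda>w. indicator (cball a (3 * r)) w *\<^sub>R h w)"
      unfolding h_def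
      by (intro borel_integrable_compact compact_cball continuous_intros
          continuous_on_subset[OF continuous_on_dbar[OF \<kappa>(1)]]
          continuous_on_subset[OF holomorphic_on_imp_continuous_on[OF g] sub]) auto
    moreover have "(\<lambda>w. indicator (cball a (3 * r)) w *\<^sub>R h w) = h"
      using h0 by (auto simp: fun_eq_iff indicator_def)
    ultimately show ?thesis by simp
  qed
  let ?C = "cauchy_transform lborel h"
  have F: "(\<lambda>z. \<kappa> z * g z - ?C z / of_real pi) holomorphic_on S"
    using localized_cauchy_transform_holomorphic[OF S g \<kappa>(1)] hint by (simp add: h_def[abs_def])
  have D: "?C holomorphic_on - cball a (3 * r)"
    by (rule cauchy_transform_holomorphic[OF hint]) (auto simp: h0)
  define E where "E z = (if z \<in> S then \<kappa> z * g z else 0) - ?C z / of_real pi" for z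
  \<comment> \<open>off the support of the bump \<open>E\<close> is a multiple of a Cauchy transform, whatever the domain of \<open>g\<close>\<close>
  have "E holomorphic_on UNIV"
  proof (rule holomorphic_on_if_locally)
    fix z
    show "\<exists>U. open U \<and> z \<in> U \<and> E holomorphic_on U"
    proof (cases "z \<in> cball a (3 * r)")
      case True
      have "E holomorphic_on S"
        by (rule holomorphic_transform[OF F]) (simp add: E_def)
      then show ?thesis using True sub S by auto
    next
      case False
      have "(\<lambda>z. - (?C z / of_real pi)) holomorphic_on - cball a (3 * r)"
        by (intro holomorphic_on_minus holomorphic_on_divide D holomorphic_on_const) auto
      then have "E holomorphic_on - cball a (3 * r)"
        by (rule holomorphic_transform) (use \<kappa>(5) in \<open>auto simp: E_def dist_norm norm_minus_commute\<close>)
      then show ?thesis using False by (intro exI[of _ "- cball a (3 * r)"]) auto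
    qed
  qed
  moreover have "(E \<longlongrightarrow> 0) at_infinity"
  proof (rule Lim_null_comparison)
    define R where "R = norm a + 3 * r"
    define H where "H = (\<integral>w. norm (h w) \<partial>lborel) / pi"
    have "norm (E z) \<le> H * inverse (norm z - R)" if z: "R < norm z" for z
    proof -
      have far: "norm z - R \<le> norm (z - w)" if "h w \<noteq> 0" for w
      proof -
        have "norm (w - a) \<le> 3 * r" using h0[of w] that by (auto simp: dist_norm norm_minus_commute)
        then show ?thesis
          using norm_triangle_ineq2[of z w] norm_triangle_ineq2[of w a] by (simp add: R_def)
      qed
      have "norm (z - a) > 3 * r"
        using z norm_triangle_ineq2[of z a] by (simp add: R_def)
      then have "norm (E z) = norm (?C z) / pi"
        using \<kappa>(5)[of z] by (simp add: E_def norm_divide)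
      also have "norm (?C z) \<le> (\<integral>w. norm (h w) * inverse (norm z - R) \<partial>lborel)"
        unfolding cauchy_transform_def
      proof (rule Bochner_Integration.integral_norm_bound_integral)
        show "integrable lborel (\<lambda>w. h w / (z - w))"
          by (rule integrable_cauchy_kernel[OF hint, of "norm z - R"]) (use z far in auto)
        show "norm (h w / (z - w)) \<le> norm (h w) * inverse (norm z - R)" for w
          using far[of w] z by (cases "h w = 0") (auto simp: norm_mult norm_inverse divide_inverse intro!: mult_left_mono le_imp_inverse_le)
      qed (use hint in simp)
      finally show ?thesis using hint by (simp add: H_def divide_right_mono)
    qed
    then show "\<forall>\<^sub>F z in at_infinity. norm (E z) \<le> H * inverse (norm z - R)"
      unfolding eventually_at_infinity by (intro exI[of _ "R + 1"]) auto
    have "filterlim (\<lambda>z::complex. norm z - R) at_top at_infinity"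
      using filterlim_tendsto_add_at_top[OF tendsto_const[of "-R"] filterlim_norm_at_top] by simp
    then have "((\<lambda>z. inverse (norm z - R)) \<longlongrightarrow> 0) (at_infinity :: complex filter)"
      by (rule tendsto_inverse_0_at_top)
    from tendsto_mult_left[OF this, of H]
    show "((\<lambda>z. H * inverse (norm z - R)) \<longlongrightarrow> 0) (at_infinity :: complex filter)" by simp
  qed
  ultimately have "E a = 0" by (rule Liouville_weak_0)
  then have ga: "g a = ?C a / of_real pi"
    using \<kappa>(4)[of a] subsetD[OF sub, of a] r by (simp add: E_def)
  have "ennreal (norm (g a)) \<le> ennreal (norm (?C a))"
    unfolding ga using pi_gt3 by (intro ennreal_leI) (simp add: norm_divide divide_le_eq mult_le_cancel_left1)
  also have "\<dots> \<le> (\<integral>\<^sup>+w. ennreal (norm (h w) / norm (a - w)) \<partial>lborel)"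
    by (rule norm_cauchy_transform_le)
  also have "\<dots> \<le> (\<integral>\<^sup>+w. ennreal (4 / r\<^sup>2) * (ennreal (norm (g w)) * indicator (cball a (3 * r)) w) \<partial>lborel)"
  proof (rule nn_integral_mono)
    fix w
    show "ennreal (norm (h w) / norm (a - w)) \<le> ennreal (4 / r\<^sup>2) * (ennreal (norm (g w)) * indicator (cball a (3 * r)) w)"
    proof (cases "h w = 0")
      case False
      have w: "w \<in> cball a (3 * r)" using h0[of w] False by blast
      have "r \<le> norm (a - w)"
        using \<kappa>(4)[of w] False by (cases "norm (w - a) \<le> r") (auto simp: h_def norm_minus_commute)
      then have "norm (h w) / norm (a - w) \<le> (norm (g w) * (4 / r)) / r"
        unfolding h_def norm_mult using r by (intro frac_le mult_left_mono \<kappa>(3)) auto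
      also have "\<dots> = 4 / r\<^sup>2 * norm (g w)" by (simp add: power2_eq_square)
      finally show ?thesis using w by (simp add: ennreal_leI flip: ennreal_mult)
    qed simp
  qed
  also have "\<dots> = ennreal (4 / r\<^sup>2) * (\<integral>\<^sup>+w\<in>cball a (3 * r). ennreal (norm (g w)) \<partial>lborel)"
  proof (rule nn_integral_cmult)
    have "(\<lambda>w. indicator (cball a (3 * r)) w *\<^sub>R g w) \<in> borel_measurable borel"
      using holomorphic_on_imp_continuous_on[OF g] sub
      by (intro borel_measurable_continuous_on_indicator continuous_on_subset[OF _ sub]) auto
    then have "(\<lambda>w. ennreal (norm (indicator (cball a (3 * r)) w *\<^sub>R g w))) \<in> borel_measurable borel"
      by measurable
    moreover have "(\<lambda>w. ennreal (norm (indicator (cball a (3 * r)) w *\<^sub>R g w))) = (\<lambda>w. ennreal (norm (g w)) * indicator (cball a (3 * r)) w)"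
      by (auto simp: fun_eq_iff indicator_def)
    ultimately show "(\<lambda>w. ennreal (norm (g w)) * indicator (cball a (3 * r)) w) \<in> borel_measurable lborel"
      by (simp only: measurable_lborel2)
  qed
  finally show ?thesis .
qed

lemma holomorphic_norm_le_Lp:
  assumes S: "open S" and g: "g holomorphic_on S" and r: "0 < r" and sub: "cball a (3 * r) \<subseteq> S"
    and p: "1 \<le> p" and I: "0 \<le> I"
    and gI: "(\<integral>\<^sup>+w\<in>cball a (3 * r). ennreal (norm (g w) powr p) \<partial>lborel) \<le> ennreal I"
    and t: "0 < t"
  shows "norm (g a) \<le> 144 * t + 4 * t powr (1 - p) * I / r\<^sup>2"
proof -
  let ?Q = "cball a (3 * r)"
  have m: "(\<lambda>w. ennreal (norm (g w) powr p) * indicator ?Q w) \<in> borel_measurable borel"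
  proof -
    have "(\<lambda>w. indicator ?Q w *\<^sub>R g w) \<in> borel_measurable borel"
      using holomorphic_on_imp_continuous_on[OF g] sub
      by (intro borel_measurable_continuous_on_indicator continuous_on_subset[OF _ sub]) auto
    then have "(\<lambda>w. ennreal (norm (indicator ?Q w *\<^sub>R g w) powr p)) \<in> borel_measurable borel"
      by measurable
    moreover have "(\<lambda>w. ennreal (norm (indicator ?Q w *\<^sub>R g w) powr p)) = (\<lambda>w. ennreal (norm (g w) powr p) * indicator ?Q w)"
      by (auto simp: fun_eq_iff indicator_def)
    ultimately show ?thesis by (simp only:)
  qed
  then have m': "(\<lambda>w. ennreal (norm (g w) powr p) * indicator ?Q w) \<in> borel_measurable lborel"
    by (simp only: measurable_lborel2)
  have "ennreal (norm (g a)) \<le> ennreal (4 / r\<^sup>2) * (\<integral>\<^sup>+w\<in>?Q. ennreal (norm (g w)) \<partial>lborel)"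
    by (rule holomorphic_norm_le_mean[OF S g r sub])
  also have "(\<integral>\<^sup>+w\<in>?Q. ennreal (norm (g w)) \<partial>lborel)
      \<le> (\<integral>\<^sup>+w. ennreal t * indicator ?Q w + ennreal (t powr (1 - p)) * (ennreal (norm (g w) powr p) * indicator ?Q w) \<partial>lborel)"
  proof (rule nn_integral_mono)
    fix w
    have "ennreal (norm (g w)) \<le> ennreal (t + t powr (1 - p) * norm (g w) powr p)"
      using p t by (intro ennreal_leI le_add_powr) auto
    also have "\<dots> = ennreal t + ennreal (t powr (1 - p)) * ennreal (norm (g w) powr p)"
      using t by (simp add: ennreal_mult)
    finally show "ennreal (norm (g w)) * indicator ?Q w
        \<le> ennreal t * indicator ?Q w + ennreal (t powr (1 - p)) * (ennreal (norm (g w) powr p) * indicator ?Q w)"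
      by (auto simp: indicator_def)
  qed
  also have "\<dots> = (\<integral>\<^sup>+w. ennreal t * indicator ?Q w \<partial>lborel) + (\<integral>\<^sup>+w. ennreal (t powr (1 - p)) * (ennreal (norm (g w) powr p) * indicator ?Q w) \<partial>lborel)"
    by (intro nn_integral_add borel_measurable_times_ennreal borel_measurable_const borel_measurable_indicator m') auto
  also have "(\<integral>\<^sup>+w. ennreal t * indicator ?Q w \<partial>lborel) = ennreal t * emeasure lborel ?Q"
    by (rule nn_integral_cmult_indicator) auto
  also have "emeasure lborel ?Q = ennreal (pi * (9 * r\<^sup>2))"
    using r by (subst emeasure_cball) (auto simp: unit_ball_vol_2 power_mult_distrib)
  also have "(\<integral>\<^sup>+w. ennreal (t powr (1 - p)) * (ennreal (norm (g w) powr p) * indicator ?Q w) \<partial>lborel)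
      = ennreal (t powr (1 - p)) * (\<integral>\<^sup>+w\<in>?Q. ennreal (norm (g w) powr p) \<partial>lborel)"
    by (rule nn_integral_cmult[OF m'])
  also have "\<dots> \<le> ennreal (t powr (1 - p)) * ennreal I"
    by (intro mult_left_mono gI) auto
  finally have "ennreal (norm (g a)) \<le> ennreal (4 / r\<^sup>2) * (ennreal t * ennreal (pi * (9 * r\<^sup>2)) + ennreal (t powr (1 - p)) * ennreal I)"
    by (simp add: mult_left_mono)
  also have "\<dots> = ennreal (4 / r\<^sup>2 * (t * (pi * (9 * r\<^sup>2)) + t powr (1 - p) * I))"
  proof -
    have "0 \<le> pi * (9 * r\<^sup>2)" "0 \<le> 4 / r\<^sup>2" "0 \<le> t" using t by auto
    then show ?thesis
      using I by (simp only: ennreal_mult ennreal_plus add_nonneg_nonneg mult_nonneg_nonneg powr_ge_zero)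
  qed
  finally have "norm (g a) \<le> 4 / r\<^sup>2 * (t * (pi * (9 * r\<^sup>2)) + t powr (1 - p) * I)"
    using t I by (subst (asm) ennreal_le_iff) auto
  also have "\<dots> = 36 * pi * t + 4 * t powr (1 - p) * I / r\<^sup>2"
    using r by (simp add: field_simps)
  also have "36 * pi * t \<le> 144 * t"
    using pi_less_4 t by simp
  finally show ?thesis by simp
qed

lemma nn_integral_shrinking_ball:
  assumes f[measurable]: "f \<in> borel_measurable borel" and fin: "(\<integral>\<^sup>+w. f w \<partial>(lborel :: complex measure)) < \<infinity>"
    and e: "0 < e"
  obtains \<delta> where "0 < \<delta>" "(\<integral>\<^sup>+w\<in>ball a \<delta>. f w \<partial>lborel) < ennreal e"
proof -
  let ?M = "density lborel f"
  have "(\<lambda>n. emeasure ?M (ball a (1 / Suc n))) \<longlonglongrightarrow> emeasure ?M (\<Inter>n. ball a (1 / Suc n))"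
  proof (rule Lim_emeasure_decseq)
    show "decseq (\<lambda>n. ball a (1 / Suc n))"
      unfolding decseq_def
    proof (intro allI impI subset_ball)
      fix m n :: nat assume "m \<le> n"
      then show "1 / Suc n \<le> 1 / Suc m" by (intro divide_left_mono) auto
    qed
    show "emeasure ?M (ball a (1 / Suc n)) \<noteq> \<infinity>" for n
    proof -
      have "emeasure ?M (ball a (1 / Suc n)) \<le> emeasure ?M (space ?M)"
        by (rule emeasure_mono) auto
      also have "\<dots> < \<infinity>"
        using fin by (simp add: emeasure_density)
      finally show ?thesis by simp
    qed
  qed auto
  moreover have "(\<Inter>n. ball a (1 / Suc n)) = {a}"
  proof (intro equalityI subsetI)
    fix w assume w: "w \<in> (\<Inter>n. ball a (1 / Suc n))"
    have "w = a"
    proof (rule ccontr)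
      assume "w \<noteq> a"
      then obtain n where "inverse (Suc n) < dist a w"
        using reals_Archimedean[of "dist a w"] by auto
      moreover have "dist a w < inverse (Suc n)" using w by (simp add: inverse_eq_divide)
      ultimately show False by simp
    qed
    then show "w \<in> {a}" by simp
  qed auto
  moreover have "emeasure ?M {a} = 0"
    by (subst emeasure_density) (auto simp: nn_integral_null_set)
  ultimately have "(\<lambda>n. emeasure ?M (ball a (1 / Suc n))) \<longlonglongrightarrow> 0" by simp
  then have "\<forall>\<^sub>F n in sequentially. emeasure ?M (ball a (1 / Suc n)) < ennreal e"
    using e by (intro order_tendstoD) auto
  then obtain n where "emeasure ?M (ball a (1 / Suc n)) < ennreal e"
    by (auto simp: eventually_sequentially)
  then show ?thesis
    by (intro that[of "1 / Suc n"]) (auto simp: emeasure_density)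
qed

lemma entire_Lp_eq_0:
  assumes g: "g holomorphic_on UNIV" and p: "1 \<le> p"
    and I: "(\<integral>\<^sup>+w. ennreal (norm (g w) powr p) \<partial>lborel) < \<infinity>"
  shows "g z = 0"
proof -
  obtain J where J: "0 \<le> J" "(\<integral>\<^sup>+w. ennreal (norm (g w) powr p) \<partial>lborel) = ennreal J"
    using I by (cases "\<integral>\<^sup>+w. ennreal (norm (g w) powr p) \<partial>lborel") auto
  have b: "norm (g z) \<le> 144 * t + 4 * t powr (1 - p) * J / r\<^sup>2" if "0 < t" "0 < r" for t r
  proof (rule holomorphic_norm_le_Lp[OF open_UNIV g that(2) _ p J(1) _ that(1)])
    show "(\<integral>\<^sup>+w\<in>cball z (3 * r). ennreal (norm (g w) powr p) \<partial>lborel) \<le> ennreal J"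
      unfolding J(2)[symmetric] by (intro nn_integral_mono) (auto simp: indicator_def)
  qed simp
  have "norm (g z) \<le> 144 * t" if t: "0 < t" for t
  proof (rule tendsto_lowerbound)
    show "((\<lambda>r. 144 * t + 4 * t powr (1 - p) * J / r\<^sup>2) \<longlongrightarrow> 144 * t) at_top"
      by real_asymp
    show "\<forall>\<^sub>F r in at_top. norm (g z) \<le> 144 * t + 4 * t powr (1 - p) * J / r\<^sup>2"
      using eventually_gt_at_top[of "0::real"] by eventually_elim (use b t in auto)
  qed simp
  then have "norm (g z) \<le> 0 + e" if "0 < e" for e
    using \<open>\<And>t. 0 < t \<Longrightarrow> norm (g z) \<le> 144 * t\<close>[of "e / 144"] that by simp
  then have "norm (g z) \<le> 0" by (rule field_le_epsilon)
  then show ?thesis by simp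
qed

text \<open>For \<open>p \<ge> 2\<close> isolated singularities of \<open>p\<close>-integrable holomorphic functions are removable, and
  an entire function that is \<open>p\<close>-integrable over the plane vanishes.\<close>

lemma holomorphic_Lp_cofinite_eq_0:
  assumes "finite F" and "g holomorphic_on - F" and p: "2 \<le> p"
    and "g \<in> borel_measurable borel"
    and "(\<integral>\<^sup>+w. ennreal (norm (g w) powr p) \<partial>lborel) < \<infinity>" and "z \<notin> F"
  shows "g z = 0"
  using assms(1,2,4-6)
proof (induction F arbitrary: g z rule: finite_induct)
  case empty
  then show ?case using p by (intro entire_Lp_eq_0[of g p]) auto
next
  case (insert a F)
  note [measurable] = insert.prems(2)
  obtain \<rho> where \<rho>: "\<rho> > 0" "ball a \<rho> \<inter> F = {}"
  proof -
    have "open (- F)" "a \<in> - F"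
      using finite_imp_closed[OF insert.hyps(1)] insert.hyps(2) by (auto simp: open_Compl)
    then obtain \<rho> where "\<rho> > 0" "ball a \<rho> \<subseteq> - F" by (rule openE)
    then show ?thesis by (intro that) auto
  qed
  have S: "open (- insert a F)"
    using insert.hyps(1) by (intro open_Compl finite_imp_closed) auto
  have lim: "((\<lambda>w. (w - a) * g w) \<longlongrightarrow> 0) (at a)"
  proof (rule tendstoI)
    fix e :: real assume e: "0 < e"
    \<comment> \<open>any value below \<open>e / 592\<close> will do\<close>
    define \<eta> where "\<eta> = e / 1200"
    have \<eta>: "\<eta> > 0" using e by (simp add: \<eta>_def)
    define E where "E = \<eta> / (\<eta> powr (1 - p))"
    have E: "E > 0" using \<eta> by (simp add: E_def)
    obtain \<delta> where \<delta>: "0 < \<delta>" "(\<integral>\<^sup>+w\<in>ball a \<delta>. ennreal (norm (g w) powr p) \<partial>lborel) < ennreal E"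
      using nn_integral_shrinking_ball[OF _ insert.prems(3) E, of a] by auto
    define d where "d = min 1 (min (\<rho> / 2) (\<delta> / 2))"
    have d: "d > 0" using \<rho> \<delta> by (simp add: d_def)
    have "dist ((w - a) * g w) 0 < e" if w: "w \<noteq> a" "dist w a < d" for w
    proof -
      define r where "r = norm (w - a) / 4"
      have r: "0 < r" "r \<le> 1" "8 * r < \<rho>" "8 * r < \<delta>"
        using w by (auto simp: r_def d_def dist_norm)
      have near: "0 < norm (x - a)" "norm (x - a) < 8 * r" if "x \<in> cball w (3 * r)" for x
      proof -
        have "norm (w - x) \<le> 3 * r" using that by (simp add: dist_norm)
        moreover have "norm (w - a) = 4 * r" by (simp add: r_def)
        ultimately show "0 < norm (x - a)" "norm (x - a) < 8 * r"
          using norm_triangle_ineq[of "w - x" "x - a"] norm_triangle_ineq2[of "x - a" "w - a"]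
            norm_triangle_ineq4[of "w - a" "w - x"] r(1) by (auto simp: algebra_simps)
      qed
      \<comment> \<open>the estimate with \<open>t = \<eta> / r\<close>, the size that \<open>g\<close> may have if \<open>(w - a) g(w)\<close> is of size \<open>\<eta>\<close>\<close>
      have "norm (g w) \<le> 144 * (\<eta> / r) + 4 * (\<eta> / r) powr (1 - p) * E / r\<^sup>2"
      proof (rule holomorphic_norm_le_Lp[OF S insert.prems(1) r(1)])
        have "x \<notin> insert a F" if "x \<in> cball w (3 * r)" for x
        proof -
          have "x \<in> ball a \<rho>" using near[OF that] r by (simp add: dist_norm norm_minus_commute)
          then show ?thesis using \<rho>(2) near(1)[OF that] by auto
        qed
        then show "cball w (3 * r) \<subseteq> - insert a F" by blast
        have "cball w (3 * r) \<subseteq> ball a \<delta>"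
          using near(2) r by (force simp: dist_norm norm_minus_commute)
        then have "(\<integral>\<^sup>+x\<in>cball w (3 * r). ennreal (norm (g x) powr p) \<partial>lborel)
            \<le> (\<integral>\<^sup>+x\<in>ball a \<delta>. ennreal (norm (g x) powr p) \<partial>lborel)"
          by (intro nn_integral_mono) (auto simp: indicator_def)
        then show "(\<integral>\<^sup>+x\<in>cball w (3 * r). ennreal (norm (g x) powr p) \<partial>lborel) \<le> ennreal E"
          using \<delta>(2) by simp
      qed (use p E \<eta> r in auto)
      then have "r * norm (g w) \<le> r * (144 * (\<eta> / r) + 4 * (\<eta> / r) powr (1 - p) * E / r\<^sup>2)"
        using r by (intro mult_left_mono) auto
      also have "\<dots> = 144 * \<eta> + 4 * \<eta> powr (1 - p) * E * (r powr (p - 2))"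
      proof -
        have "(\<eta> / r) powr (1 - p) = \<eta> powr (1 - p) * r powr (p - 1)"
          using \<eta> r by (simp add: powr_divide powr_diff field_simps)
        moreover have "r powr (p - 1) = r * r powr (p - 2)"
          using r by (simp add: powr_mult_base)
        ultimately show ?thesis using r by (simp add: field_simps power2_eq_square)
      qed
      also have "\<dots> \<le> 144 * \<eta> + 4 * \<eta> powr (1 - p) * E * 1"
      proof -
        have "r powr (p - 2) \<le> 1" using r p by (simp add: powr_le1)
        then show ?thesis using E by (intro add_mono mult_left_mono) auto
      qed
      also have "\<dots> = 148 * \<eta>" using \<eta> by (simp add: E_def)
      finally have "norm (w - a) * norm (g w) \<le> 592 * \<eta>" by (simp add: r_def)
      also have "\<dots> < e" using e by (simp add: \<eta>_def)
      finally show ?thesis by (simp add: norm_mult)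
    qed
    then show "\<forall>\<^sub>F w in at a. dist ((w - a) * g w) 0 < e"
      using d by (auto simp: eventually_at)
  qed
  have oF: "open (- F)" using insert.hyps(1) by (intro open_Compl finite_imp_closed) auto
  have "g holomorphic_on (- F) - {a}"
    by (rule holomorphic_on_subset[OF insert.prems(1)]) auto
  moreover have "a \<in> interior (- F)" using oF insert.hyps(2) by (simp add: interior_open)
  ultimately obtain G where G: "G holomorphic_on - F" "\<And>w. w \<in> - F - {a} \<Longrightarrow> G w = g w"
    using holomorphic_on_extend_lim[of g "- F" a] lim by blast
  define G' where "G' w = (if w = a then G a else g w)" for w
  have "G' holomorphic_on - F"
    by (rule holomorphic_transform[OF G(1)]) (use G(2) in \<open>auto simp: G'_def\<close>)
  moreover have "G' \<in> borel_measurable borel"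
    unfolding G'_def by measurable
  moreover have "(\<integral>\<^sup>+w. ennreal (norm (G' w) powr p) \<partial>lborel) = (\<integral>\<^sup>+w. ennreal (norm (g w) powr p) \<partial>lborel)"
  proof (rule nn_integral_cong_AE)
    show "AE w in lborel. ennreal (norm (G' w) powr p) = ennreal (norm (g w) powr p)"
      using AE_lborel_singleton[of a] by eventually_elim (simp add: G'_def)
  qed
  ultimately have "G' z = 0"
    using insert.IH[of G' z] insert.prems by simp
  then show ?case using insert.prems by (simp add: G'_def)
qed

section \<open>Bergman spaces as Banach spaces\<close>

lemma bergman_borel_measurable:
  assumes "open \<Omega>" "f holomorphic_on \<Omega>" "\<And>z. z \<notin> \<Omega> \<Longrightarrow> f z = 0"
  shows "f \<in> borel_measurable borel"
proof -
  have "(\<lambda>z. indicator \<Omega> z *\<^sub>R f z) \<in> borel_measurable borel"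
    using assms by (intro borel_measurable_continuous_on_indicator holomorphic_on_imp_continuous_on) auto
  moreover have "(\<lambda>z. indicator \<Omega> z *\<^sub>R f z) = f"
    using assms(3) by (auto simp: fun_eq_iff indicator_def)
  ultimately show ?thesis by simp
qed

text \<open>Because elements of the space vanish off \<open>\<Omega>\<close>, integrals over \<open>\<Omega>\<close> may be replaced by integrals over \<open>\<complex>\<close>.\<close>

lemma bergman_iff:
  assumes "open \<Omega>"
  shows "f \<in> bergman \<Omega> p \<longleftrightarrow> f holomorphic_on \<Omega> \<and> (\<forall>z. z \<notin> \<Omega> \<longrightarrow> f z = 0) \<and>
           (\<integral>\<^sup>+z. ennreal (norm (f z) powr p) \<partial>lborel) < \<infinity>"
proof (cases "f holomorphic_on \<Omega> \<and> (\<forall>z. z \<notin> \<Omega> \<longrightarrow> f z = 0)")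
  case True
  then have [measurable]: "f \<in> borel_measurable borel"
    using bergman_borel_measurable[OF assms] by blast
  have e: "(\<lambda>z. indicator \<Omega> z *\<^sub>R (norm (f z) powr p)) = (\<lambda>z. norm (f z) powr p)"
    using True by (auto simp: fun_eq_iff indicator_def)
  have "f \<in> bergman \<Omega> p \<longleftrightarrow> integrable lborel (\<lambda>z. norm (f z) powr p)"
    using True e by (simp add: bergman_def set_integrable_def)
  then show ?thesis
    using True by (simp add: integrable_iff_bounded)
qed (auto simp: bergman_def)

lemma bergman_measurable:
  assumes "open \<Omega>" "f \<in> bergman \<Omega> p"
  shows "f \<in> borel_measurable borel"
  using assms bergman_borel_measurable by (auto simp: bergman_def)

lemma powr_norm_add_le:
  fixes x y :: complex
  assumes "0 \<le> p"
  shows "norm (x + y) powr p \<le> 2 powr p * (norm x powr p + norm y powr p)"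
proof -
  have "norm (x + y) \<le> 2 * max (norm x) (norm y)"
    using norm_triangle_ineq[of x y] by (simp add: max_def)
  then have "norm (x + y) powr p \<le> (2 * max (norm x) (norm y)) powr p"
    using assms by (intro powr_mono2) auto
  also have "\<dots> = 2 powr p * max (norm x) (norm y) powr p"
    by (simp add: powr_mult)
  also have "\<dots> \<le> 2 powr p * (norm x powr p + norm y powr p)"
    by (intro mult_left_mono) (auto simp: max_def)
  finally show ?thesis .
qed

lemma nn_integral_powr_norm_add:
  fixes f g :: "complex \<Rightarrow> complex"
  assumes [measurable]: "f \<in> borel_measurable borel" "g \<in> borel_measurable borel" and p: "0 \<le> p"
    and f: "(\<integral>\<^sup>+z. ennreal (norm (f z) powr p) \<partial>lborel) < \<infinity>"
    and g: "(\<integral>\<^sup>+z. ennreal (norm (g z) powr p) \<partial>lborel) < \<infinity>"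
  shows "(\<integral>\<^sup>+z. ennreal (norm (f z + g z) powr p) \<partial>lborel) < \<infinity>"
proof -
  have "(\<integral>\<^sup>+z. ennreal (norm (f z + g z) powr p) \<partial>lborel)
     \<le> (\<integral>\<^sup>+z. ennreal (2 powr p) * (ennreal (norm (f z) powr p) + ennreal (norm (g z) powr p)) \<partial>lborel)"
    using powr_norm_add_le[OF p] by (intro nn_integral_mono) (simp add: ennreal_leI flip: ennreal_mult ennreal_plus)
  also have "\<dots> = ennreal (2 powr p) * ((\<integral>\<^sup>+z. ennreal (norm (f z) powr p) \<partial>lborel) + (\<integral>\<^sup>+z. ennreal (norm (g z) powr p) \<partial>lborel))"
    by (simp add: nn_integral_cmult nn_integral_add)
  also have "\<dots> < \<infinity>"
    using f g by (simp add: ennreal_mult_less_top)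
  finally show ?thesis .
qed

lemma nn_integral_powr_norm_scale:
  fixes f :: "complex \<Rightarrow> complex"
  assumes [measurable]: "f \<in> borel_measurable borel"
  shows "(\<integral>\<^sup>+z. ennreal (norm (c * f z) powr p) \<partial>lborel) = ennreal (norm c powr p) * (\<integral>\<^sup>+z. ennreal (norm (f z) powr p) \<partial>lborel)"
  by (subst nn_integral_cmult[symmetric]) (auto simp: norm_mult powr_mult ennreal_mult)

lemma bergman_add:
  assumes "open \<Omega>" "0 \<le> p" "f \<in> bergman \<Omega> p" "g \<in> bergman \<Omega> p"
  shows "f + g \<in> bergman \<Omega> p"
proof -
  have "(\<lambda>z. f z + g z) holomorphic_on \<Omega>"
    using assms by (intro holomorphic_on_add) (auto simp: bergman_def)
  moreover have "(\<integral>\<^sup>+z. ennreal (norm (f z + g z) powr p) \<partial>lborel) < \<infinity>"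
    using assms by (intro nn_integral_powr_norm_add bergman_measurable) (auto simp: bergman_iff)
  ultimately show ?thesis
    using assms by (simp add: bergman_iff plus_fun_def)
qed

lemma bergman_scale:
  assumes "open \<Omega>" "f \<in> bergman \<Omega> p"
  shows "(\<lambda>z. c * f z) \<in> bergman \<Omega> p"
proof -
  have "(\<lambda>z. c * f z) holomorphic_on \<Omega>"
    using assms by (intro holomorphic_on_mult) (auto simp: bergman_def)
  then show ?thesis
    using assms bergman_measurable[OF assms]
    by (auto simp: bergman_iff nn_integral_powr_norm_scale ennreal_mult_less_top)
qed

lemma bergman_subspace:
  assumes "open \<Omega>" "0 \<le> p"
  shows "cfun.subspace (bergman \<Omega> p)"
proof -
  have "0 \<in> bergman \<Omega> p"
    using assms by (simp add: bergman_iff zero_fun_def)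
  then show ?thesis
    unfolding cfun.subspace_def using assms bergman_add bergman_scale by blast
qed

lemma bergman_diff:
  assumes "open \<Omega>" "0 \<le> p" "f \<in> bergman \<Omega> p" "g \<in> bergman \<Omega> p"
  shows "f - g \<in> bergman \<Omega> p"
  using cfun.subspace_diff[OF bergman_subspace[OF assms(1,2)] assms(3,4)] .

lemma bergman_norm_nonneg: "0 \<le> bergman_norm \<Omega> p f"
  by (simp add: bergman_norm_def)

lemma nn_integral_eq_bergman_norm:
  assumes "open \<Omega>" "0 < p" "f \<in> bergman \<Omega> p"
  shows "(\<integral>\<^sup>+z. ennreal (norm (f z) powr p) \<partial>lborel) = ennreal (bergman_norm \<Omega> p f powr p)"
proof -
  have [measurable]: "f \<in> borel_measurable borel"
    using assms bergman_measurable by blast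
  have z: "\<forall>z. z \<notin> \<Omega> \<longrightarrow> f z = 0" using assms by (simp add: bergman_def)
  have e: "(\<lambda>z. indicator \<Omega> z *\<^sub>R (norm (f z) powr p)) = (\<lambda>z. norm (f z) powr p)"
    using z by (auto simp: fun_eq_iff indicator_def)
  have "integrable lborel (\<lambda>z. norm (f z) powr p)"
    using assms by (simp add: integrable_iff_bounded bergman_iff)
  then have "(\<integral>\<^sup>+z. ennreal (norm (f z) powr p) \<partial>lborel) = ennreal (\<integral>z. norm (f z) powr p \<partial>lborel)"
    by (intro nn_integral_eq_integral) auto
  also have "(\<integral>z. norm (f z) powr p \<partial>lborel) = (LINT z:\<Omega>|lborel. norm (f z) powr p)"
    unfolding set_lebesgue_integral_def e ..
  also have "\<dots> = bergman_norm \<Omega> p f powr p"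
    using assms(2) unfolding bergman_norm_def set_lebesgue_integral_def
    by (simp add: powr_powr Bochner_Integration.integral_nonneg)
  finally show ?thesis .
qed

lemma bergman_norm_le:
  assumes "open \<Omega>" "0 < p" "f \<in> bergman \<Omega> p" "0 \<le> e"
    and "(\<integral>\<^sup>+z. ennreal (norm (f z) powr p) \<partial>lborel) \<le> ennreal (e powr p)"
  shows "bergman_norm \<Omega> p f \<le> e"
proof -
  have "bergman_norm \<Omega> p f powr p \<le> e powr p"
    using assms by (simp add: nn_integral_eq_bergman_norm ennreal_le_iff)
  then show ?thesis
    using assms bergman_norm_nonneg[of \<Omega> p f] by (meson not_le powr_less_mono2)
qed

lemma bergman_point_evaluation:
  assumes \<Omega>: "open \<Omega>" and p: "1 \<le> p" and f: "f \<in> bergman \<Omega> p"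
    and r: "0 < r" "cball a (3 * r) \<subseteq> \<Omega>"
  shows "norm (f a) \<le> (144 + 4 / r\<^sup>2) * bergman_norm \<Omega> p f"
proof -
  let ?N = "bergman_norm \<Omega> p f"
  have fh: "f holomorphic_on \<Omega>" using f by (simp add: bergman_def)
  have I: "(\<integral>\<^sup>+w\<in>cball a (3 * r). ennreal (norm (f w) powr p) \<partial>lborel) \<le> ennreal (?N powr p)"
    using p nn_integral_eq_bergman_norm[OF \<Omega> _ f]
    by (auto intro!: nn_integral_mono simp: indicator_def simp flip: nn_integral_eq_bergman_norm[OF \<Omega> _ f])
  have b: "norm (f a) \<le> 144 * t + 4 * t powr (1 - p) * ?N powr p / r\<^sup>2" if "0 < t" for t
    by (rule holomorphic_norm_le_Lp[OF \<Omega> fh r p _ I that]) simp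
  show ?thesis
  proof (cases "?N = 0")
    case True
    have "norm (f a) \<le> 0 + e" if "0 < e" for e
      using b[of "e / 144"] that True by simp
    then have "norm (f a) \<le> 0" by (rule field_le_epsilon)
    then show ?thesis using True by simp
  next
    case False
    then have N: "0 < ?N" using bergman_norm_nonneg[of \<Omega> p f] by simp
    have "?N powr (1 - p) * ?N powr p = ?N"
      using N by (simp flip: powr_add)
    then show ?thesis using b[OF N] by (simp add: algebra_simps)
  qed
qed

lemma bergman_norm_eq_0_iff:
  assumes \<Omega>: "open \<Omega>" and p: "1 \<le> p" and f: "f \<in> bergman \<Omega> p"
  shows "bergman_norm \<Omega> p f = 0 \<longleftrightarrow> f = 0"
proof
  assume N: "bergman_norm \<Omega> p f = 0"
  show "f = 0"
  proof
    fix a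
    show "f a = 0 a"
    proof (cases "a \<in> \<Omega>")
      case True
      then obtain e where e: "e > 0" "cball a e \<subseteq> \<Omega>"
        using \<Omega> open_contains_cball by blast
      then show ?thesis
        using bergman_point_evaluation[OF \<Omega> p f, of "e / 3" a] N by simp
    qed (use f in \<open>simp add: bergman_def\<close>)
  qed
next
  assume "f = 0"
  then show "bergman_norm \<Omega> p f = 0"
    using p by (simp add: bergman_norm_def)
qed

lemma bergman_norm_scale:
  assumes \<Omega>: "open \<Omega>" and p: "1 \<le> p" and f: "f \<in> bergman \<Omega> p"
  shows "bergman_norm \<Omega> p (\<lambda>z. c * f z) = norm c * bergman_norm \<Omega> p f"
proof -
  have "ennreal (bergman_norm \<Omega> p (\<lambda>z. c * f z) powr p) = ennreal (norm c powr p) * ennreal (bergman_norm \<Omega> p f powr p)"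
    using p nn_integral_powr_norm_scale[OF bergman_measurable[OF \<Omega> f]]
      nn_integral_eq_bergman_norm[OF \<Omega> _ f] nn_integral_eq_bergman_norm[OF \<Omega> _ bergman_scale[OF \<Omega> f]]
    by simp
  also have "\<dots> = ennreal ((norm c * bergman_norm \<Omega> p f) powr p)"
    by (simp add: powr_mult bergman_norm_nonneg ennreal_mult)
  finally have "bergman_norm \<Omega> p (\<lambda>z. c * f z) powr p = (norm c * bergman_norm \<Omega> p f) powr p"
    by simp
  then have "(bergman_norm \<Omega> p (\<lambda>z. c * f z) powr p) powr (1 / p) = ((norm c * bergman_norm \<Omega> p f) powr p) powr (1 / p)"
    by simp
  then show ?thesis using p by (simp add: powr_powr bergman_norm_nonneg)
qed

lemma powr_convex_combination:
  fixes x y p u :: real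
  assumes "1 \<le> p" "0 \<le> x" "0 \<le> y" "0 \<le> u" "u \<le> 1"
  shows "(u * x + (1 - u) * y) powr p \<le> u * x powr p + (1 - u) * y powr p"
proof -
  have shrink: "(v * w) powr p \<le> v * w powr p" if "0 \<le> v" "v \<le> 1" "0 \<le> w" for v w
  proof -
    have "v powr p \<le> v powr 1"
      using that assms(1) by (intro powr_mono') auto
    then have "v powr p * w powr p \<le> v * w powr p"
      using that by (intro mult_right_mono) auto
    then show ?thesis using that by (simp add: powr_mult)
  qed
  consider "x = 0" | "y = 0" | "0 < x" "0 < y" using assms by linarith
  then show ?thesis
  proof cases
    case 3
    from convex_onD[OF powr_convex[OF assms(1)], of "1 - u" x y] assms 3
    show ?thesis by (simp add: algebra_simps)
  qed (use shrink[of u x] shrink[of "1 - u" y] assms in auto)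
qed

text \<open>Minkowski's inequality: with \<open>a, b\<close> the norms and \<open>u = a / (a + b)\<close>, convexity bounds
  \<open>((norm f + norm g) / (a + b)) ^ p\<close> by \<open>u (norm f / a) ^ p + (1 - u) (norm g / b) ^ p\<close>, which integrates to \<open>1\<close>.\<close>

lemma bergman_norm_triangle:
  assumes \<Omega>: "open \<Omega>" and p: "1 \<le> p" and f: "f \<in> bergman \<Omega> p" and g: "g \<in> bergman \<Omega> p"
  shows "bergman_norm \<Omega> p (f + g) \<le> bergman_norm \<Omega> p f + bergman_norm \<Omega> p g"
proof (cases "f = 0 \<or> g = 0")
  case True
  then show ?thesis using bergman_norm_nonneg[of \<Omega> p] by auto
next
  case False
  have [measurable]: "f \<in> borel_measurable borel" "g \<in> borel_measurable borel"
    using f g \<Omega> bergman_measurable by blast+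
  define a where "a = bergman_norm \<Omega> p f"
  define b where "b = bergman_norm \<Omega> p g"
  have a: "a > 0" and b: "b > 0"
    using False bergman_norm_eq_0_iff[OF \<Omega> p f] bergman_norm_eq_0_iff[OF \<Omega> p g] bergman_norm_nonneg[of \<Omega> p]
    by (auto simp: a_def b_def less_le)
  define u where "u = a / (a + b)"
  have u: "0 \<le> u" "u \<le> 1" "1 - u = b / (a + b)" using a b by (auto simp: u_def field_simps)
  define A where "A = (a + b) powr p * (u / a powr p)"
  define B where "B = (a + b) powr p * ((1 - u) / b powr p)"
  have AB: "A \<ge> 0" "B \<ge> 0" using u a b by (auto simp: A_def B_def)
  have pt: "norm (f z + g z) powr p \<le> A * norm (f z) powr p + B * norm (g z) powr p" for z
  proof -
    have "norm (f z + g z) \<le> (a + b) * (u * (norm (f z) / a) + (1 - u) * (norm (g z) / b))"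
    proof -
      have "(a + b) * u = a" "(a + b) * (1 - u) = b" unfolding u(3) using a b by (simp_all add: u_def)
      then have "(a + b) * (u * (norm (f z) / a) + (1 - u) * (norm (g z) / b)) = a * (norm (f z) / a) + b * (norm (g z) / b)"
        by (simp only: distrib_left mult.assoc[symmetric])
      also have "\<dots> = norm (f z) + norm (g z)" using a b by simp
      finally show ?thesis using norm_triangle_ineq[of "f z" "g z"] by simp
    qed
    then have "norm (f z + g z) powr p \<le> ((a + b) * (u * (norm (f z) / a) + (1 - u) * (norm (g z) / b))) powr p"
      using p by (intro powr_mono2) auto
    also have "\<dots> = (a + b) powr p * (u * (norm (f z) / a) + (1 - u) * (norm (g z) / b)) powr p"
      using a b u by (intro powr_mult)
    also have "\<dots> \<le> (a + b) powr p * (u * (norm (f z) / a) powr p + (1 - u) * (norm (g z) / b) powr p)"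
      using p a b u(1,2) by (intro mult_left_mono powr_convex_combination) auto
    also have "\<dots> = A * norm (f z) powr p + B * norm (g z) powr p"
      using a b by (simp add: A_def B_def powr_divide algebra_simps)
    finally show ?thesis .
  qed
  have "(\<integral>\<^sup>+z. ennreal (norm ((f + g) z) powr p) \<partial>lborel)
     \<le> (\<integral>\<^sup>+z. ennreal A * ennreal (norm (f z) powr p) + ennreal B * ennreal (norm (g z) powr p) \<partial>lborel)"
    using pt AB by (intro nn_integral_mono) (simp add: ennreal_leI flip: ennreal_mult ennreal_plus)
  also have "\<dots> = ennreal A * ennreal (a powr p) + ennreal B * ennreal (b powr p)"
    using p nn_integral_eq_bergman_norm[OF \<Omega> _ f] nn_integral_eq_bergman_norm[OF \<Omega> _ g]
    by (simp add: nn_integral_add nn_integral_cmult a_def b_def)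
  also have "\<dots> = ennreal (A * a powr p + B * b powr p)"
    using AB by (simp add: ennreal_mult ennreal_plus)
  also have "A * a powr p + B * b powr p = (a + b) powr p"
  proof -
    have "A * a powr p = (a + b) powr p * u" "B * b powr p = (a + b) powr p * (1 - u)"
      using a b by (simp_all add: A_def B_def)
    then show ?thesis by (simp add: algebra_simps)
  qed
  finally have "(\<integral>\<^sup>+z. ennreal (norm ((f + g) z) powr p) \<partial>lborel) \<le> ennreal ((a + b) powr p)" .
  then show ?thesis
    using p a b bergman_add[OF \<Omega> _ f g] by (intro bergman_norm_le[OF \<Omega>]) (auto simp: a_def b_def)
qed

lemma bergman_metric_space:
  assumes \<Omega>: "open \<Omega>" and p: "1 \<le> p"
  shows "Metric_space (bergman \<Omega> p) (\<lambda>f g. bergman_norm \<Omega> p (f - g))"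
proof
  fix f g h assume fgh: "f \<in> bergman \<Omega> p" "g \<in> bergman \<Omega> p" "h \<in> bergman \<Omega> p"
  have d: "f - g \<in> bergman \<Omega> p" "g - h \<in> bergman \<Omega> p"
    using fgh p bergman_diff[OF \<Omega>] by auto
  show "bergman_norm \<Omega> p (f - g) = 0 \<longleftrightarrow> f = g"
    using bergman_norm_eq_0_iff[OF \<Omega> p d(1)] by simp
  show "bergman_norm \<Omega> p (f - h) \<le> bergman_norm \<Omega> p (f - g) + bergman_norm \<Omega> p (g - h)"
    using bergman_norm_triangle[OF \<Omega> p d] by simp
next
  fix f g
  show "bergman_norm \<Omega> p (f - g) = bergman_norm \<Omega> p (g - f)"
    unfolding bergman_norm_def by (simp add: norm_minus_commute)
qed (simp add: bergman_norm_nonneg)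

text \<open>A Cauchy sequence converges locally uniformly by the bound on point evaluations, and in the norm by Fatou's
  lemma.\<close>

lemma bergman_complete:
  assumes \<Omega>: "open \<Omega>" and p: "1 \<le> p"
  shows "Metric_space.mcomplete (bergman \<Omega> p) (\<lambda>f g. bergman_norm \<Omega> p (f - g))"
proof -
  interpret Metric_space "bergman \<Omega> p" "\<lambda>f g. bergman_norm \<Omega> p (f - g)"
    by (rule bergman_metric_space[OF \<Omega> p])
  show ?thesis
    unfolding mcomplete_def
  proof (intro allI impI)
    fix \<sigma> assume "MCauchy \<sigma>"
    then have \<sigma>V: "\<And>n. \<sigma> n \<in> bergman \<Omega> p"
      and \<sigma>C: "\<And>e. 0 < e \<Longrightarrow> \<exists>N. \<forall>n m. N \<le> n \<longrightarrow> N \<le> m \<longrightarrow> bergman_norm \<Omega> p (\<sigma> n - \<sigma> m) < e"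
      unfolding MCauchy_def by auto
    have [measurable]: "\<sigma> n \<in> borel_measurable borel" for n
      using bergman_measurable[OF \<Omega> \<sigma>V] .
    have unif: "\<exists>N. \<forall>n m z. N \<le> n \<longrightarrow> N \<le> m \<longrightarrow> z \<in> cball a r \<longrightarrow> norm (\<sigma> n z - \<sigma> m z) < e"
      if r: "0 < r" "cball a (4 * r) \<subseteq> \<Omega>" and e: "0 < e" for a r e
    proof -
      define C where "C = 144 + 4 / r\<^sup>2"
      have C: "C > 0" using r by (simp add: C_def add_pos_nonneg)
      obtain N where N: "\<And>n m. N \<le> n \<Longrightarrow> N \<le> m \<Longrightarrow> bergman_norm \<Omega> p (\<sigma> n - \<sigma> m) < e / C"
        using \<sigma>C[of "e / C"] e C by auto
      have "norm (\<sigma> n z - \<sigma> m z) < e" if "N \<le> n" "N \<le> m" "z \<in> cball a r" for n m z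
      proof -
        have "cball z (3 * r) \<subseteq> cball a (4 * r)"
          using that(3) by (intro cball_subset_cball_iff[THEN iffD2]) (simp add: dist_commute)
        then have "norm ((\<sigma> n - \<sigma> m) z) \<le> C * bergman_norm \<Omega> p (\<sigma> n - \<sigma> m)"
          unfolding C_def using r p by (intro bergman_point_evaluation[OF \<Omega> p] bergman_diff[OF \<Omega>] \<sigma>V) auto
        also have "\<dots> < C * (e / C)"
          using N[OF that(1,2)] C by (intro mult_strict_left_mono)
        finally show ?thesis using C by simp
      qed
      then show ?thesis by blast
    qed
    have small: "\<exists>r>0. cball a (4 * r) \<subseteq> \<Omega>" if a: "a \<in> \<Omega>" for a
    proof -
      obtain e where "e > 0" "cball a e \<subseteq> \<Omega>"
        using \<Omega> a open_contains_cball by blast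
      then show ?thesis by (intro exI[of _ "e / 4"]) auto
    qed
    have conv: "convergent (\<lambda>n. \<sigma> n z)" for z
    proof (cases "z \<in> \<Omega>")
      case True
      obtain r where r: "r > 0" "cball z (4 * r) \<subseteq> \<Omega>" using small[OF True] by blast
      have "Cauchy (\<lambda>n. \<sigma> n z)"
        unfolding Cauchy_def dist_norm using unif[OF r] r(1) by (meson centre_in_cball less_imp_le)
      then show ?thesis by (simp add: Cauchy_convergent_iff)
    next
      case False
      then have "(\<lambda>n. \<sigma> n z) = (\<lambda>n. 0)" using \<sigma>V by (auto simp: bergman_def)
      then show ?thesis by (simp add: convergent_const)
    qed
    define f where "f z = lim (\<lambda>n. \<sigma> n z)" for z
    have lim: "(\<lambda>n. \<sigma> n z) \<longlonglongrightarrow> f z" for z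
      using conv[of z] by (simp add: f_def convergent_LIMSEQ_iff)
    have f0: "f z = 0" if "z \<notin> \<Omega>" for z
    proof -
      have "(\<lambda>n. \<sigma> n z) = (\<lambda>n. 0)" using \<sigma>V that by (auto simp: bergman_def)
      then show ?thesis using lim[of z] LIMSEQ_unique tendsto_const by metis
    qed
    have fhol: "f holomorphic_on \<Omega>"
    proof (rule holomorphic_uniform_sequence[OF \<Omega>])
      show "\<sigma> n holomorphic_on \<Omega>" for n using \<sigma>V[of n] by (simp add: bergman_def)
      fix a assume "a \<in> \<Omega>"
      then obtain r where r: "r > 0" "cball a (4 * r) \<subseteq> \<Omega>" using small by blast
      have "uniform_limit (cball a r) \<sigma> f sequentially"
      proof (rule uniform_limitI)
        fix e :: real assume e: "0 < e"
        obtain N where N: "\<And>n m z. N \<le> n \<Longrightarrow> N \<le> m \<Longrightarrow> z \<in> cball a r \<Longrightarrow> norm (\<sigma> n z - \<sigma> m z) < e / 2"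
          using unif[OF r, of "e / 2"] e by auto
        have "dist (\<sigma> n z) (f z) < e" if "N \<le> n" "z \<in> cball a r" for n z
        proof -
          have "(\<lambda>m. norm (\<sigma> n z - \<sigma> m z)) \<longlonglongrightarrow> norm (\<sigma> n z - f z)"
            by (intro tendsto_intros lim)
          then have "norm (\<sigma> n z - f z) \<le> e / 2"
            by (rule LIMSEQ_le_const2) (use N that in \<open>auto intro!: exI[of _ N] less_imp_le\<close>)
          then show ?thesis using e by (simp add: dist_norm)
        qed
        then show "\<forall>\<^sub>F n in sequentially. \<forall>z\<in>cball a r. dist (\<sigma> n z) (f z) < e"
          by (intro eventually_sequentiallyI[of N]) auto
      qed
      moreover have "cball a r \<subseteq> \<Omega>"
        using r by (intro order_trans[OF _ r(2)] subset_cball) auto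
      ultimately show "\<exists>d>0. cball a d \<subseteq> \<Omega> \<and> uniform_limit (cball a d) \<sigma> f sequentially"
        using r by blast
    qed
    have [measurable]: "f \<in> borel_measurable borel"
      using bergman_borel_measurable[OF \<Omega> fhol f0] .
    have tail: "\<exists>N. \<forall>n\<ge>N. \<sigma> n - f \<in> bergman \<Omega> p \<and> bergman_norm \<Omega> p (\<sigma> n - f) \<le> e" if e: "0 < e" for e
    proof -
      obtain N where N: "\<And>n m. N \<le> n \<Longrightarrow> N \<le> m \<Longrightarrow> bergman_norm \<Omega> p (\<sigma> n - \<sigma> m) < e"
        using \<sigma>C[OF e] by blast
      have "\<sigma> n - f \<in> bergman \<Omega> p \<and> bergman_norm \<Omega> p (\<sigma> n - f) \<le> e" if n: "N \<le> n" for n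
      proof -
        have "(\<integral>\<^sup>+z. ennreal (norm ((\<sigma> n - f) z) powr p) \<partial>lborel)
            = (\<integral>\<^sup>+z. liminf (\<lambda>m. ennreal (norm (\<sigma> n z - \<sigma> m z) powr p)) \<partial>lborel)"
        proof (intro nn_integral_cong)
          fix z
          have L: "(\<lambda>m. ennreal (norm (\<sigma> n z - \<sigma> m z) powr p)) \<longlonglongrightarrow> ennreal (norm (\<sigma> n z - f z) powr p)"
            using p by (intro tendsto_ennrealI tendsto_powr2 tendsto_intros lim) auto
          show "ennreal (norm ((\<sigma> n - f) z) powr p) = liminf (\<lambda>m. ennreal (norm (\<sigma> n z - \<sigma> m z) powr p))"
            using lim_imp_Liminf[OF trivial_limit_sequentially L] by (simp only: minus_apply)
        qed
        also have "\<dots> \<le> liminf (\<lambda>m. \<integral>\<^sup>+z. ennreal (norm (\<sigma> n z - \<sigma> m z) powr p) \<partial>lborel)"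
          by (rule nn_integral_liminf) measurable
        also have "\<dots> \<le> liminf (\<lambda>m. ennreal (e powr p))"
        proof (rule Liminf_mono)
          show "\<forall>\<^sub>F m in sequentially. (\<integral>\<^sup>+z. ennreal (norm (\<sigma> n z - \<sigma> m z) powr p) \<partial>lborel) \<le> ennreal (e powr p)"
            using eventually_ge_at_top[of N]
          proof eventually_elim
            case (elim m)
            have "\<sigma> n - \<sigma> m \<in> bergman \<Omega> p" using p by (intro bergman_diff[OF \<Omega>] \<sigma>V) auto
            from nn_integral_eq_bergman_norm[OF \<Omega> _ this] p
            have "(\<integral>\<^sup>+z. ennreal (norm (\<sigma> n z - \<sigma> m z) powr p) \<partial>lborel) = ennreal (bergman_norm \<Omega> p (\<sigma> n - \<sigma> m) powr p)"
              by simp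
            also have "\<dots> \<le> ennreal (e powr p)"
              using N[OF n elim] p by (intro ennreal_leI powr_mono2) (auto simp: bergman_norm_nonneg)
            finally show ?case .
          qed
        qed
        also have "\<dots> = ennreal (e powr p)" by (simp add: Liminf_const)
        finally have le: "(\<integral>\<^sup>+z. ennreal (norm ((\<sigma> n - f) z) powr p) \<partial>lborel) \<le> ennreal (e powr p)" .
        have "(\<lambda>z. \<sigma> n z - f z) holomorphic_on \<Omega>"
          using \<sigma>V[of n] fhol by (intro holomorphic_on_diff) (auto simp: bergman_def)
        then have mem: "\<sigma> n - f \<in> bergman \<Omega> p"
          using le \<sigma>V[of n] f0 by (auto simp: bergman_iff[OF \<Omega>] fun_diff_def intro: order_le_less_trans)
        have "bergman_norm \<Omega> p (\<sigma> n - f) \<le> e"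
          by (rule bergman_norm_le[OF \<Omega> _ mem _ le]) (use p e in auto)
        with mem show ?thesis by blast
      qed
      then show ?thesis by blast
    qed
    have fV: "f \<in> bergman \<Omega> p"
    proof -
      obtain N where "\<sigma> N - f \<in> bergman \<Omega> p" using tail[of 1] by auto
      from bergman_diff[OF \<Omega> _ \<sigma>V this, of N] p show ?thesis by simp
    qed
    have "limitin mtopology \<sigma> f sequentially"
      unfolding limitin_metric eventually_sequentially
    proof (intro conjI allI impI fV)
      fix e :: real assume "0 < e"
      then obtain N where "\<forall>n\<ge>N. bergman_norm \<Omega> p (\<sigma> n - f) \<le> e / 2"
        using tail[of "e / 2"] by auto
      then show "\<exists>N. \<forall>n\<ge>N. \<sigma> n \<in> bergman \<Omega> p \<and> bergman_norm \<Omega> p (\<sigma> n - f) < e"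
        using \<sigma>V \<open>0 < e\<close> by (intro exI[of _ N]) (fastforce intro: order_le_less_trans[of _ "e / 2"])
    qed
    then show "\<exists>f. limitin mtopology \<sigma> f sequentially" by blast
  qed
qed

lemma bergman_banach:
  assumes "open \<Omega>" "1 \<le> p"
  shows "complex_banach_space (bergman \<Omega> p) (bergman_norm \<Omega> p)"
  unfolding complex_banach_space_def
  using assms bergman_subspace bergman_norm_nonneg bergman_norm_eq_0_iff bergman_norm_scale
    bergman_norm_triangle bergman_metric_space bergman_complete
  by auto

section \<open>The dichotomy between trivial and infinite-dimensional\<close>

lemma infinite_open_complex:
  fixes S :: "complex set"
  assumes "open S" "S \<noteq> {}"
  shows "infinite S"
proof -
  obtain a where "a \<in> S" using assms by blast
  then obtain e where e: "0 < e" "ball a e \<subseteq> S" using assms openE by blast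
  have "infinite (ball a e)"
    using uncountable_ball[OF e(1)] countable_finite by blast
  then show ?thesis using e finite_subset by blast
qed

lemma borel_measurable_cnj [measurable (raw)]:
  assumes "f \<in> borel_measurable M"
  shows "(\<lambda>x. cnj (f x)) \<in> borel_measurable M"
  by (rule measurable_compose[OF assms]) (intro borel_measurable_continuous_onI continuous_intros)

lemma cauchy_transform_mem_bergman:
  assumes \<Omega>: "open \<Omega>" and p: "2 \<le> p" and h[measurable]: "h \<in> borel_measurable borel"
    and zero: "\<And>w. w \<in> \<Omega> \<Longrightarrow> h w = 0" and supp: "\<And>w. R \<le> norm w \<Longrightarrow> h w = 0"
    and Lp: "(\<integral>\<^sup>+w. ennreal (norm (h w) powr p) \<partial>lborel) < \<infinity>" and mean: "(\<integral>w. h w \<partial>lborel) = 0"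
  shows "(\<lambda>z. if z \<in> \<Omega> then cauchy_transform lborel h z else 0) \<in> bergman \<Omega> p"
proof -
  have "integrable lborel h"
    using integrable_of_Lp[of p h R, OF _ h supp Lp] p by simp
  then have "cauchy_transform lborel h holomorphic_on \<Omega>"
    by (rule cauchy_transform_holomorphic[OF _ _ \<Omega> zero]) auto
  then have hol: "(\<lambda>z. if z \<in> \<Omega> then cauchy_transform lborel h z else 0) holomorphic_on \<Omega>"
    by (rule holomorphic_transform) simp
  have "(\<integral>\<^sup>+z. ennreal (norm (if z \<in> \<Omega> then cauchy_transform lborel h z else 0) powr p) \<partial>lborel)
      \<le> (\<integral>\<^sup>+z. ennreal (norm (cauchy_transform lborel h z) powr p) \<partial>lborel)"
    by (intro nn_integral_mono) auto
  also have "\<dots> < \<infinity>"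
    by (rule cauchy_transform_Lp[OF p h supp Lp mean])
  finally show ?thesis
    using hol by (simp add: bergman_iff[OF \<Omega>])
qed

text \<open>If the complement has positive measure, choose a bounded part \<open>E\<close> of it of positive measure and points
  \<open>\<zeta> j\<close> of \<open>\<Omega>\<close>. Cauchy transforms of densities \<open>H\<close> on \<open>E\<close> with mean \<open>0\<close> belong to the space. In a
  finite-dimensional space there would be such an \<open>H \<noteq> 0\<close> in the span of the functions
  \<open>cnj (1 / (\<zeta> j - w))\<close> on \<open>E\<close> with \<open>C H = 0\<close> on \<open>\<Omega>\<close>. But then \<open>H\<close> is orthogonal to all of these functions, hence to
  itself.\<close>

lemma bergman_not_span_positive_complement:
  assumes \<Omega>: "open \<Omega>" "\<Omega> \<noteq> {}" and p: "2 \<le> p" and pos: "emeasure lborel (- \<Omega>) \<noteq> 0" and B: "finite B"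
  shows "bergman \<Omega> p \<noteq> cfun.span B"
proof
  assume V: "bergman \<Omega> p = cfun.span B"
  have [measurable]: "\<Omega> \<in> sets borel" using \<Omega> by simp
  obtain R where R: "emeasure lborel (- \<Omega> \<inter> ball 0 R) \<noteq> 0"
  proof (rule ccontr)
    assume "\<not> thesis"
    then have "- \<Omega> \<inter> ball 0 (real n) \<in> null_sets lborel" for n
      using that by (auto simp: null_sets_def)
    then have "(\<Union>n. - \<Omega> \<inter> ball 0 (real n)) \<in> null_sets lborel"
      by (rule null_sets_UN)
    moreover have "(\<Union>n. - \<Omega> \<inter> ball 0 (real n)) = - \<Omega>"
      using reals_Archimedean2 by auto
    ultimately show False using pos by (simp add: null_sets_def)
  qed
  define E where "E = - \<Omega> \<inter> ball 0 R"
  have [measurable]: "E \<in> sets borel" by (simp add: E_def)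
  define N where "N = 2 * Suc (card B)"
  obtain \<zeta> :: "nat \<Rightarrow> complex" where \<zeta>: "inj \<zeta>" "range \<zeta> \<subseteq> \<Omega>"
    using infinite_countable_subset[OF infinite_open_complex[OF \<Omega>]] by blast
  have far: "\<exists>\<delta>>0. \<forall>w\<in>E. \<delta> \<le> norm (\<zeta> j - w)" for j
  proof -
    have "\<zeta> j \<in> \<Omega>" using \<zeta> by auto
    then obtain \<delta> where "\<delta> > 0" "ball (\<zeta> j) \<delta> \<subseteq> \<Omega>" using \<Omega> openE by blast
    then show ?thesis by (intro exI[of _ \<delta>]) (force simp: E_def dist_norm)
  qed
  define h where "h j w = indicator E w * cnj (1 / (\<zeta> j - w))" for j w
  have [measurable]: "h j \<in> borel_measurable borel" for j
    unfolding h_def by measurable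
  have hE: "h j w = 0" if "w \<notin> E" for j w using that by (simp add: h_def)
  have hbound: "\<exists>K\<ge>0. \<forall>w. norm (h j w) \<le> K" for j
  proof -
    obtain \<delta> where "\<delta> > 0" "\<forall>w\<in>E. \<delta> \<le> norm (\<zeta> j - w)" using far by blast
    then have "norm (h j w) \<le> 1 / \<delta>" for w
      by (cases "w \<in> E") (auto simp: h_def norm_divide norm_mult simp flip: complex_cnj_diff intro!: frac_le)
    then show ?thesis using \<open>\<delta> > 0\<close> by (intro exI[of _ "1 / \<delta>"]) auto
  qed
  obtain K where K: "\<And>j. 0 \<le> K j" "\<And>j w. norm (h j w) \<le> K j"
    using hbound by metis
  define H where "H c w = (\<Sum>j<N. c j * h j w)" for c :: "nat \<Rightarrow> complex" and w
  have [measurable]: "H c \<in> borel_measurable borel" for c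
    unfolding H_def by measurable
  have HE: "H c w = 0" if "w \<notin> E" for c w using that by (simp add: H_def hE)
  have Hb: "norm (H c w) \<le> (\<Sum>j<N. norm (c j) * K j)" for c w
    unfolding H_def by (rule sum_norm_le) (simp add: norm_mult mult_left_mono K)
  have Eint: "integrable lborel f" if [measurable]: "f \<in> borel_measurable borel"
    and "\<And>w. w \<notin> E \<Longrightarrow> f w = 0" "\<And>w. norm (f w) \<le> M" for f :: "complex \<Rightarrow> complex" and M
  proof -
    have "integrable lborel (\<lambda>w. indicator (ball 0 R) w *\<^sub>R f w)"
      by (rule integrableI_bounded_set_indicator[where B = M])
        (use that(3) emeasure_lborel_ball_finite[of "0::complex" R] in auto)
    moreover have "(\<lambda>w. indicator (ball 0 R) w *\<^sub>R f w) = f"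
      using that(2) by (auto simp: fun_eq_iff indicator_def E_def)
    ultimately show ?thesis by simp
  qed
  have hint: "integrable lborel (h j)" for j
    by (rule Eint[where M = "K j"]) (use hE K in auto)
  have kint: "integrable lborel (\<lambda>w. h j w / (z - w))" if z: "z \<in> \<Omega>" for j z
  proof -
    obtain \<delta> where \<delta>: "\<delta> > 0" "ball z \<delta> \<subseteq> \<Omega>" by (rule openE[OF \<Omega>(1) z])
    show ?thesis
      by (rule integrable_cauchy_kernel[OF hint _ \<delta>(1)])
        (use \<delta> hE in \<open>force simp: E_def dist_norm\<close>)+
  qed
  have CH: "cauchy_transform lborel (H c) z = (\<Sum>j<N. c j * cauchy_transform lborel (h j) z)" if "z \<in> \<Omega>" for c z
  proof -
    have "cauchy_transform lborel (H c) z = (\<integral>w. (\<Sum>j<N. c j * (h j w / (z - w))) \<partial>lborel)"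
      by (simp add: cauchy_transform_def H_def sum_divide_distrib)
    also have "\<dots> = (\<Sum>j<N. \<integral>w. c j * (h j w / (z - w)) \<partial>lborel)"
      by (rule Bochner_Integration.integral_sum) (intro integrable_mult_right kint[OF that])
    finally show ?thesis
      by (simp only: cauchy_transform_def integral_mult_right_zero)
  qed
  define F where "F j z = (if z \<in> \<Omega> then cauchy_transform lborel (h j) z else 0)" for j z
  define m where "m j = (\<integral>w. h j w \<partial>lborel)" for j
  have mem: "(\<lambda>z. \<Sum>i<N. c i * F i z) \<in> cfun.span B" if "(\<Sum>i<N. c i * m i) = 0" for c
  proof -
    have "(\<lambda>z. if z \<in> \<Omega> then cauchy_transform lborel (H c) z else 0) \<in> bergman \<Omega> p"
    proof (rule cauchy_transform_mem_bergman[OF \<Omega>(1) p])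
      show "H c w = 0" if "w \<in> \<Omega>" for w using that by (intro HE) (simp add: E_def)
      show "H c w = 0" if "R \<le> norm w" for w using that by (intro HE) (simp add: E_def)
      show "(\<integral>w. H c w \<partial>lborel) = 0"
        using that hint by (simp add: H_def m_def Bochner_Integration.integral_sum)
      have "(\<integral>\<^sup>+w. ennreal (norm (H c w) powr p) \<partial>lborel)
         \<le> (\<integral>\<^sup>+w. ennreal ((\<Sum>j<N. norm (c j) * K j) powr p) * indicator (ball (0::complex) R) w \<partial>lborel)"
      proof (rule nn_integral_mono)
        fix w
        show "ennreal (norm (H c w) powr p) \<le> ennreal ((\<Sum>j<N. norm (c j) * K j) powr p) * indicator (ball 0 R) w"
          using Hb[of c w] HE[of w c] p by (cases "w \<in> ball 0 R") (auto simp: E_def intro!: ennreal_leI powr_mono2)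
      qed
      also have "\<dots> < \<infinity>"
        using emeasure_lborel_ball_finite[of "0::complex" R]
        by (simp add: nn_integral_cmult_indicator ennreal_mult_less_top)
      finally show "(\<integral>\<^sup>+w. ennreal (norm (H c w) powr p) \<partial>lborel) < \<infinity>" .
    qed measurable
    moreover have "(\<lambda>z. if z \<in> \<Omega> then cauchy_transform lborel (H c) z else 0) = (\<lambda>z. \<Sum>i<N. c i * F i z)"
      by (auto simp: fun_eq_iff F_def CH)
    ultimately show ?thesis by (simp add: V)
  qed
  obtain j c where c: "j < N" "c j \<noteq> 0" "(\<Sum>i<N. c i * m i) = 0" "\<And>z. (\<Sum>i<N. c i * F i z) = 0"
    by (rule finite_span_relation[OF B N_def mem], assumption, rule that)
  have orth: "(\<integral>w. H c w / (\<zeta> i - w) \<partial>lborel) = 0" for i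
  proof -
    have "\<zeta> i \<in> \<Omega>" using \<zeta> by auto
    then have "cauchy_transform lborel (H c) (\<zeta> i) = 0"
      using CH c(4)[of "\<zeta> i"] by (simp add: F_def)
    then show ?thesis by (simp add: cauchy_transform_def)
  qed
  have Hkint: "integrable lborel (\<lambda>w. H c w / (\<zeta> i - w))" for i
  proof -
    have "\<zeta> i \<in> \<Omega>" using \<zeta> by auto
    then have "integrable lborel (\<lambda>w. \<Sum>j<N. c j * (h j w / (\<zeta> i - w)))"
      using kint by (intro Bochner_Integration.integrable_sum integrable_mult_right) auto
    then show ?thesis by (simp add: H_def sum_divide_distrib)
  qed
  have HH: "H c w * cnj (H c w) = (\<Sum>i<N. cnj (c i) * (H c w / (\<zeta> i - w)))" for w
  proof (cases "w \<in> E")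
    case True
    then have "cnj (H c w) = (\<Sum>i<N. cnj (c i) / (\<zeta> i - w))"
      by (simp add: H_def h_def)
    then show ?thesis by (simp add: sum_distrib_left mult.commute)
  qed (simp add: HE)
  have "(\<integral>w. H c w * cnj (H c w) \<partial>lborel) = 0"
  proof -
    have "(\<integral>w. H c w * cnj (H c w) \<partial>lborel) = (\<Sum>i<N. \<integral>w. cnj (c i) * (H c w / (\<zeta> i - w)) \<partial>lborel)"
      unfolding HH by (rule Bochner_Integration.integral_sum) (intro integrable_mult_right Hkint)
    then show ?thesis
      by (simp only: integral_mult_right_zero orth) simp
  qed
  moreover have "H c w * cnj (H c w) = of_real ((norm (H c w))\<^sup>2)" for w
    by (simp add: complex_norm_square del: of_real_power)
  ultimately have "(\<integral>w. (norm (H c w))\<^sup>2 \<partial>lborel) = 0"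
    by (simp only: integral_complex_of_real of_real_eq_0_iff)
  moreover have "integrable lborel (\<lambda>w. (norm (H c w))\<^sup>2)"
  proof -
    have "integrable lborel (\<lambda>w. of_real ((norm (H c w))\<^sup>2) :: complex)"
      by (rule Eint[where M = "(\<Sum>j<N. norm (c j) * K j)\<^sup>2"]) (auto simp: HE norm_power intro!: power_mono Hb)
    then show ?thesis by (simp only: complex_of_real_integrable_eq)
  qed
  ultimately have ae: "AE w in lborel. H c w = 0"
    by (subst (asm) integral_nonneg_eq_0_iff_AE) auto
  define Z where "Z = {w \<in> E. H c w = 0}"
  have Zmeas[measurable]: "Z \<in> sets borel" unfolding Z_def by measurable
  have "infinite Z"
  proof
    assume "finite Z"
    then have "emeasure lborel Z = 0" by (simp add: emeasure_lborel_countable countable_finite)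
    moreover have "emeasure lborel E = emeasure lborel Z"
      by (rule emeasure_eq_AE) (use ae in \<open>auto simp: Z_def\<close>)
    ultimately show False using R by (simp add: E_def)
  qed
  have "cnj (c j) = 0"
  proof (rule partial_fractions_independent[OF _ _ \<open>infinite Z\<close>, of "{..<N}" \<zeta> "\<lambda>j. cnj (c j)"])
    show "inj_on \<zeta> {..<N}" using \<zeta>(1) by (simp add: inj_on_def)
    fix w assume "w \<in> Z"
    then have "w \<in> E" "H c w = 0" by (auto simp: Z_def)
    then have "0 = cnj (H c w)" by simp
    also have "\<dots> = (\<Sum>i<N. cnj (c i) / (\<zeta> i - w))"
      using \<open>w \<in> E\<close> by (simp add: H_def h_def)
    also have "\<dots> = - (\<Sum>i<N. cnj (c i) / (w - \<zeta> i))"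
      unfolding sum_negf[symmetric] by (intro sum.cong refl) (simp add: minus_divide_right)
    finally show "(\<Sum>i<N. cnj (c i) / (w - \<zeta> i)) = 0" by simp
  qed (use c in auto)
  then show False using c by simp
qed

text \<open>In a finite-dimensional space every \<open>g\<close> extends holomorphically across all but finitely many points. Otherwise
  put bumps at sufficiently many singular points, each vanishing near the other points; some nontrivial combination of the localised
  functions \<open>\<kappa> g - C(g \<partial>\<kappa>) / \<pi>\<close> vanishes on \<open>\<Omega>\<close>, and this expresses \<open>g\<close> near one of these points as a Cauchy
  transform that is holomorphic there.\<close>

lemma bergman_singular_set_finite:
  assumes \<Omega>: "open \<Omega>" and p: "2 \<le> p" and g: "g \<in> bergman \<Omega> p" and B: "finite B"
    and V: "bergman \<Omega> p = cfun.span B"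
  shows "finite {a. \<not> (\<exists>D G. open D \<and> a \<in> D \<and> G holomorphic_on D \<and> (\<forall>z\<in>D \<inter> \<Omega>. G z = g z))}"
    (is "finite ?F")
proof (rule ccontr)
  assume "infinite ?F"
  then obtain a :: "nat \<Rightarrow> complex" where a: "inj a" "range a \<subseteq> ?F"
    using infinite_countable_subset by blast
  define N where "N = 2 * Suc (card B)"
  have gh: "g holomorphic_on \<Omega>" and g0: "\<And>z. z \<notin> \<Omega> \<Longrightarrow> g z = 0"
    and gL: "(\<integral>\<^sup>+z. ennreal (norm (g z) powr p) \<partial>lborel) < \<infinity>"
    using g by (auto simp: bergman_iff[OF \<Omega>])
  have [measurable]: "g \<in> borel_measurable borel" using bergman_measurable[OF \<Omega> g] .
  obtain r where r: "0 < r" "\<And>i j. i < N \<Longrightarrow> j < N \<Longrightarrow> i \<noteq> j \<Longrightarrow> 4 * r \<le> norm (a i - a j)"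
  proof -
    define D where "D = (\<lambda>(i, j). norm (a i - a j)) ` {(i, j). i < N \<and> j < N \<and> i \<noteq> j}"
    have "finite {(i, j). i < N \<and> j < N \<and> i \<noteq> j}"
      by (rule finite_subset[of _ "{..<N} \<times> {..<N}"]) auto
    then have fin: "finite (insert 1 D)" by (simp add: D_def)
    have "0 < Min (insert 1 D)"
      using fin a(1) by (auto simp: D_def inj_eq)
    moreover have "Min (insert 1 D) \<le> norm (a i - a j)" if "i < N" "j < N" "i \<noteq> j" for i j
      using that fin by (intro Min_le) (auto simp: D_def)
    ultimately show ?thesis by (intro that[of "Min (insert 1 D) / 4"]) auto
  qed
  have "\<exists>\<kappa> \<kappa>x \<kappa>y. continuous_partials \<kappa> \<kappa>x \<kappa>y \<and> (\<forall>z. norm (\<kappa> z) \<le> 1) \<and> (\<forall>z. norm (dbar \<kappa>x \<kappa>y z) \<le> 4 / r)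
    \<and> (\<forall>z. norm (z - a i) \<le> r \<longrightarrow> \<kappa> z = 1 \<and> dbar \<kappa>x \<kappa>y z = 0)
    \<and> (\<forall>z. 3 * r \<le> norm (z - a i) \<longrightarrow> \<kappa> z = 0 \<and> dbar \<kappa>x \<kappa>y z = 0)" for i
    using bump_function[OF r(1), of "a i"] by metis
  then obtain \<kappa> \<kappa>x \<kappa>y where \<kappa>: "\<And>i. continuous_partials (\<kappa> i) (\<kappa>x i) (\<kappa>y i)"
    "\<And>i z. norm (\<kappa> i z) \<le> 1" "\<And>i z. norm (dbar (\<kappa>x i) (\<kappa>y i) z) \<le> 4 / r"
    "\<And>i z. norm (z - a i) \<le> r \<Longrightarrow> \<kappa> i z = 1 \<and> dbar (\<kappa>x i) (\<kappa>y i) z = 0"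
    "\<And>i z. 3 * r \<le> norm (z - a i) \<Longrightarrow> \<kappa> i z = 0 \<and> dbar (\<kappa>x i) (\<kappa>y i) z = 0"
    by metis
  define h where "h i w = g w * dbar (\<kappa>x i) (\<kappa>y i) w" for i w
  have [measurable]: "dbar (\<kappa>x i) (\<kappa>y i) \<in> borel_measurable borel" for i
    using continuous_on_dbar[OF \<kappa>(1)] by (rule borel_measurable_continuous_onI)
  have [measurable]: "\<kappa> i \<in> borel_measurable borel" for i
    using \<kappa>(1)[of i] by (auto simp: continuous_partials_def intro: borel_measurable_continuous_onI)
  have [measurable]: "h i \<in> borel_measurable borel" for i
    unfolding h_def by measurable
  define R where "R = (\<Sum>i<N. norm (a i)) + 3 * r"
  have hsupp: "h i w = 0" if "R \<le> norm w" "i < N" for i w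
  proof -
    have "norm (a i) \<le> (\<Sum>i<N. norm (a i))"
      using that by (intro member_le_sum) auto
    then have "3 * r \<le> norm (w - a i)"
      using that(1) norm_triangle_ineq2[of w "a i"] by (simp add: R_def)
    then show ?thesis using \<kappa>(5) by (simp add: h_def)
  qed
  define H where "H c w = (\<Sum>i<N. c i * h i w)" for c :: "nat \<Rightarrow> complex" and w
  have [measurable]: "H c \<in> borel_measurable borel" for c
    unfolding H_def by measurable
  have HL: "(\<integral>\<^sup>+w. ennreal (norm (\<Sum>i<N. c i * (\<psi> i w * g w)) powr p) \<partial>lborel) < \<infinity>"
    if [measurable]: "\<And>i. \<psi> i \<in> borel_measurable borel" and K: "\<And>i w. norm (\<psi> i w) \<le> K"
    for c :: "nat \<Rightarrow> complex" and \<psi> :: "nat \<Rightarrow> complex \<Rightarrow> complex" and K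
  proof -
    define M where "M = (\<Sum>i<N. norm (c i) * K)"
    have "norm (\<Sum>i<N. c i * (\<psi> i w * g w)) \<le> M * norm (g w)" for w
      unfolding M_def sum_distrib_right
      by (rule sum_norm_le) (auto simp: norm_mult mult.assoc intro!: mult_left_mono mult_right_mono K)
    then have "norm (\<Sum>i<N. c i * (\<psi> i w * g w)) \<le> norm (of_real M * g w)" for w
      by (rule order_trans) (auto simp: norm_mult intro!: mult_right_mono)
    then have "(\<integral>\<^sup>+w. ennreal (norm (\<Sum>i<N. c i * (\<psi> i w * g w)) powr p) \<partial>lborel)
       \<le> (\<integral>\<^sup>+w. ennreal (norm (of_real M * g w) powr p) \<partial>lborel)"
      using p by (intro nn_integral_mono ennreal_leI powr_mono2) auto
    also have "\<dots> < \<infinity>"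
      using gL by (subst nn_integral_powr_norm_scale) (auto simp: ennreal_mult_less_top)
    finally show ?thesis .
  qed
  have hL: "(\<integral>\<^sup>+w. ennreal (norm (H c w) powr p) \<partial>lborel) < \<infinity>" for c
    using HL[of "\<lambda>i. dbar (\<kappa>x i) (\<kappa>y i)" "4 / r" c] \<kappa>(3) by (simp add: H_def h_def mult.commute)
  have hint: "integrable lborel (h i)" if "i < N" for i
  proof (rule integrable_of_Lp[of p _ R])
    have "H (\<lambda>j. if j = i then 1 else 0) = h i"
      using that by (auto simp: fun_eq_iff H_def if_distrib[of "\<lambda>x. x * _"] cong: if_cong)
    then show "(\<integral>\<^sup>+w. ennreal (norm (h i w) powr p) \<partial>lborel) < \<infinity>"
      using hL[of "\<lambda>j. if j = i then 1 else 0"] by simp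
  qed (use p that hsupp in auto)
  have kint: "integrable lborel (\<lambda>w. h i w / (z - w))" if z: "z \<in> \<Omega>" and i: "i < N" for i z
  proof -
    obtain \<rho> where \<rho>: "\<rho> > 0" "cball z \<rho> \<subseteq> \<Omega>" using z \<Omega> open_contains_cball by blast
    have "compact (g ` cball z \<rho>)"
      by (intro compact_continuous_image continuous_on_subset[OF holomorphic_on_imp_continuous_on[OF gh] \<rho>(2)]) auto
    then obtain K where K: "\<And>w. w \<in> cball z \<rho> \<Longrightarrow> norm (g w) \<le> K"
      using compact_imp_bounded bounded_iff by (metis image_eqI)
    show ?thesis
    proof (rule integrable_cauchy_kernel_bounded_near[OF hint[OF i] \<rho>(1)])
      fix w assume "w \<in> ball z \<rho>"
      then have "norm (g w) \<le> K" using K by simp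
      then show "norm (h i w) \<le> K * (4 / r)"
        unfolding h_def norm_mult using \<kappa>(3) by (intro mult_mono) (auto intro: order_trans[OF norm_ge_zero])
    qed
  qed
  have CH: "cauchy_transform lborel (H c) z = (\<Sum>i<N. c i * cauchy_transform lborel (h i) z)" if "z \<in> \<Omega>" for c z
  proof -
    have "cauchy_transform lborel (H c) z = (\<integral>w. (\<Sum>j<N. c j * (h j w / (z - w))) \<partial>lborel)"
      by (simp add: cauchy_transform_def H_def sum_divide_distrib)
    also have "\<dots> = (\<Sum>j<N. \<integral>w. c j * (h j w / (z - w)) \<partial>lborel)"
      by (rule Bochner_Integration.integral_sum) (intro integrable_mult_right kint[OF that], simp)
    finally show ?thesis
      by (simp only: cauchy_transform_def integral_mult_right_zero)
  qed
  define F where "F i z = (if z \<in> \<Omega> then \<kappa> i z * g z - cauchy_transform lborel (h i) z / of_real pi else 0)" for i z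
  define m where "m i = (\<integral>w. h i w \<partial>lborel)" for i
  have Fhol: "F i holomorphic_on \<Omega>" if "i < N" for i
    by (rule holomorphic_transform[OF localized_cauchy_transform_holomorphic[OF \<Omega> gh \<kappa>(1)[of i]]])
      (use hint[OF that] in \<open>auto simp: F_def h_def[abs_def]\<close>)
  have mem: "(\<lambda>z. \<Sum>i<N. c i * F i z) \<in> cfun.span B" if c0: "(\<Sum>i<N. c i * m i) = 0" for c
  proof -
    have hol: "(\<lambda>z. \<Sum>i<N. c i * F i z) holomorphic_on \<Omega>"
      by (intro holomorphic_on_sum holomorphic_on_mult holomorphic_on_const Fhol) auto
    have eq: "(\<Sum>i<N. c i * F i z) = (\<Sum>i<N. c i * (\<kappa> i z * g z)) + (- 1 / of_real pi) * cauchy_transform lborel (H c) z"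
      if "z \<in> \<Omega>" for z
      using that by (simp add: F_def CH right_diff_distrib sum_subtractf sum_divide_distrib)
    have mean: "(\<integral>w. H c w \<partial>lborel) = 0"
      using c0 hint by (simp add: H_def m_def Bochner_Integration.integral_sum)
    have "(\<integral>\<^sup>+z. ennreal (norm (\<Sum>i<N. c i * F i z) powr p) \<partial>lborel)
      \<le> (\<integral>\<^sup>+z. ennreal (norm ((\<Sum>i<N. c i * (\<kappa> i z * g z)) + (- 1 / of_real pi) * cauchy_transform lborel (H c) z) powr p) \<partial>lborel)"
    proof (rule nn_integral_mono)
      fix z
      show "ennreal (norm (\<Sum>i<N. c i * F i z) powr p)
        \<le> ennreal (norm ((\<Sum>i<N. c i * (\<kappa> i z * g z)) + (- 1 / of_real pi) * cauchy_transform lborel (H c) z) powr p)"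
        by (cases "z \<in> \<Omega>") (simp only: eq order_refl, simp add: F_def)
    qed
    also have "\<dots> < \<infinity>"
    proof (rule nn_integral_powr_norm_add)
      show "(\<integral>\<^sup>+z. ennreal (norm (\<Sum>i<N. c i * (\<kappa> i z * g z)) powr p) \<partial>lborel) < \<infinity>"
        by (rule HL[where K = 1]) (use \<kappa>(2) in auto)
      have "(\<integral>\<^sup>+z. ennreal (norm (cauchy_transform lborel (H c) z) powr p) \<partial>lborel) < \<infinity>"
        by (rule cauchy_transform_Lp[OF p _ _ hL mean, of R]) (auto simp: H_def hsupp)
      then show "(\<integral>\<^sup>+z. ennreal (norm ((- 1 / of_real pi) * cauchy_transform lborel (H c) z) powr p) \<partial>lborel) < \<infinity>"
        by (subst nn_integral_powr_norm_scale) (auto simp: ennreal_mult_less_top)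
    qed (use p in auto)
    finally have "(\<lambda>z. \<Sum>i<N. c i * F i z) \<in> bergman \<Omega> p"
      using hol by (auto simp: bergman_iff[OF \<Omega>] F_def)
    then show ?thesis by (simp add: V)
  qed
  obtain j c where c: "j < N" "c j \<noteq> 0" "(\<Sum>i<N. c i * m i) = 0" "\<And>z. (\<Sum>i<N. c i * F i z) = 0"
    by (rule finite_span_relation[OF B N_def mem], assumption, rule that)
  have sep: "3 * r \<le> norm (z - a i)" if "z \<in> ball (a j) r" "i < N" "i \<noteq> j" for z i
  proof -
    have "norm (a j - a i) \<le> norm (z - a i) + norm (a j - z)"
      using norm_triangle_ineq[of "z - a i" "a j - z"] by simp
    then show ?thesis using r(2)[OF c(1) that(2)] that by (simp add: dist_norm)
  qed
  have h0: "h i w = 0" if "w \<in> ball (a j) r" "i < N" for i w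
    using sep[OF that] \<kappa>(4)[of w j] \<kappa>(5)[of w i] that
    by (cases "i = j") (auto simp: h_def dist_norm norm_minus_commute)
  \<comment> \<open>near \<open>a j\<close> only the bump number \<open>j\<close> is present, and it is constant there\<close>
  define G where "G z = (\<Sum>i<N. c i * cauchy_transform lborel (h i) z) / (of_real pi * c j)" for z
  have "cauchy_transform lborel (h i) holomorphic_on ball (a j) r" if "i < N" for i
    by (rule cauchy_transform_holomorphic[OF hint[OF that]]) (use h0 that in auto)
  then have "G holomorphic_on ball (a j) r"
    unfolding G_def using c(2)
    by (intro holomorphic_on_divide holomorphic_on_sum holomorphic_on_mult holomorphic_on_const) auto
  moreover have "G z = g z" if z: "z \<in> ball (a j) r \<inter> \<Omega>" for z
  proof -
    have "(\<Sum>i<N. c i * (\<kappa> i z * g z)) = (\<Sum>i<N. if i = j then c j * g z else 0)"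
    proof (rule sum.cong[OF refl])
      fix i assume "i \<in> {..<N}"
      then show "c i * (\<kappa> i z * g z) = (if i = j then c j * g z else 0)"
        using sep[of z i] \<kappa>(4)[of z j] \<kappa>(5)[of z i] z by (auto simp: dist_norm norm_minus_commute)
    qed
    also have "\<dots> = c j * g z" using c(1) by simp
    finally have s: "(\<Sum>i<N. c i * (\<kappa> i z * g z)) = c j * g z" .
    have "0 = (\<Sum>i<N. c i * F i z)" by (simp add: c(4))
    also have "\<dots> = (\<Sum>i<N. c i * (\<kappa> i z * g z)) - (\<Sum>i<N. c i * cauchy_transform lborel (h i) z) / of_real pi"
      using z by (simp add: F_def right_diff_distrib sum_subtractf sum_divide_distrib)
    also have "\<dots> = c j * g z - G z * c j"
      using c(2) by (simp add: s G_def)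
    finally show ?thesis using c(2) by simp
  qed
  ultimately have "a j \<notin> ?F"
    using r(1) by (auto intro!: exI[of _ "ball (a j) r"] exI[of _ G])
  then show False using a(2) by blast
qed

text \<open>If the complement is a null set, \<open>\<Omega>\<close> is dense, so the local extensions agree and \<open>g\<close> extends to a
  \<open>p\<close>-integrable holomorphic function on the plane without finitely many points.\<close>

lemma bergman_trivial_if_finite_dim_null_complement:
  assumes \<Omega>: "open \<Omega>" and p: "2 \<le> p" and null: "emeasure lborel (- \<Omega>) = 0" and B: "finite B"
    and V: "bergman \<Omega> p = cfun.span B" and g: "g \<in> bergman \<Omega> p"
  shows "g = 0"
proof -
  let ?good = "\<lambda>a. \<exists>D G. open D \<and> a \<in> D \<and> G holomorphic_on D \<and> (\<forall>z\<in>D \<inter> \<Omega>. G z = g z)"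
  define F where "F = {a. \<not> ?good a}"
  have gh: "g holomorphic_on \<Omega>" and g0: "\<And>z. z \<notin> \<Omega> \<Longrightarrow> g z = 0"
    and gL: "(\<integral>\<^sup>+z. ennreal (norm (g z) powr p) \<partial>lborel) < \<infinity>"
    using g by (auto simp: bergman_iff[OF \<Omega>])
  have finF: "finite F"
    unfolding F_def by (rule bergman_singular_set_finite[OF \<Omega> p g B V])
  have F\<Omega>: "z \<notin> F" if "z \<in> \<Omega>" for z
    using that gh \<Omega> by (auto simp: F_def)
  have [measurable]: "\<Omega> \<in> sets borel" using \<Omega> by simp
  have nullS: "- \<Omega> \<in> null_sets lborel" using null by (simp add: null_sets_def)
  \<comment> \<open>\<open>\<Omega>\<close> is dense, so limits along \<open>\<Omega>\<close> are unique at every point of the plane\<close>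
  have lp: "z islimpt \<Omega>" for z
    unfolding islimpt_def
  proof (intro allI impI)
    fix T assume T: "z \<in> T" "open T"
    have "infinite (T \<inter> \<Omega>)"
    proof (cases "T \<inter> \<Omega> = {}")
      case True
      then have "T \<subseteq> - \<Omega>" by blast
      then have "emeasure lborel T \<le> emeasure lborel (- \<Omega>)" by (intro emeasure_mono) auto
      then have "emeasure lborel T = 0" using null by simp
      moreover obtain e where "e > 0" "ball z e \<subseteq> T" using T openE by blast
      moreover have "emeasure lborel (ball z e) \<le> emeasure lborel T"
        using \<open>ball z e \<subseteq> T\<close> T(2) by (intro emeasure_mono) auto
      ultimately have "emeasure lborel (ball z e) = 0" by simp
      then show ?thesis using \<open>e > 0\<close> by (simp add: emeasure_ball unit_ball_vol_2)
    next
      case False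
      then show ?thesis using T(2) \<Omega> by (intro infinite_open_complex) auto
    qed
    then have "\<not> T \<inter> \<Omega> \<subseteq> {z}" using finite_subset by blast
    then show "\<exists>y\<in>\<Omega>. y \<in> T \<and> y \<noteq> z" by blast
  qed
  define G where "G z = Lim (at z within \<Omega>) g" for z
  have loc: "G w = G' w" if D: "open D" "G' holomorphic_on D" "\<And>z. z \<in> D \<inter> \<Omega> \<Longrightarrow> G' z = g z" and w: "w \<in> D" for D G' w
  proof -
    have "(G' \<longlongrightarrow> G' w) (at w)"
      using D w holomorphic_on_imp_continuous_on continuous_on_eq_continuous_at isContD by blast
    then have "(G' \<longlongrightarrow> G' w) (at w within \<Omega>)"
      using tendsto_within_subset by blast
    moreover have "\<forall>\<^sub>F z in at w within \<Omega>. G' z = g z"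
      using D(1,3) w by (auto simp: eventually_at_topological)
    ultimately have "(g \<longlongrightarrow> G' w) (at w within \<Omega>)"
      by (rule Lim_transform_eventually)
    then show ?thesis
      unfolding G_def using lp[of w] by (intro tendsto_Lim) (auto simp: trivial_limit_within)
  qed
  have Ghol: "G holomorphic_on - F"
  proof (rule holomorphic_on_if_locally)
    fix a assume "a \<in> - F"
    then obtain D G' where D: "open D" "a \<in> D" "G' holomorphic_on D" "\<forall>z\<in>D \<inter> \<Omega>. G' z = g z"
      by (auto simp: F_def)
    then have "G holomorphic_on D"
      using loc[OF D(1,3)] by (intro holomorphic_transform[OF D(3)]) auto
    then show "\<exists>U. open U \<and> a \<in> U \<and> G holomorphic_on U" using D by blast
  qed
  have Gg: "G z = g z" if "z \<in> \<Omega>" for z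
    using loc[OF \<Omega> gh _ that] by simp
  have oF: "open (- F)" using finF by (intro open_Compl finite_imp_closed)
  define G2 where "G2 z = (if z \<in> F then 0 else G z)" for z
  have G2hol: "G2 holomorphic_on - F"
    by (rule holomorphic_transform[OF Ghol]) (simp add: G2_def)
  have "G2 z = 0" if "z \<notin> F" for z
  proof (rule holomorphic_Lp_cofinite_eq_0[OF finF G2hol p _ _ that])
    show "G2 \<in> borel_measurable borel"
      by (rule bergman_borel_measurable[OF oF G2hol]) (simp add: G2_def)
    have "(\<integral>\<^sup>+z. ennreal (norm (G2 z) powr p) \<partial>lborel) = (\<integral>\<^sup>+z. ennreal (norm (g z) powr p) \<partial>lborel)"
    proof (rule nn_integral_cong_AE)
      show "AE z in lborel. ennreal (norm (G2 z) powr p) = ennreal (norm (g z) powr p)"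
        using AE_not_in[OF nullS] by eventually_elim (simp add: G2_def Gg F\<Omega>)
    qed
    then show "(\<integral>\<^sup>+z. ennreal (norm (G2 z) powr p) \<partial>lborel) < \<infinity>" using gL by simp
  qed
  then have "g z = 0" for z
    using g0[of z] Gg[of z] F\<Omega>[of z] by (cases "z \<in> \<Omega>") (auto simp: G2_def)
  then show ?thesis by (auto simp: fun_eq_iff)
qed

lemma bergman_trivial_or_infinite_dimensional:
  assumes \<Omega>: "open \<Omega>" "\<Omega> \<noteq> {}" and p: "2 \<le> p"
  shows "bergman \<Omega> p = {0} \<or> infinite_dimensional (bergman \<Omega> p)"
proof (cases "\<exists>B. finite B \<and> bergman \<Omega> p = cfun.span B")
  case True
  then obtain B where B: "finite B" "bergman \<Omega> p = cfun.span B" by blast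
  then have "emeasure lborel (- \<Omega>) = 0"
    using bergman_not_span_positive_complement[OF \<Omega> p _ B(1)] by blast
  then have "g = 0" if "g \<in> bergman \<Omega> p" for g
    using bergman_trivial_if_finite_dim_null_complement[OF \<Omega>(1) p _ B that] by blast
  moreover have "0 \<in> bergman \<Omega> p"
    using cfun.subspace_0[OF bergman_subspace[OF \<Omega>(1)]] p by simp
  ultimately show ?thesis by blast
next
  case False
  then show ?thesis
    using bergman_subspace[OF \<Omega>(1), of p] p by (auto simp: infinite_dimensional_def)
qed

section \<open>Exponents above two and Riesz capacity\<close>

text \<open>The substitution \<open>z = x + d u\<close> with \<open>d = norm (w - x)\<close> extracts the factor \<open>d powr (- \<alpha>)\<close>.\<close>

lemma riesz_potential_scaling:
  fixes \<alpha> :: real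
  assumes \<alpha>: "0 < \<alpha>" "\<alpha> < 1"
  obtains C where "0 < C"
    "\<And>x w. (\<integral>\<^sup>+z. ennreal (norm (z - x) powr (- 1 - \<alpha>) / (norm (z - x) + norm (w - x))) \<partial>lborel)
       \<le> ennreal C * riesz_kernel \<alpha> x w"
proof -
  let ?f = "\<lambda>u::complex. norm u powr (- 1 - \<alpha>) / (norm u + 1)"
  have "(\<integral>\<^sup>+u. ennreal (?f u) \<partial>lborel) \<le> (\<integral>\<^sup>+u. ennreal (norm u powr (- (1 + \<alpha>)) * (1 + (norm u)\<^sup>2) powr (- 1 / 2)) \<partial>(lborel :: complex measure))"
  proof (intro nn_integral_mono ennreal_leI)
    fix u :: complex
    have "sqrt (1 + (norm u)\<^sup>2) \<le> norm u + 1"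
      by (rule real_le_lsqrt) (auto simp: power2_eq_square algebra_simps)
    moreover have "0 < sqrt (1 + (norm u)\<^sup>2)" by (simp add: add_pos_nonneg)
    ultimately have "1 / (norm u + 1) \<le> 1 / sqrt (1 + (norm u)\<^sup>2)"
      by (intro divide_left_mono) (auto intro!: mult_pos_pos add_nonneg_pos)
    also have "\<dots> = (1 + (norm u)\<^sup>2) powr (- 1 / 2)"
    proof -
      have "(1 + (norm u)\<^sup>2) powr (1 / 2) = sqrt (1 + (norm u)\<^sup>2)"
        by (rule powr_half_sqrt) simp
      then show ?thesis
        using powr_minus_divide[of "1 + (norm u)\<^sup>2" "1 / 2"] by simp
    qed
    finally have "norm u powr (- 1 - \<alpha>) * (1 / (norm u + 1)) \<le> norm u powr (- 1 - \<alpha>) * (1 + (norm u)\<^sup>2) powr (- 1 / 2)"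
      by (rule mult_left_mono) simp
    then show "?f u \<le> norm u powr (- (1 + \<alpha>)) * (1 + (norm u)\<^sup>2) powr (- 1 / 2)"
      by simp
  qed
  also have "\<dots> < \<infinity>"
    using nn_integral_power_weight[of "1 + \<alpha>" 1] \<alpha> by simp
  finally obtain c where c: "0 \<le> c" "(\<integral>\<^sup>+u. ennreal (?f u) \<partial>lborel) = ennreal c"
    by (cases "\<integral>\<^sup>+u. ennreal (?f u) \<partial>lborel") auto
  show ?thesis
  proof (rule that[of "c + 1"])
    show "0 < c + 1" using c by simp
    fix x w :: complex
    show "(\<integral>\<^sup>+z. ennreal (norm (z - x) powr (- 1 - \<alpha>) / (norm (z - x) + norm (w - x))) \<partial>lborel)
       \<le> ennreal (c + 1) * riesz_kernel \<alpha> x w"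
    proof (cases "x = w")
      case True
      then show ?thesis using c by (simp add: riesz_kernel_def ennreal_mult_top)
    next
      case False
      define d where "d = norm (w - x)"
      have d: "d > 0" using False by (simp add: d_def)
      have "(\<integral>\<^sup>+z. ennreal (norm (z - x) powr (- 1 - \<alpha>) / (norm (z - x) + d)) \<partial>lborel)
        = (\<integral>\<^sup>+z. ennreal (norm (z - x) powr (- 1 - \<alpha>) / (norm (z - x) + d)) \<partial>density (distr lborel borel (\<lambda>u::complex. x + d *\<^sub>R u)) (\<lambda>_. ennreal (\<bar>d\<bar>^DIM(complex))))"
        using d by (subst lborel_affine[of d x]) auto
      also have "\<dots> = (\<integral>\<^sup>+u. ennreal (d\<^sup>2) * ennreal (norm (d *\<^sub>R u) powr (- 1 - \<alpha>) / (norm (d *\<^sub>R u) + d)) \<partial>(lborel :: complex measure))"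
        using d by (subst nn_integral_density) (auto simp: nn_integral_distr)
      also have "\<dots> = (\<integral>\<^sup>+u. ennreal (d powr (- \<alpha>)) * ennreal (?f u) \<partial>(lborel :: complex measure))"
      proof (intro nn_integral_cong)
        fix u :: complex
        have "norm (d *\<^sub>R u) powr (- 1 - \<alpha>) = d powr (- 1 - \<alpha>) * norm u powr (- 1 - \<alpha>)"
          using d by (simp add: powr_mult)
        moreover have "norm (d *\<^sub>R u) + d = d * (norm u + 1)"
          using d by (simp add: algebra_simps)
        moreover have "d\<^sup>2 * d powr (- 1 - \<alpha>) / d = d powr (- \<alpha>)"
        proof -
          have "d\<^sup>2 * d powr (- 1 - \<alpha>) = d powr (2 + (- 1 - \<alpha>))"
            using d by (subst powr_add) (simp add: powr_numeral)
          also have "\<dots> / d = d powr (2 + (- 1 - \<alpha>) - 1)"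
            using d by (subst powr_diff) simp
          finally show ?thesis by simp
        qed
        ultimately have "d\<^sup>2 * (norm (d *\<^sub>R u) powr (- 1 - \<alpha>) / (norm (d *\<^sub>R u) + d)) = d powr (- \<alpha>) * ?f u"
          by (metis (no_types, lifting) mult.assoc times_divide_times_eq times_divide_eq_right)
        then show "ennreal (d\<^sup>2) * ennreal (norm (d *\<^sub>R u) powr (- 1 - \<alpha>) / (norm (d *\<^sub>R u) + d)) = ennreal (d powr (- \<alpha>)) * ennreal (?f u)"
          using d by (subst (1 2) ennreal_mult[symmetric]) auto
      qed
      also have "\<dots> = ennreal (d powr (- \<alpha>)) * ennreal c"
        by (subst nn_integral_cmult) (auto simp: c)
      also have "\<dots> \<le> ennreal (d powr (- \<alpha>)) * ennreal (c + 1)"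
        by (intro mult_left_mono ennreal_leI) auto
      finally show ?thesis
        using False by (simp add: d_def riesz_kernel_def norm_minus_commute mult.commute)
    qed
  qed
qed

lemma inverse_add_le_riesz_kernel:
  assumes \<alpha>: "0 < \<alpha>" "\<alpha> < 1" and \<rho>: "0 < \<rho>"
  shows "ennreal (1 / (\<rho> + norm (w - x))) \<le> ennreal (\<rho> powr (\<alpha> - 1)) * riesz_kernel \<alpha> x w"
proof (cases "x = w")
  case True
  then show ?thesis using \<rho> by (simp add: riesz_kernel_def ennreal_mult_top)
next
  case False
  define d where "d = norm (w - x)"
  have d: "d > 0" using False by (simp add: d_def)
  have "\<rho> powr (1 - \<alpha>) * d powr \<alpha> \<le> (\<rho> + d) powr (1 - \<alpha>) * (\<rho> + d) powr \<alpha>"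
    using \<alpha> \<rho> d by (intro mult_mono powr_mono2) auto
  also have "\<dots> = \<rho> + d" using \<rho> d by (simp flip: powr_add)
  finally have "1 / (\<rho> + d) \<le> 1 / (\<rho> powr (1 - \<alpha>) * d powr \<alpha>)"
    using \<rho> d by (intro divide_left_mono) auto
  also have "\<dots> = \<rho> powr (\<alpha> - 1) * d powr (- \<alpha>)"
    using powr_minus_divide[of \<rho> "1 - \<alpha>"] powr_minus_divide[of d \<alpha>] by simp
  finally have "ennreal (1 / (\<rho> + d)) \<le> ennreal (\<rho> powr (\<alpha> - 1) * d powr (- \<alpha>))"
    by (rule ennreal_leI)
  then show ?thesis
    using False by (simp add: ennreal_mult riesz_kernel_def d_def norm_minus_commute)
qed

text \<open>A power of a total mass is controlled by integrals over the part of the mass that comes later in the order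
  given by \<open>\<tau>\<close>. By symmetry the square of the mass is at most twice \<open>\<integral> k S\<close>, with \<open>S x\<close> the mass of
  \<open>{w. \<tau> x \<le> \<tau> w}\<close>; Young's inequality then raises \<open>S\<close> to the power \<open>p - 1\<close>.\<close>

lemma power_le_ordered_integral:
  fixes \<nu> :: "complex measure" and k \<tau> :: "complex \<Rightarrow> real"
  assumes fin: "finite_measure \<nu>" and s: "sets \<nu> = sets borel" and p: "2 \<le> p"
    and [measurable]: "k \<in> borel_measurable borel" "\<tau> \<in> borel_measurable borel" and k0: "\<And>w. 0 \<le> k w"
    and T: "0 \<le> T" "(\<integral>\<^sup>+w. ennreal (k w) \<partial>\<nu>) = ennreal T"
  shows "ennreal (T powr p) \<le> ennreal (4 powr (p - 1)) *
     (\<integral>\<^sup>+x. ennreal (k x) * ennreal (enn2real (\<integral>\<^sup>+w. ennreal (k w) * indicator {w. \<tau> x \<le> \<tau> w} w \<partial>\<nu>) powr (p - 1)) \<partial>\<nu>)"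
proof (cases "T = 0")
  case False
  then have Tpos: "T > 0" using T by simp
  note [measurable_cong] = s
  interpret finite_measure \<nu> by fact
  interpret pair_sigma_finite \<nu> \<nu> ..
  define S where "S x = (\<integral>\<^sup>+w. ennreal (k w) * indicator {w. \<tau> x \<le> \<tau> w} w \<partial>\<nu>)" for x
  have [measurable]: "S \<in> borel_measurable borel"
    unfolding S_def measurable_cong_sets[OF s[symmetric] refl] by measurable
  define J where "J = (\<integral>\<^sup>+x. ennreal (k x) * ennreal (enn2real (S x) powr (p - 1)) \<partial>\<nu>)"
  have ST: "S x \<le> ennreal T" for x
    unfolding S_def T(2)[symmetric] by (intro nn_integral_mono) (auto simp: indicator_def)
  then have Sfin: "ennreal (enn2real (S x)) = S x" for x
    using order_le_less_trans[OF ST ennreal_less_top] by simp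
  have "ennreal T * ennreal T = (\<integral>\<^sup>+x. ennreal (k x) * ennreal T \<partial>\<nu>)"
    by (subst nn_integral_multc) (auto simp: T)
  also have "\<dots> = (\<integral>\<^sup>+x. \<integral>\<^sup>+w. ennreal (k x) * ennreal (k w) \<partial>\<nu> \<partial>\<nu>)"
    by (intro nn_integral_cong) (simp add: nn_integral_cmult T)
  also have "\<dots> \<le> (\<integral>\<^sup>+x. (\<integral>\<^sup>+w. ennreal (k x) * (ennreal (k w) * indicator {w. \<tau> x \<le> \<tau> w} w) \<partial>\<nu>)
       + (\<integral>\<^sup>+w. ennreal (k w) * (ennreal (k x) * indicator {x. \<tau> w \<le> \<tau> x} x) \<partial>\<nu>) \<partial>\<nu>)"
  proof (rule nn_integral_mono)
    fix x
    have "(\<integral>\<^sup>+w. ennreal (k x) * ennreal (k w) \<partial>\<nu>)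
      \<le> (\<integral>\<^sup>+w. ennreal (k x) * (ennreal (k w) * indicator {w. \<tau> x \<le> \<tau> w} w) + ennreal (k w) * (ennreal (k x) * indicator {x. \<tau> w \<le> \<tau> x} x) \<partial>\<nu>)"
      by (intro nn_integral_mono) (auto simp: indicator_def mult.commute)
    also have "\<dots> = (\<integral>\<^sup>+w. ennreal (k x) * (ennreal (k w) * indicator {w. \<tau> x \<le> \<tau> w} w) \<partial>\<nu>)
       + (\<integral>\<^sup>+w. ennreal (k w) * (ennreal (k x) * indicator {x. \<tau> w \<le> \<tau> x} x) \<partial>\<nu>)"
      by (rule nn_integral_add) measurable
    finally show "(\<integral>\<^sup>+w. ennreal (k x) * ennreal (k w) \<partial>\<nu>) \<le> \<dots>" .
  qed
  also have "\<dots> = (\<integral>\<^sup>+x. \<integral>\<^sup>+w. ennreal (k x) * (ennreal (k w) * indicator {w. \<tau> x \<le> \<tau> w} w) \<partial>\<nu> \<partial>\<nu>)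
       + (\<integral>\<^sup>+x. \<integral>\<^sup>+w. ennreal (k w) * (ennreal (k x) * indicator {x. \<tau> w \<le> \<tau> x} x) \<partial>\<nu> \<partial>\<nu>)"
    by (rule nn_integral_add) measurable
  also have "(\<integral>\<^sup>+x. \<integral>\<^sup>+w. ennreal (k w) * (ennreal (k x) * indicator {x. \<tau> w \<le> \<tau> x} x) \<partial>\<nu> \<partial>\<nu>)
       = (\<integral>\<^sup>+w. \<integral>\<^sup>+x. ennreal (k w) * (ennreal (k x) * indicator {x. \<tau> w \<le> \<tau> x} x) \<partial>\<nu> \<partial>\<nu>)"
    by (rule Fubini') measurable
  also have "(\<integral>\<^sup>+x. \<integral>\<^sup>+w. ennreal (k x) * (ennreal (k w) * indicator {w. \<tau> x \<le> \<tau> w} w) \<partial>\<nu> \<partial>\<nu>)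
       = (\<integral>\<^sup>+x. ennreal (k x) * S x \<partial>\<nu>)"
    unfolding S_def by (intro nn_integral_cong nn_integral_cmult) measurable
  finally have TT: "ennreal T * ennreal T \<le> 2 * (\<integral>\<^sup>+x. ennreal (k x) * S x \<partial>\<nu>)"
    by (simp add: mult_2)
  \<comment> \<open>small enough for the first summand of Young's inequality to be absorbed by the left-hand side\<close>
  define t where "t = T / 4"
  have t: "t > 0" using Tpos by (simp add: t_def)
  have "(\<integral>\<^sup>+x. ennreal (k x) * S x \<partial>\<nu>)
     \<le> (\<integral>\<^sup>+x. ennreal t * ennreal (k x) + ennreal (t powr (2 - p)) * (ennreal (k x) * ennreal (enn2real (S x) powr (p - 1))) \<partial>\<nu>)"
  proof (rule nn_integral_mono)
    fix x
    have "enn2real (S x) \<le> t + t powr (1 - (p - 1)) * enn2real (S x) powr (p - 1)"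
      using p t by (intro le_add_powr) auto
    then have "k x * enn2real (S x) \<le> k x * (t + t powr (2 - p) * enn2real (S x) powr (p - 1))"
      by (intro mult_left_mono k0) (simp add: algebra_simps)
    also have "\<dots> = t * k x + t powr (2 - p) * (k x * enn2real (S x) powr (p - 1))"
      by (simp add: algebra_simps)
    finally have "ennreal (k x * enn2real (S x)) \<le> ennreal (t * k x + t powr (2 - p) * (k x * enn2real (S x) powr (p - 1)))"
      by (rule ennreal_leI)
    also have "\<dots> = ennreal t * ennreal (k x) + ennreal (t powr (2 - p)) * (ennreal (k x) * ennreal (enn2real (S x) powr (p - 1)))"
      using t k0 by (simp add: ennreal_mult ennreal_plus)
    finally show "ennreal (k x) * S x \<le> ennreal t * ennreal (k x) + ennreal (t powr (2 - p)) * (ennreal (k x) * ennreal (enn2real (S x) powr (p - 1)))"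
      using k0 by (simp add: ennreal_mult Sfin)
  qed
  also have "\<dots> = ennreal t * ennreal T + ennreal (t powr (2 - p)) * J"
    unfolding J_def by (subst nn_integral_add, measurable) (simp add: nn_integral_cmult T)
  finally have kS: "(\<integral>\<^sup>+x. ennreal (k x) * S x \<partial>\<nu>) \<le> ennreal t * ennreal T + ennreal (t powr (2 - p)) * J" .
  have "ennreal (T powr p) \<le> ennreal (4 powr (p - 1)) * J"
  proof (cases J)
    case (real j)
    have "ennreal (T * T) \<le> 2 * (ennreal t * ennreal T + ennreal (t powr (2 - p)) * J)"
      using order_trans[OF TT mult_left_mono[OF kS, of 2]] T by (simp add: ennreal_mult)
    also have "\<dots> = ennreal (2 * (t * T + t powr (2 - p) * j))"
      using t T real by (simp add: ennreal_mult ennreal_plus)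
    finally have "T * T \<le> 2 * (t * T + t powr (2 - p) * j)"
      using t T real by (subst (asm) ennreal_le_iff) auto
    then have "T * T / 4 \<le> t powr (2 - p) * j"
      by (simp add: t_def)
    then have "t powr (p - 2) * (T * T / 4) \<le> t powr (p - 2) * (t powr (2 - p) * j)"
      by (intro mult_left_mono) auto
    also have "\<dots> = j" using t by (simp add: mult.assoc[symmetric] flip: powr_add)
    also have "t powr (p - 2) * (T * T / 4) = T powr p / 4 powr (p - 1)"
    proof -
      have "t powr (p - 2) = T powr (p - 2) / 4 powr (p - 2)"
        using Tpos by (simp add: t_def powr_divide)
      moreover have "T powr p = T powr (p - 2) * (T * T)"
        using Tpos powr_add[of T "p - 2" 2] by (simp add: powr_numeral power2_eq_square)
      moreover have "(4::real) powr (p - 1) = 4 powr (p - 2) * 4"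
        using powr_add[of "4::real" "p - 2" 1] by simp
      ultimately show ?thesis by simp
    qed
    finally have "T powr p \<le> 4 powr (p - 1) * j"
      by (simp add: field_simps)
    then show ?thesis using real by (simp add: ennreal_leI flip: ennreal_mult)
  qed (simp add: ennreal_mult_top)
  then show ?thesis by (simp add: J_def S_def)
qed simp

text \<open>A measure with bounded Riesz potential of order \<open>\<alpha> = 2 - q\<close> has a \<open>p\<close>-integrable Newton potential \<open>T\<close>. Let \<open>S x\<close> be
  the part of \<open>T z\<close> coming from points that are at least as far from \<open>z\<close> as \<open>x\<close> is, and
  \<open>\<rho> = norm (z - x)\<close>. Then \<open>S x \<le> 3 \<Psi>\<close> with \<open>\<Psi> = \<integral> 1 / (\<rho> + norm (w - x))\<close>, and bounding all but one of the
  \<open>p - 1\<close> factors of \<open>\<Psi> ^ (p - 1)\<close> by \<open>M \<rho> powr (\<alpha> - 1)\<close> leaves, since \<open>(1 - \<alpha>) (p - 2) = \<alpha>\<close>, the kernel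
  \<open>\<rho> powr (- 1 - \<alpha>) / (\<rho> + norm (w - x))\<close>. Its integral over \<open>z\<close> is a multiple of the Riesz kernel.\<close>

lemma newton_potential_Lp:
  fixes \<nu> :: "complex measure"
  assumes fin: "finite_measure \<nu>" and s: "sets \<nu> = sets borel"
    and p: "2 < p" and \<alpha>: "\<alpha> = (p - 2) / (p - 1)" and M: "0 < M"
    and K: "AE x in \<nu>. x \<notin> \<Omega>" and U: "AE x in \<nu>. (\<integral>\<^sup>+w. riesz_kernel \<alpha> x w \<partial>\<nu>) \<le> ennreal M"
    and \<Omega>: "open \<Omega>"
  shows "(\<integral>\<^sup>+z\<in>\<Omega>. ennreal (enn2real (\<integral>\<^sup>+w. ennreal (1 / norm (z - w)) \<partial>\<nu>) powr p) \<partial>lborel) < \<infinity>"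
proof -
  note [measurable_cong] = s
  interpret finite_measure \<nu> by fact
  interpret P: pair_sigma_finite "lborel :: complex measure" \<nu> ..
  have [measurable]: "\<Omega> \<in> sets borel" using \<Omega> by simp
  have \<alpha>01: "0 < \<alpha>" "\<alpha> < 1" using p by (auto simp: \<alpha> field_simps)
  have \<alpha>p: "(1 - \<alpha>) * (p - 2) = \<alpha>" using p by (simp add: \<alpha> field_simps)
  have [measurable]: "(\<lambda>x. riesz_kernel \<alpha> (f x) (g x)) \<in> borel_measurable N"
    if [measurable]: "f \<in> borel_measurable N" "g \<in> borel_measurable N" for f g and N :: "'x measure"
    unfolding riesz_kernel_def by measurable
  obtain C where C: "0 < C" "\<And>x w. (\<integral>\<^sup>+z. ennreal (norm (z - x) powr (- 1 - \<alpha>) / (norm (z - x) + norm (w - x))) \<partial>lborel)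
       \<le> ennreal C * riesz_kernel \<alpha> x w"
    using riesz_potential_scaling[OF \<alpha>01] by blast
  define D where "D = 3 powr (p - 1) * M powr (p - 2)"
  have D: "D > 0" using M by (simp add: D_def)
  define \<Psi> where "\<Psi> z x = (\<integral>\<^sup>+w. ennreal (1 / (norm (z - x) + norm (w - x))) \<partial>\<nu>)" for z x :: complex
  define T where "T z = enn2real (\<integral>\<^sup>+w. ennreal (1 / norm (z - w)) \<partial>\<nu>)" for z
  have pt: "ennreal (T z powr p) \<le> ennreal (4 powr (p - 1) * D) *
       (\<integral>\<^sup>+x. \<integral>\<^sup>+w. ennreal (norm (z - x) powr (- 1 - \<alpha>) / (norm (z - x) + norm (w - x))) \<partial>\<nu> \<partial>\<nu>)"
    if z: "z \<in> \<Omega>" for z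
  proof -
    obtain \<delta> where \<delta>: "\<delta> > 0" "ball z \<delta> \<subseteq> \<Omega>" using \<Omega> z openE by blast
    have far: "\<delta> \<le> norm (z - x)" if "x \<notin> \<Omega>" for x
      using \<delta> that by (force simp: dist_norm)
    have "(\<integral>\<^sup>+w. ennreal (1 / norm (z - w)) \<partial>\<nu>) \<le> (\<integral>\<^sup>+w. ennreal (1 / \<delta>) \<partial>\<nu>)"
    proof (rule nn_integral_mono_AE)
      show "AE w in \<nu>. ennreal (1 / norm (z - w)) \<le> ennreal (1 / \<delta>)"
        using K by eventually_elim (use far \<delta> in \<open>auto intro!: ennreal_leI divide_left_mono mult_pos_pos intro: order_less_le_trans\<close>)
    qed
    also have "\<dots> < \<infinity>"
      using emeasure_finite[of "space \<nu>"] by (auto simp: ennreal_mult_eq_top_iff less_top[symmetric])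
    finally have Tz: "(\<integral>\<^sup>+w. ennreal (1 / norm (z - w)) \<partial>\<nu>) = ennreal (T z)"
      by (simp add: T_def)
    have T0: "0 \<le> T z" by (simp add: T_def)
    define S where "S x = (\<integral>\<^sup>+w. ennreal (1 / norm (z - w)) * indicator {w. norm (z - x) \<le> norm (z - w)} w \<partial>\<nu>)" for x
    have "ennreal (T z powr p) \<le> ennreal (4 powr (p - 1)) *
       (\<integral>\<^sup>+x. ennreal (1 / norm (z - x)) * ennreal (enn2real (S x) powr (p - 1)) \<partial>\<nu>)"
      unfolding S_def
      by (rule power_le_ordered_integral[OF fin s _ _ _ _ T0 Tz]) (use p in auto)
    also have "(\<integral>\<^sup>+x. ennreal (1 / norm (z - x)) * ennreal (enn2real (S x) powr (p - 1)) \<partial>\<nu>)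
       \<le> (\<integral>\<^sup>+x. ennreal D * (\<integral>\<^sup>+w. ennreal (norm (z - x) powr (- 1 - \<alpha>) / (norm (z - x) + norm (w - x))) \<partial>\<nu>) \<partial>\<nu>)"
    proof (rule nn_integral_mono_AE)
      show "AE x in \<nu>. ennreal (1 / norm (z - x)) * ennreal (enn2real (S x) powr (p - 1))
         \<le> ennreal D * (\<integral>\<^sup>+w. ennreal (norm (z - x) powr (- 1 - \<alpha>) / (norm (z - x) + norm (w - x))) \<partial>\<nu>)"
        using K U
      proof eventually_elim
        case (elim x)
        define \<rho> where "\<rho> = norm (z - x)"
        have "\<delta> \<le> \<rho>" using far[OF elim(1)] by (simp add: \<rho>_def)
        then have \<rho>: "\<rho> > 0" using \<delta> by linarith
        have "S x \<le> (\<integral>\<^sup>+w. ennreal 3 * ennreal (1 / (\<rho> + norm (w - x))) \<partial>\<nu>)"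
          unfolding S_def
        proof (rule nn_integral_mono)
          fix w
          show "ennreal (1 / norm (z - w)) * indicator {w. norm (z - x) \<le> norm (z - w)} w
              \<le> ennreal 3 * ennreal (1 / (\<rho> + norm (w - x)))"
          proof (cases "norm (z - x) \<le> norm (z - w)")
            case True
            have "norm (w - x) \<le> norm (z - w) + norm (z - x)"
              using norm_triangle_ineq4[of "z - x" "z - w"] by simp
            then have "\<rho> + norm (w - x) \<le> 3 * norm (z - w)" using True by (simp add: \<rho>_def)
            then have "1 / norm (z - w) \<le> 3 * (1 / (\<rho> + norm (w - x)))"
              using \<rho> True by (simp add: \<rho>_def divide_simps add_pos_nonneg)
            then have "ennreal (1 / norm (z - w)) \<le> ennreal (3 * (1 / (\<rho> + norm (w - x))))"
              by (rule ennreal_leI)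
            also have "\<dots> = ennreal 3 * ennreal (1 / (\<rho> + norm (w - x)))"
              using \<rho> by (intro ennreal_mult) auto
            finally show ?thesis using True by simp
          qed simp
        qed
        also have "\<dots> = ennreal 3 * \<Psi> z x"
          unfolding \<Psi>_def \<rho>_def by (rule nn_integral_cmult) measurable
        finally have S\<Psi>: "S x \<le> ennreal 3 * \<Psi> z x" .
        have "\<Psi> z x \<le> (\<integral>\<^sup>+w. ennreal (\<rho> powr (\<alpha> - 1)) * riesz_kernel \<alpha> x w \<partial>\<nu>)"
          unfolding \<Psi>_def using inverse_add_le_riesz_kernel[OF \<alpha>01 \<rho>] by (intro nn_integral_mono) (simp add: \<rho>_def)
        also have "\<dots> = ennreal (\<rho> powr (\<alpha> - 1)) * (\<integral>\<^sup>+w. riesz_kernel \<alpha> x w \<partial>\<nu>)"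
          by (rule nn_integral_cmult) measurable
        also have "\<dots> \<le> ennreal (\<rho> powr (\<alpha> - 1)) * ennreal M"
          by (intro mult_left_mono elim) auto
        also have "\<dots> = ennreal (\<rho> powr (\<alpha> - 1) * M)"
          using M by (simp add: ennreal_mult)
        finally have \<Psi>M: "\<Psi> z x \<le> ennreal (\<rho> powr (\<alpha> - 1) * M)" .
        then obtain y where y: "0 \<le> y" "\<Psi> z x = ennreal y" "y \<le> \<rho> powr (\<alpha> - 1) * M"
          using M by (cases "\<Psi> z x") (auto simp: ennreal_le_iff top_unique)
        have Sy: "enn2real (S x) \<le> 3 * y"
        proof (rule enn2real_leI)
          show "S x \<le> ennreal (3 * y)"
            using S\<Psi> y(1) unfolding y(2) by (subst ennreal_mult) auto
        qed (use y in simp)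
        have "enn2real (S x) powr (p - 1) \<le> (3 * y) powr (p - 1)"
          using Sy p by (intro powr_mono2) auto
        also have "\<dots> = 3 powr (p - 1) * (y powr (p - 2) * y)"
        proof (cases "y = 0")
          case False
          then have "y powr (p - 1) = y powr (p - 2) * y"
            using y(1) powr_add[of y "p - 2" 1] by simp
          then show ?thesis by (simp add: powr_mult)
        qed simp
        also have "\<dots> \<le> 3 powr (p - 1) * ((\<rho> powr (\<alpha> - 1) * M) powr (p - 2) * y)"
          using y p by (intro mult_left_mono mult_right_mono powr_mono2) auto
        also have "(\<rho> powr (\<alpha> - 1) * M) powr (p - 2) = \<rho> powr (- \<alpha>) * M powr (p - 2)"
        proof -
          have "(\<alpha> - 1) * (p - 2) = - \<alpha>" using \<alpha>p by (simp add: algebra_simps)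
          then show ?thesis using M \<rho> by (simp add: powr_mult powr_powr)
        qed
        finally have "enn2real (S x) powr (p - 1) \<le> D * (\<rho> powr (- \<alpha>) * y)"
          by (simp add: D_def mult_ac)
        then have "1 / \<rho> * enn2real (S x) powr (p - 1) \<le> 1 / \<rho> * (D * (\<rho> powr (- \<alpha>) * y))"
          using \<rho> by (intro mult_left_mono) auto
        also have "\<dots> = D * (\<rho> powr (- 1 - \<alpha>) * y)"
          using \<rho> powr_add[of \<rho> "- 1" "- \<alpha>"] by (simp add: powr_minus_divide)
        finally have "ennreal (1 / \<rho> * enn2real (S x) powr (p - 1)) \<le> ennreal (D * (\<rho> powr (- 1 - \<alpha>) * y))"
          by (rule ennreal_leI)
        also have "\<dots> = ennreal D * (ennreal (\<rho> powr (- 1 - \<alpha>)) * \<Psi> z x)"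
          using D y by (simp add: ennreal_mult)
        also have "ennreal (\<rho> powr (- 1 - \<alpha>)) * \<Psi> z x
           = (\<integral>\<^sup>+w. ennreal (\<rho> powr (- 1 - \<alpha>)) * ennreal (1 / (\<rho> + norm (w - x))) \<partial>\<nu>)"
          unfolding \<Psi>_def \<rho>_def by (rule nn_integral_cmult[symmetric]) measurable
        also have "\<dots> = (\<integral>\<^sup>+w. ennreal (\<rho> powr (- 1 - \<alpha>) / (\<rho> + norm (w - x))) \<partial>\<nu>)"
          using \<rho> by (intro nn_integral_cong) (simp flip: ennreal_mult)
        finally have "ennreal (1 / \<rho> * enn2real (S x) powr (p - 1))
            \<le> ennreal D * (\<integral>\<^sup>+w. ennreal (\<rho> powr (- 1 - \<alpha>) / (\<rho> + norm (w - x))) \<partial>\<nu>)" .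
        moreover have "ennreal (1 / \<rho> * enn2real (S x) powr (p - 1)) = ennreal (1 / \<rho>) * ennreal (enn2real (S x) powr (p - 1))"
          using \<rho> by (intro ennreal_mult) auto
        ultimately show ?case
          by (simp only: \<rho>_def)
      qed
    qed
    also have "\<dots> = ennreal D * (\<integral>\<^sup>+x. \<integral>\<^sup>+w. ennreal (norm (z - x) powr (- 1 - \<alpha>) / (norm (z - x) + norm (w - x))) \<partial>\<nu> \<partial>\<nu>)"
      by (rule nn_integral_cmult) measurable
    finally show ?thesis
      using D by (simp add: ennreal_mult mult.assoc mult_left_mono)
  qed
  let ?g = "\<lambda>z x w. ennreal (norm (z - x) powr (- 1 - \<alpha>) / (norm (z - x) + norm (w - x)))"
  have "(\<integral>\<^sup>+z. \<integral>\<^sup>+x. \<integral>\<^sup>+w. ?g z x w \<partial>\<nu> \<partial>\<nu> \<partial>lborel) = (\<integral>\<^sup>+x. \<integral>\<^sup>+z. \<integral>\<^sup>+w. ?g z x w \<partial>\<nu> \<partial>lborel \<partial>\<nu>)"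
    by (rule P.Fubini'[symmetric]) measurable
  also have "\<dots> = (\<integral>\<^sup>+x. \<integral>\<^sup>+w. \<integral>\<^sup>+z. ?g z x w \<partial>lborel \<partial>\<nu> \<partial>\<nu>)"
    by (intro nn_integral_cong P.Fubini'[symmetric]) measurable
  also have "\<dots> \<le> (\<integral>\<^sup>+x. \<integral>\<^sup>+w. ennreal C * riesz_kernel \<alpha> x w \<partial>\<nu> \<partial>\<nu>)"
    by (intro nn_integral_mono C(2))
  also have "\<dots> = (\<integral>\<^sup>+x. ennreal C * (\<integral>\<^sup>+w. riesz_kernel \<alpha> x w \<partial>\<nu>) \<partial>\<nu>)"
    by (intro nn_integral_cong nn_integral_cmult) measurable
  also have "\<dots> \<le> (\<integral>\<^sup>+x. ennreal C * ennreal M \<partial>\<nu>)"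
  proof (rule nn_integral_mono_AE)
    show "AE x in \<nu>. ennreal C * (\<integral>\<^sup>+w. riesz_kernel \<alpha> x w \<partial>\<nu>) \<le> ennreal C * ennreal M"
      using U by eventually_elim (rule mult_left_mono, auto)
  qed
  also have "\<dots> < \<infinity>"
    using emeasure_finite[of "space \<nu>"] by (auto simp: ennreal_mult_eq_top_iff less_top[symmetric])
  finally have X: "(\<integral>\<^sup>+z. \<integral>\<^sup>+x. \<integral>\<^sup>+w. ?g z x w \<partial>\<nu> \<partial>\<nu> \<partial>lborel) < \<infinity>" .
  have "(\<integral>\<^sup>+z\<in>\<Omega>. ennreal (T z powr p) \<partial>lborel)
     \<le> (\<integral>\<^sup>+z. ennreal (4 powr (p - 1) * D) * (\<integral>\<^sup>+x. \<integral>\<^sup>+w. ?g z x w \<partial>\<nu> \<partial>\<nu>) \<partial>lborel)"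
    using pt by (intro nn_integral_mono) (auto simp: indicator_def)
  also have "\<dots> = ennreal (4 powr (p - 1) * D) * (\<integral>\<^sup>+z. \<integral>\<^sup>+x. \<integral>\<^sup>+w. ?g z x w \<partial>\<nu> \<partial>\<nu> \<partial>lborel)"
    by (rule nn_integral_cmult) measurable
  also have "\<dots> < \<infinity>"
    using X by (simp add: ennreal_mult_less_top)
  finally show ?thesis by (simp add: T_def)
qed


text \<open>The weight \<open>cnj (1 / (z0 - w))\<close> makes the Cauchy transform at \<open>z0\<close> equal to the positive number
  \<open>\<integral> 1 / (norm (z0 - w))\<^sup>2\<close>, so that the transform does not vanish identically on \<open>\<Omega>\<close>.\<close>

lemma bergman_nontrivial_if_bounded_potential:
  fixes \<nu> :: "complex measure"
  assumes \<Omega>: "open \<Omega>" "\<Omega> \<noteq> {}" and fin: "finite_measure \<nu>" and s: "sets \<nu> = sets borel"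
    and p: "2 < p" and \<alpha>: "\<alpha> = (p - 2) / (p - 1)" and M: "0 < M"
    and K: "AE x in \<nu>. x \<notin> \<Omega>" and U: "AE x in \<nu>. (\<integral>\<^sup>+w. riesz_kernel \<alpha> x w \<partial>\<nu>) \<le> ennreal M"
    and pos: "emeasure \<nu> (space \<nu>) \<noteq> 0"
  shows "bergman \<Omega> p \<noteq> {0}"
proof -
  note [measurable_cong] = s
  interpret finite_measure \<nu> by fact
  have [measurable]: "\<Omega> \<in> sets borel" using \<Omega> by simp
  obtain z0 where z0: "z0 \<in> \<Omega>" using \<Omega> by blast
  obtain \<delta> where \<delta>: "\<delta> > 0" "ball z0 \<delta> \<subseteq> \<Omega>" using \<Omega>(1) z0 openE by blast
  have far: "\<delta> \<le> norm (z0 - w)" if "w \<notin> \<Omega>" for w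
    using \<delta> that by (force simp: dist_norm)
  define h where "h w = indicator (- \<Omega>) w * cnj (1 / (z0 - w))" for w
  have [measurable]: "h \<in> borel_measurable borel"
    unfolding h_def by measurable
  have hb: "norm (h w) \<le> 1 / \<delta>" for w
    using far[of w] \<delta>(1) by (cases "w \<in> \<Omega>") (auto simp: h_def norm_divide norm_mult simp flip: complex_cnj_diff intro!: frac_le)
  have h0: "h w = 0" if "w \<in> \<Omega>" for w using that by (simp add: h_def)
  have hint: "integrable \<nu> h"
    by (rule integrable_const_bound[of _ "1 / \<delta>"]) (use hb in auto)
  define f where "f z = (if z \<in> \<Omega> then cauchy_transform \<nu> h z else 0)" for z
  have "cauchy_transform \<nu> h holomorphic_on \<Omega>"
    by (rule cauchy_transform_holomorphic[OF hint s \<Omega>(1) h0])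
  then have hol: "f holomorphic_on \<Omega>"
    by (rule holomorphic_transform) (simp add: f_def)
  define T where "T z = enn2real (\<integral>\<^sup>+w. ennreal (1 / norm (z - w)) \<partial>\<nu>)" for z
  have fT: "norm (f z) \<le> 1 / \<delta> * T z" if z: "z \<in> \<Omega>" for z
  proof -
    obtain \<delta>' where \<delta>': "\<delta>' > 0" "ball z \<delta>' \<subseteq> \<Omega>" using \<Omega>(1) z openE by blast
    have "(\<integral>\<^sup>+w. ennreal (1 / norm (z - w)) \<partial>\<nu>) \<le> (\<integral>\<^sup>+w. ennreal (1 / \<delta>') \<partial>\<nu>)"
    proof (rule nn_integral_mono_AE)
      show "AE w in \<nu>. ennreal (1 / norm (z - w)) \<le> ennreal (1 / \<delta>')"
        using K
      proof eventually_elim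
        case (elim w)
        then have "\<delta>' \<le> norm (z - w)" using \<delta>' by (force simp: dist_norm)
        then show ?case using \<delta>' by (intro ennreal_leI divide_left_mono) (auto intro: mult_pos_pos order_less_le_trans)
      qed
    qed
    also have "\<dots> < \<infinity>"
      using emeasure_finite[of "space \<nu>"] by (auto simp: ennreal_mult_eq_top_iff less_top[symmetric])
    finally have Tz: "(\<integral>\<^sup>+w. ennreal (1 / norm (z - w)) \<partial>\<nu>) = ennreal (T z)"
      by (simp add: T_def)
    have "ennreal (norm (f z)) \<le> (\<integral>\<^sup>+w. ennreal (norm (h w) / norm (z - w)) \<partial>\<nu>)"
      using norm_cauchy_transform_le[of \<nu> h z] z by (simp add: f_def)
    also have "\<dots> \<le> (\<integral>\<^sup>+w. ennreal (1 / \<delta>) * ennreal (1 / norm (z - w)) \<partial>\<nu>)"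
    proof (rule nn_integral_mono)
      fix w
      have "norm (h w) / norm (z - w) \<le> 1 / \<delta> * (1 / norm (z - w))"
        using divide_right_mono[OF hb[of w], of "norm (z - w)"] by simp
      then show "ennreal (norm (h w) / norm (z - w)) \<le> ennreal (1 / \<delta>) * ennreal (1 / norm (z - w))"
        using \<delta> by (subst ennreal_mult[symmetric]) (auto intro: ennreal_leI)
    qed
    also have "\<dots> = ennreal (1 / \<delta>) * ennreal (T z)"
      by (subst nn_integral_cmult) (auto simp: Tz)
    also have "\<dots> = ennreal (1 / \<delta> * T z)"
      using \<delta> by (intro ennreal_mult[symmetric]) (auto simp: T_def)
    finally show ?thesis
      using \<delta> by (subst (asm) ennreal_le_iff) (auto simp: T_def)
  qed
  have "(\<integral>\<^sup>+z. ennreal (norm (f z) powr p) \<partial>lborel)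
     \<le> (\<integral>\<^sup>+z. ennreal ((1 / \<delta>) powr p) * (ennreal (T z powr p) * indicator \<Omega> z) \<partial>lborel)"
  proof (rule nn_integral_mono)
    fix z
    show "ennreal (norm (f z) powr p) \<le> ennreal ((1 / \<delta>) powr p) * (ennreal (T z powr p) * indicator \<Omega> z)"
    proof (cases "z \<in> \<Omega>")
      case True
      have "norm (f z) powr p \<le> (1 / \<delta> * T z) powr p"
        using fT[OF True] p by (intro powr_mono2) auto
      also have "\<dots> = (1 / \<delta>) powr p * T z powr p"
        by (rule powr_mult)
      finally show ?thesis using True by (simp add: ennreal_leI flip: ennreal_mult)
    qed (simp add: f_def)
  qed
  also have "\<dots> = ennreal ((1 / \<delta>) powr p) * (\<integral>\<^sup>+z\<in>\<Omega>. ennreal (T z powr p) \<partial>lborel)"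
    unfolding T_def by (rule nn_integral_cmult) measurable
  also have "\<dots> < \<infinity>"
    using newton_potential_Lp[OF fin s p \<alpha> M K U \<Omega>(1)] by (simp add: T_def ennreal_mult_less_top)
  finally have mem: "f \<in> bergman \<Omega> p"
    using hol by (simp add: bergman_iff[OF \<Omega>(1)] f_def)
  have "f z0 \<noteq> 0"
  proof
    assume "f z0 = 0"
    then have "(\<integral>w. h w / (z0 - w) \<partial>\<nu>) = 0" using z0 by (simp add: f_def cauchy_transform_def)
    moreover have "h w / (z0 - w) = of_real ((norm (h w))\<^sup>2)" for w
    proof (cases "w \<in> \<Omega>")
      case False
      then have "h w / (z0 - w) = h w * cnj (h w)" by (simp add: h_def)
      then show ?thesis by (simp add: complex_norm_square del: of_real_power)
    qed (simp add: h0)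
    ultimately have "(\<integral>w. (norm (h w))\<^sup>2 \<partial>\<nu>) = 0"
      by (simp only: integral_complex_of_real of_real_eq_0_iff)
    moreover have "integrable \<nu> (\<lambda>w. (norm (h w))\<^sup>2)"
      by (rule integrable_const_bound[of _ "(1 / \<delta>)\<^sup>2"]) (auto simp del: power_divide intro!: power_mono hb)
    ultimately have "AE w in \<nu>. (norm (h w))\<^sup>2 = 0"
      by (subst (asm) integral_nonneg_eq_0_iff_AE) auto
    then have "AE w in \<nu>. False"
      using K
    proof eventually_elim
      case (elim w)
      then show ?case using z0 by (auto simp: h_def)
    qed
    then have "emeasure \<nu> (space \<nu>) = 0"
      by (subst (asm) AE_iff_measurable[of "space \<nu>"]) auto
    then show False using pos by simp
  qed
  then have "f \<noteq> 0" by (metis zero_fun_apply)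
  then show ?thesis using mem by blast
qed

text \<open>A measure of finite energy has an almost everywhere finite Riesz potential, so its restriction to a set
  \<open>A n\<close> on which the potential is at most \<open>Suc n\<close> is nonzero for some \<open>n\<close>.\<close>

lemma bergman_nontrivial_if_positive_capacity:
  assumes \<Omega>: "open \<Omega>" "\<Omega> \<noteq> {}" and p: "2 < p" and q: "1 / p + 1 / q = 1"
    and cap: "0 < riesz_capacity (2 - q) (- \<Omega>)"
  shows "bergman \<Omega> p \<noteq> {0}"
proof -
  have "1 / q = (p - 1) / p" using q p by (simp add: field_simps)
  then have "q = p / (p - 1)" by (metis inverse_divide inverse_eq_divide inverse_inverse_eq)
  then have \<alpha>: "2 - q = (p - 2) / (p - 1)" using p by (simp add: field_simps)
  define \<alpha> where "\<alpha> = 2 - q"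
  obtain K \<mu> where K: "compact K" "K \<subseteq> - \<Omega>" and \<mu>: "\<mu> \<in> borel_probs_on K" and E: "0 < 1 / riesz_energy \<alpha> K \<mu>"
    using cap by (auto simp: riesz_capacity_def riesz_capacity_compact_def less_SUP_iff \<alpha>_def)
  have s: "sets \<mu> = sets borel" and \<mu>K: "emeasure \<mu> (- K) = 0" and "prob_space \<mu>"
    using \<mu> by (auto simp: borel_probs_on_def)
  note [measurable_cong] = s
  interpret prob_space \<mu> by fact
  have [measurable]: "K \<in> sets borel" using K by (simp add: compact_imp_closed)
  have [measurable]: "(\<lambda>x. riesz_kernel \<alpha> (f x) (g x)) \<in> borel_measurable N"
    if [measurable]: "f \<in> borel_measurable N" "g \<in> borel_measurable N" for f g and N :: "'x measure"
    unfolding riesz_kernel_def by measurable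
  define U where "U x = (\<integral>\<^sup>+w\<in>K. riesz_kernel \<alpha> x w \<partial>\<mu>)" for x
  have [measurable]: "U \<in> borel_measurable borel"
    unfolding U_def measurable_cong_sets[OF s[symmetric] refl] by measurable
  have "riesz_energy \<alpha> K \<mu> \<noteq> \<infinity>" using E by auto
  then have "(\<integral>\<^sup>+x. U x * indicator K x \<partial>\<mu>) \<noteq> \<infinity>"
    by (simp add: riesz_energy_def U_def)
  then have "AE x in \<mu>. U x * indicator K x \<noteq> \<infinity>"
    by (intro nn_integral_PInf_AE) auto
  moreover have "AE x in \<mu>. x \<in> K"
    using \<mu>K s by (intro AE_I[of _ _ "- K"]) auto
  ultimately have Ufin: "AE x in \<mu>. x \<in> K \<and> U x \<noteq> \<infinity>"
    by eventually_elim auto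
  define A where "A n = {x \<in> K. U x \<le> ennreal (real (Suc n))}" for n :: nat
  have [measurable]: "A n \<in> sets borel" for n unfolding A_def by measurable
  obtain n where n: "emeasure \<mu> (A n) \<noteq> 0"
  proof (rule ccontr)
    assume "\<not> thesis"
    then have "A n \<in> null_sets \<mu>" for n using that s by (auto simp: null_sets_def)
    then have "(\<Union>n. A n) \<in> null_sets \<mu>" by (rule null_sets_UN)
    from AE_not_in[OF this] Ufin have "AE x in \<mu>. False"
    proof eventually_elim
      case (elim x)
      obtain m where "U x \<le> of_nat m" using elim by (metis ennreal_Ex_less_of_nat less_imp_le less_top infinity_ennreal_def)
      also have "(of_nat m :: ennreal) \<le> ennreal (real (Suc m))" by (simp add: ennreal_of_nat_eq_real_of_nat ennreal_leI del: of_nat_Suc)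
      finally have "x \<in> A m" using elim by (simp add: A_def)
      then show ?case using elim by blast
    qed
    then show False by simp
  qed
  define \<nu> where "\<nu> = density \<mu> (indicator (A n))"
  have s\<nu>: "sets \<nu> = sets borel" by (simp add: \<nu>_def s)
  have tot: "emeasure \<nu> (space \<nu>) = emeasure \<mu> (A n)"
    using sets.sets_into_space[of "A n" \<mu>] s sets.top[of \<mu>] emeasure_restricted[of "A n" \<mu> "space \<mu>"]
    by (simp add: \<nu>_def Int_absorb2)
  have fin: "finite_measure \<nu>"
    by (rule finite_measureI) (simp add: tot emeasure_finite)
  have AEA: "AE x in \<nu>. x \<in> A n"
    unfolding \<nu>_def by (subst AE_density) (auto simp: indicator_def)
  have pot: "(\<integral>\<^sup>+w. riesz_kernel \<alpha> x w \<partial>\<nu>) \<le> ennreal (real (Suc n))" if "x \<in> A n" for x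
  proof -
    have "(\<integral>\<^sup>+w. riesz_kernel \<alpha> x w \<partial>\<nu>) = (\<integral>\<^sup>+w. indicator (A n) w * riesz_kernel \<alpha> x w \<partial>\<mu>)"
      unfolding \<nu>_def by (rule nn_integral_density) measurable
    also have "\<dots> \<le> U x"
      unfolding U_def by (intro nn_integral_mono) (auto simp: A_def indicator_def)
    also have "\<dots> \<le> ennreal (real (Suc n))" using that by (simp add: A_def)
    finally show ?thesis .
  qed
  show ?thesis
  proof (rule bergman_nontrivial_if_bounded_potential[OF \<Omega> fin s\<nu> p, of \<alpha> "real (Suc n)"])
    show "\<alpha> = (p - 2) / (p - 1)" using \<alpha> by (simp add: \<alpha>_def)
    show "AE x in \<nu>. x \<notin> \<Omega>"
      using AEA by eventually_elim (use K in \<open>auto simp: A_def\<close>)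
    show "AE x in \<nu>. (\<integral>\<^sup>+w. riesz_kernel \<alpha> x w \<partial>\<nu>) \<le> ennreal (real (Suc n))"
      using AEA by eventually_elim (rule pot)
    show "emeasure \<nu> (space \<nu>) \<noteq> 0" using tot n by simp
  qed simp
qed

section \<open>Exponents below two\<close>

lemma inverse_product_bound:
  fixes z x y1 y2 :: complex
  assumes \<delta>: "0 < \<delta>" and near: "norm (z - x) \<le> norm (z - y1)" "norm (z - x) \<le> norm (z - y2)"
    and sep: "2 * \<delta> \<le> norm (x - y1)" "2 * \<delta> \<le> norm (x - y2)"
  shows "1 / (norm (z - x) * norm (z - y1) * norm (z - y2))
     \<le> 2 / min 1 (\<delta>\<^sup>2) * (1 / (norm (z - x) * (1 + (norm (z - x))\<^sup>2)))"
proof (cases "z = x")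
  case False
  define s where "s = norm (z - x)"
  define k where "k = min 1 (\<delta>\<^sup>2)"
  have s: "s > 0" using False by (simp add: s_def)
  have k: "k > 0" "k \<le> 1" "k \<le> \<delta>\<^sup>2" using \<delta> by (auto simp: k_def)
  have far: "max s \<delta> \<le> norm (z - y)" if "norm (z - x) \<le> norm (z - y)" "2 * \<delta> \<le> norm (x - y)" for y
  proof -
    have "norm (x - y) \<le> norm (z - x) + norm (z - y)"
      using norm_triangle_ineq[of "x - z" "z - y"] by (simp add: norm_minus_commute)
    then show ?thesis using that by (simp add: s_def)
  qed
  have "k * (1 + s\<^sup>2) / 2 \<le> (max s \<delta>)\<^sup>2"
  proof -
    have "k * (1 + s\<^sup>2) \<le> \<delta>\<^sup>2 + s\<^sup>2"
      using k mult_right_mono[OF k(2), of "s\<^sup>2"] by (simp add: algebra_simps)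
    moreover have "\<delta>\<^sup>2 \<le> (max s \<delta>)\<^sup>2" "s\<^sup>2 \<le> (max s \<delta>)\<^sup>2"
      using s \<delta> by (auto intro!: power_mono)
    ultimately show ?thesis by linarith
  qed
  also have "\<dots> \<le> norm (z - y1) * norm (z - y2)"
    unfolding power2_eq_square using far near sep s by (intro mult_mono) auto
  finally have "s * (k * (1 + s\<^sup>2) / 2) \<le> s * (norm (z - y1) * norm (z - y2))"
    using s by (intro mult_left_mono) auto
  moreover have "0 < s * (k * (1 + s\<^sup>2) / 2)"
    using s k by (simp add: add_pos_nonneg)
  ultimately have "1 / (s * (norm (z - y1) * norm (z - y2))) \<le> 1 / (s * (k * (1 + s\<^sup>2) / 2))"
    by (intro divide_left_mono) auto
  then show ?thesis
    by (simp add: s_def k_def mult_ac)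
qed simp

text \<open>For \<open>p < 2\<close> simple poles are locally \<open>p\<close>-integrable, and three of them produce decay of order
  \<open>1 / (norm z) ^ 3\<close>, which suffices at infinity for every \<open>p \<ge> 1\<close>.\<close>

lemma rational_mem_bergman:
  assumes \<Omega>: "open \<Omega>" and p: "1 \<le> p" "p < 2"
    and abc: "a \<notin> \<Omega>" "b \<notin> \<Omega>" "c \<notin> \<Omega>" "a \<noteq> b" "a \<noteq> c" "b \<noteq> c"
  shows "(\<lambda>z. if z \<in> \<Omega> then 1 / ((z - a) * (z - b) * (z - c)) else 0) \<in> bergman \<Omega> p" (is "?e \<in> _")
proof -
  have nz: "z - a \<noteq> 0" "z - b \<noteq> 0" "z - c \<noteq> 0" if "z \<in> \<Omega>" for z
    using abc that by auto
  have "(\<lambda>z. 1 / ((z - a) * (z - b) * (z - c))) holomorphic_on \<Omega>"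
    by (intro holomorphic_intros) (use nz in auto)
  then have hol: "?e holomorphic_on \<Omega>"
    by (rule holomorphic_transform) simp
  define \<delta> where "\<delta> = min (norm (a - b)) (min (norm (a - c)) (norm (b - c))) / 2"
  have \<delta>: "0 < \<delta>" "2 * \<delta> \<le> norm (a - b)" "2 * \<delta> \<le> norm (a - c)" "2 * \<delta> \<le> norm (b - c)"
    using abc by (auto simp: \<delta>_def)
  define k where "k = 2 / min 1 (\<delta>\<^sup>2)"
  have k: "k > 0" using \<delta> by (simp add: k_def)
  let ?w = "\<lambda>z. norm z powr (- p) * (1 + (norm z)\<^sup>2) powr (- (2 * p) / 2)"
  have weight: "(1 / (norm u * (1 + (norm u)\<^sup>2))) powr p = ?w u" for u :: complex
    by (simp add: powr_divide powr_mult powr_minus_divide add_nonneg_nonneg)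
  have bound: "norm (?e z) powr p \<le> k powr p * (?w (a - z) + ?w (b - z) + ?w (c - z))" for z
  proof -
    have w0: "0 \<le> ?w u" for u :: complex by simp
    \<comment> \<open>take for \<open>x\<close> a pole nearest to \<open>z\<close>; the product of the distances to the others is at least \<open>1 + (norm (z - x))\<^sup>2\<close> up to a constant\<close>
    have "\<exists>x\<in>{a, b, c}. norm (?e z) \<le> k * (1 / (norm (z - x) * (1 + (norm (z - x))\<^sup>2)))"
    proof -
      have le: "norm (?e z) \<le> 1 / (norm (z - a) * norm (z - b) * norm (z - c))"
        by (simp add: norm_divide norm_mult)
      consider "norm (z - a) \<le> norm (z - b)" "norm (z - a) \<le> norm (z - c)"
        | "norm (z - b) \<le> norm (z - a)" "norm (z - b) \<le> norm (z - c)"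
        | "norm (z - c) \<le> norm (z - a)" "norm (z - c) \<le> norm (z - b)" by linarith
      then show ?thesis
      proof cases
        case 1
        from inverse_product_bound[OF \<delta>(1) this] \<delta> le show ?thesis by (auto simp: k_def)
      next
        case 2
        from inverse_product_bound[OF \<delta>(1) this] \<delta> le show ?thesis
          by (auto simp: k_def norm_minus_commute[of b a] mult_ac)
      next
        case 3
        from inverse_product_bound[OF \<delta>(1) this] \<delta> le show ?thesis
          by (auto simp: k_def norm_minus_commute[of c a] norm_minus_commute[of c b] mult_ac)
      qed
    qed
    then obtain x where x: "x \<in> {a, b, c}" "norm (?e z) \<le> k * (1 / (norm (z - x) * (1 + (norm (z - x))\<^sup>2)))"
      by blast
    then have "norm (?e z) powr p \<le> (k * (1 / (norm (z - x) * (1 + (norm (z - x))\<^sup>2)))) powr p"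
      using p by (intro powr_mono2) auto
    also have "\<dots> = k powr p * ?w (x - z)"
      using k unfolding weight[symmetric] by (subst powr_mult) (auto simp: norm_minus_commute add_nonneg_nonneg)
    also have "\<dots> \<le> k powr p * (?w (a - z) + ?w (b - z) + ?w (c - z))"
      using x(1) w0[of "a - z"] w0[of "b - z"] w0[of "c - z"] by (intro mult_left_mono) auto
    finally show ?thesis .
  qed
  have fin: "(\<integral>\<^sup>+z. ennreal (?w (x - z)) \<partial>lborel) < \<infinity>" for x :: complex
    using nn_integral_lborel_reflect[of "\<lambda>z. ennreal (?w z)" x] nn_integral_power_weight[of p "2 * p"] p by simp
  have "(\<integral>\<^sup>+z. ennreal (norm (?e z) powr p) \<partial>lborel)
     \<le> (\<integral>\<^sup>+z. ennreal (k powr p) * (ennreal (?w (a - z)) + ennreal (?w (b - z)) + ennreal (?w (c - z))) \<partial>lborel)"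
  proof (rule nn_integral_mono)
    fix z
    have "ennreal (norm (?e z) powr p) \<le> ennreal (k powr p * (?w (a - z) + ?w (b - z) + ?w (c - z)))"
      by (rule ennreal_leI[OF bound])
    also have "\<dots> = ennreal (k powr p) * (ennreal (?w (a - z)) + ennreal (?w (b - z)) + ennreal (?w (c - z)))"
      by (simp only: ennreal_mult ennreal_plus add_nonneg_nonneg mult_nonneg_nonneg powr_ge_zero)
    finally show "ennreal (norm (?e z) powr p) \<le> \<dots>" .
  qed
  also have "\<dots> = ennreal (k powr p) * ((\<integral>\<^sup>+z. ennreal (?w (a - z)) \<partial>lborel) + (\<integral>\<^sup>+z. ennreal (?w (b - z)) \<partial>lborel) + (\<integral>\<^sup>+z. ennreal (?w (c - z)) \<partial>lborel))"
    by (subst nn_integral_cmult, measurable, subst nn_integral_add, measurable, subst nn_integral_add, measurable)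
  also have "\<dots> < \<infinity>"
    using fin[of a] fin[of b] fin[of c] by (auto simp: ennreal_mult_less_top)
  finally show ?thesis
    using hol by (simp add: bergman_iff[OF \<Omega>])
qed

lemma bergman_infinite_dimensional_if_infinite_complement:
  assumes \<Omega>: "open \<Omega>" "\<Omega> \<noteq> {}" and inf: "infinite (- \<Omega>)" and p: "1 \<le> p" "p < 2"
  shows "infinite_dimensional (bergman \<Omega> p)"
proof -
  have False if B: "finite B" and V: "bergman \<Omega> p = cfun.span B" for B
  proof -
    obtain a :: "nat \<Rightarrow> complex" where a: "inj a" "range a \<subseteq> - \<Omega>"
      using infinite_countable_subset[OF inf] by blast
    define F where "F i z = (if z \<in> \<Omega> then 1 / ((z - a 0) * (z - a 1) * (z - a (i + 2))) else 0)" for i z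
    have aneq: "a i \<noteq> a j" if "i \<noteq> j" for i j
      using a(1) that by (simp add: inj_eq)
    have a\<Omega>: "a i \<notin> \<Omega>" for i using a(2) by auto
    have "F i \<in> cfun.span B" for i
      unfolding V[symmetric] F_def by (rule rational_mem_bergman[OF \<Omega>(1) p]) (auto intro!: a\<Omega> aneq)
    then obtain c k where c: "k < Suc (card B)" "c k \<noteq> 0" "\<And>z. (\<Sum>i<Suc (card B). c i * F i z) = 0"
      using cfun_span_dependent[OF B, of F] by blast
    have "c k = 0"
    proof (rule partial_fractions_independent[OF _ _ infinite_open_complex[OF \<Omega>], of "{..<Suc (card B)}" "\<lambda>i. a (i + 2)" c])
      show "inj_on (\<lambda>i. a (i + 2)) {..<Suc (card B)}"
        using a(1) by (auto simp: inj_on_def)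
      fix z assume z: "z \<in> \<Omega>"
      have nz: "z - a 0 \<noteq> 0" "z - a 1 \<noteq> 0" using z a\<Omega> by auto
      have "0 = (z - a 0) * (z - a 1) * (\<Sum>i<Suc (card B). c i * F i z)"
        unfolding c(3) by simp
      also have "\<dots> = (\<Sum>i<Suc (card B). c i / (z - a (i + 2)))"
        unfolding sum_distrib_left
        by (intro sum.cong refl) (use nz z in \<open>simp add: F_def\<close>)
      finally show "(\<Sum>i<Suc (card B). c i / (z - a (i + 2))) = 0" by simp
    qed (use c in auto)
    then show False using c by simp
  qed
  then show ?thesis
    using bergman_subspace[OF \<Omega>(1), of p] p by (auto simp: infinite_dimensional_def)
qed

lemma mean_value_circle:
  assumes G: "G holomorphic_on ball s R" and r: "0 < r" "r < R"
  shows "((\<lambda>t. G (s + rcis r t)) has_integral 2 * of_real pi * G s) {0..2 * pi}"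
proof -
  define C where "C = 2 * of_real pi * \<i>"
  have C: "C \<noteq> 0" by (simp add: C_def)
  have "((\<lambda>u. G u / (u - s)) has_contour_integral (2 * of_real pi * \<i> * G s)) (circlepath s r)"
    by (rule Cauchy_integral_circlepath_simple)
      (use r in \<open>auto intro!: holomorphic_on_subset[OF G]\<close>)
  then have "((\<lambda>x. G (circlepath s r x) / (circlepath s r x - s) * vector_derivative (circlepath s r) (at x within {0..1}))
     has_integral 2 * of_real pi * \<i> * G s) {0..1}"
    by (simp add: has_contour_integral_def)
  then have "((\<lambda>x. 2 * of_real pi * \<i> * G (s + rcis r (2 * pi * x))) has_integral 2 * of_real pi * \<i> * G s) {0..1}"
  proof (rule has_integral_eq[rotated])
    fix x :: real assume x: "x \<in> {0..1}"
    have e: "exp (2 * of_real pi * \<i> * of_real x) = cis (2 * pi * x)"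
      by (simp add: cis_conv_exp mult_ac)
    have c: "circlepath s r x = s + rcis r (2 * pi * x)"
      by (simp add: circlepath e rcis_def)
    have d: "vector_derivative (circlepath s r) (at x within {0..1}) = 2 * of_real pi * \<i> * rcis r (2 * pi * x)"
      using x by (simp add: vector_derivative_circlepath01 e rcis_def)
    show "G (circlepath s r x) / (circlepath s r x - s) * vector_derivative (circlepath s r) (at x within {0..1})
        = 2 * of_real pi * \<i> * G (s + rcis r (2 * pi * x))"
      unfolding c d using r by simp
  qed
  then have "((\<lambda>x. C * G (s + rcis r (2 * pi * x))) has_integral C * G s) {0..1}"
    by (simp only: C_def)
  from has_integral_mult_right[OF this, of "inverse C"]
  have "((\<lambda>x. G (s + rcis r (2 * pi * x))) has_integral G s) {0..1}"
    using C by (simp add: mult.assoc[symmetric])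
  from has_integral_stretch_real[OF this, of "1 / (2 * pi)"]
  have "((\<lambda>x. G (s + rcis r x)) has_integral (2 * pi) *\<^sub>R G s) ((\<lambda>x. x * (2 * pi)) ` {0..1})"
    by (simp add: mult.commute)
  moreover have "(\<lambda>x. x * (2 * pi)) ` {0..1} = {0..2 * pi}"
  proof -
    have "(\<lambda>x. x * (2 * pi)) ` {0..1} = (*) (2 * pi) ` {0..1}"
      by (intro image_cong) auto
    also have "\<dots> = {0..2 * pi}"
      by (subst image_mult_atLeastAtMost) auto
    finally show ?thesis .
  qed
  ultimately show ?thesis by (simp add: scaleR_conv_of_real)
qed


lemma usc_attains_max_on_compact:
  fixes \<phi> :: "complex \<Rightarrow> ereal" and k :: "complex \<Rightarrow> real"
  assumes usc: "upper_semicontinuous_on \<Omega> \<phi>" and \<Omega>: "open \<Omega>" and k: "continuous_on \<Omega> k"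
    and K: "compact K" "K \<noteq> {}" "K \<subseteq> \<Omega>"
  obtains s where "s \<in> K" "\<And>z. z \<in> K \<Longrightarrow> \<phi> z + ereal (k z) \<le> \<phi> s + ereal (k s)"
proof (rule ccontr)
  assume "\<not> thesis"
  then have ex: "\<forall>s\<in>K. \<exists>t\<in>K. \<phi> s + ereal (k s) < \<phi> t + ereal (k t)"
    using that by (meson not_le)
  define U where "U t = {z \<in> \<Omega>. \<phi> z + ereal (k z) < \<phi> t + ereal (k t)}" for t
  have "open (U t)" for t
  proof (rule openI)
    fix z assume "z \<in> U t"
    then have z: "z \<in> \<Omega>" "\<phi> z + ereal (k z) < \<phi> t + ereal (k t)" by (auto simp: U_def)
    then have "\<phi> z < (\<phi> t + ereal (k t)) - ereal (k z)"
      by (cases "\<phi> z"; cases "\<phi> t") auto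
    then obtain a where a: "\<phi> z < ereal a" "ereal a < (\<phi> t + ereal (k t)) - ereal (k z)"
      using ereal_dense2 by blast
    from a(2) have "ereal (k z) < (\<phi> t + ereal (k t)) - ereal a"
      by (cases "\<phi> t") auto
    then obtain b where b: "ereal (k z) < ereal b" "ereal b < (\<phi> t + ereal (k t)) - ereal a"
      using ereal_dense2 by blast
    have "openin (top_of_set \<Omega>) {w \<in> \<Omega>. \<phi> w < ereal a}"
      using usc by (simp add: upper_semicontinuous_on_def)
    then have o1: "open {w \<in> \<Omega>. \<phi> w < ereal a}"
      using \<Omega> by (simp add: openin_open_eq)
    have o2: "open (\<Omega> \<inter> k -` {..<b})"
      using k \<Omega> by (rule continuous_open_preimage) auto
    have "z \<in> {w \<in> \<Omega>. \<phi> w < ereal a} \<inter> (\<Omega> \<inter> k -` {..<b})"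
      using z a(1) b(1) by simp
    moreover have "{w \<in> \<Omega>. \<phi> w < ereal a} \<inter> (\<Omega> \<inter> k -` {..<b}) \<subseteq> U t"
    proof
      fix w assume w: "w \<in> {w \<in> \<Omega>. \<phi> w < ereal a} \<inter> (\<Omega> \<inter> k -` {..<b})"
      then have "\<phi> w < ereal a" "k w < b" by auto
      then have "\<phi> w + ereal (k w) < ereal (a + b)"
        by (cases "\<phi> w") auto
      also have "\<dots> \<le> \<phi> t + ereal (k t)"
        using b(2) by (cases "\<phi> t") auto
      finally show "w \<in> U t" using w by (simp add: U_def)
    qed
    ultimately show "\<exists>e>0. ball z e \<subseteq> U t"
      using open_Int[OF o1 o2] by (meson openE order_trans)
  qed
  moreover have "K \<subseteq> (\<Union>t\<in>K. U t)"
    using ex K(3) by (fastforce simp: U_def)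
  ultimately obtain T where T: "T \<subseteq> K" "finite T" "K \<subseteq> (\<Union>t\<in>T. U t)"
    using compactE_image[OF K(1), of K U] by metis
  have "T \<noteq> {}" using T(3) K(2) by auto
  define M where "M = Max ((\<lambda>t. \<phi> t + ereal (k t)) ` T)"
  have "M \<in> (\<lambda>t. \<phi> t + ereal (k t)) ` T"
    unfolding M_def using T(2) \<open>T \<noteq> {}\<close> by (intro Max_in) auto
  then obtain t where t: "t \<in> T" "M = \<phi> t + ereal (k t)" by blast
  then obtain t' where "t' \<in> T" "t \<in> U t'" using T by blast
  then have "M < \<phi> t' + ereal (k t')" using t by (simp add: U_def)
  moreover have "\<phi> t' + ereal (k t') \<le> M"
    unfolding M_def using T(2) \<open>t' \<in> T\<close> by (intro Max_ge) auto
  ultimately show False by simp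
qed

text \<open>The real part of a holomorphic function is its own circle mean. Since \<open>\<psi> \<le> 0\<close> on the circle, only the
  negative part contributes to \<open>circle_mean\<close>.\<close>

lemma circle_mean_le_of_bound:
  fixes \<psi> :: "complex \<Rightarrow> ereal" and G :: "complex \<Rightarrow> complex"
  assumes neg: "\<And>z. z \<in> sphere s r \<Longrightarrow> \<psi> z \<le> 0" and r: "0 < r" "r < R"
    and G: "G holomorphic_on ball s R"
    and le: "\<And>z. z \<in> sphere s r \<Longrightarrow> \<psi> z \<le> ereal (- Re (G z))"
  shows "circle_mean \<psi> s r \<le> ereal (- Re (G s))"
proof -
  define f where "f t = Re (G (s + rcis r t))" for t
  have on: "s + rcis r t \<in> sphere s r" for t
    using r by (simp add: dist_norm norm_minus_commute rcis_def norm_mult)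
  have "((\<lambda>t. G (s + rcis r t)) has_integral 2 * of_real pi * G s) {0..2 * pi}"
    by (rule mean_value_circle[OF G r])
  from has_integral_Re[OF this] have fI: "(f has_integral 2 * pi * Re (G s)) {0..2 * pi}"
    by (simp add: f_def[abs_def])
  have cf: "continuous_on UNIV f"
    unfolding f_def
    by (intro continuous_on_Re continuous_on_compose2[OF holomorphic_on_imp_continuous_on[OF G]])
      (use on r in \<open>auto simp: rcis_def cis_conv_exp intro!: continuous_intros\<close>)
  have cm: "continuous_on {0..2 * pi} (\<lambda>t. max 0 (f t))"
    by (intro continuous_intros continuous_on_subset[OF cf]) auto
  have mI: "((\<lambda>t. max 0 (f t)) has_integral integral {0..2 * pi} (\<lambda>t. max 0 (f t))) {0..2 * pi}"
    by (intro integrable_integral integrable_continuous_real cm)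
  have "2 * pi * Re (G s) \<le> integral {0..2 * pi} (\<lambda>t. max 0 (f t))"
    by (rule has_integral_le[OF fI mI]) auto
  then have "ennreal (2 * pi * Re (G s)) \<le> ennreal (integral {0..2 * pi} (\<lambda>t. max 0 (f t)))"
    by (rule ennreal_leI)
  also have "\<dots> = (\<integral>\<^sup>+t\<in>{0..2 * pi}. ennreal (max 0 (f t)) \<partial>lborel)"
    by (rule nn_integral_has_integral_lebesgue'[symmetric, OF _ mI]) auto
  also have "\<dots> \<le> (\<integral>\<^sup>+t\<in>{0..2 * pi}. e2ennreal (- \<psi> (s + rcis r t)) \<partial>lborel)"
  proof (intro nn_integral_mono mult_right_mono)
    fix t
    have "ereal (max 0 (f t)) \<le> - \<psi> (s + rcis r t)"
      using neg[OF on[of t]] le[OF on[of t]] by (cases "\<psi> (s + rcis r t)") (auto simp: f_def)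
    from e2ennreal_mono[OF this] show "ennreal (max 0 (f t)) \<le> e2ennreal (- \<psi> (s + rcis r t))"
      by (simp only: e2ennreal_ereal)
  qed auto
  finally have b: "ennreal (2 * pi * Re (G s)) \<le> (\<integral>\<^sup>+t\<in>{0..2 * pi}. e2ennreal (- \<psi> (s + rcis r t)) \<partial>lborel)"
    (is "_ \<le> ?J") .
  have "(\<integral>\<^sup>+t\<in>{0..2 * pi}. e2ennreal (\<psi> (s + rcis r t)) \<partial>lborel) = (\<integral>\<^sup>+t. 0 \<partial>(lborel :: real measure))"
    by (intro nn_integral_cong) (simp add: e2ennreal_neg neg[OF on])
  then have cmean: "circle_mean \<psi> s r = - enn2ereal ?J / ereal (2 * pi)"
    by (simp add: circle_mean_def zero_ennreal.rep_eq)
  have "ereal (2 * pi * Re (G s)) \<le> enn2ereal ?J"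
  proof (cases "0 \<le> Re (G s)")
    case True
    then have "enn2ereal (ennreal (2 * pi * Re (G s))) = ereal (2 * pi * Re (G s))" by simp
    then show ?thesis using b by (metis less_eq_ennreal.rep_eq)
  next
    case False
    then have "ereal (2 * pi * Re (G s)) \<le> 0" by (simp add: mult_nonneg_nonpos)
    also have "0 \<le> enn2ereal ?J" by simp
    finally show ?thesis .
  qed
  then show ?thesis
    unfolding cmean using pi_gt_zero by (cases "enn2ereal ?J") (auto simp: field_simps)
qed

text \<open>If \<open>\<Omega>\<close> omits only the finitely many points \<open>a\<close>, the function
  \<open>\<phi>(z) - \<epsilon> / 2 (norm z)\<^sup>2 + \<Sum>\<^sub>a ln (norm (z - a))\<close> tends to \<open>-\<infinity>\<close> at every omitted point and at infinity, so it attains its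
  maximum in \<open>\<Omega>\<close>. As \<open>\<phi> - \<epsilon> (norm z)\<^sup>2\<close> is subharmonic and the logarithms are harmonic, the mean over a small circle
  about a maximum point would exceed the maximum.\<close>

lemma no_negative_strictly_subharmonic_cofinite:
  fixes \<phi> :: "complex \<Rightarrow> ereal"
  assumes \<Omega>: "open \<Omega>" and fin: "finite (- \<Omega>)" and usc: "upper_semicontinuous_on \<Omega> \<phi>"
    and neg: "\<And>z. z \<in> \<Omega> \<Longrightarrow> \<phi> z < 0" and \<epsilon>: "0 < \<epsilon>"
    and sub: "subharmonic_on \<Omega> (\<lambda>z. \<phi> z - ereal (\<epsilon> * (norm z)\<^sup>2))"
    and z0: "z0 \<in> \<Omega>" "\<phi> z0 \<noteq> -\<infinity>"
  shows False
proof -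
  define F where "F = - \<Omega>"
  define P where "P z = (\<Prod>a\<in>F. z - a)" for z
  have Phol: "P holomorphic_on S" for S
    unfolding P_def by (intro holomorphic_intros)
  have P0: "P z = 0 \<longleftrightarrow> z \<notin> \<Omega>" for z
    using fin by (auto simp: P_def F_def)
  define k where "k z = ln (norm (P z)) - \<epsilon> / 2 * (norm z)\<^sup>2" for z
  have kc: "continuous_on \<Omega> k"
    unfolding k_def using P0 by (intro continuous_intros holomorphic_on_imp_continuous_on[OF Phol]) auto
  obtain f0 where f0: "\<phi> z0 = ereal f0" using neg[OF z0(1)] z0(2) by (cases "\<phi> z0") auto
  define c where "c = f0 + k z0"
  \<comment> \<open>in this form, with \<open>P\<close> in place of its logarithm, the superlevel set is visibly closed in \<open>\<complex>\<close>\<close>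
  define K where "K = {z. exp (c + \<epsilon> / 2 * (norm z)\<^sup>2) \<le> norm (P z)}"
  have K\<Omega>: "z \<in> \<Omega> \<and> c \<le> k z" if "z \<in> K" for z
  proof -
    have z: "exp (c + \<epsilon> / 2 * (norm z)\<^sup>2) \<le> norm (P z)" using that by (simp add: K_def)
    then have pos: "norm (P z) > 0" by (rule order_less_le_trans[OF exp_gt_zero])
    then have "c + \<epsilon> / 2 * (norm z)\<^sup>2 \<le> ln (norm (P z))"
      using z by (simp add: ln_ge_iff)
    then show ?thesis using pos P0[of z] by (auto simp: k_def)
  qed
  have Kk: "z \<in> K" if "z \<in> \<Omega>" "c \<le> k z" for z
  proof -
    have "norm (P z) > 0" using that(1) P0 by simp
    then show ?thesis using that(2) by (simp add: K_def k_def ln_ge_iff[symmetric] algebra_simps)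
  qed
  have "closed K"
    unfolding K_def by (intro closed_Collect_le continuous_intros holomorphic_on_imp_continuous_on[OF Phol])
  moreover have "bounded K"
  proof -
    define A where "A = (\<Sum>a\<in>F. norm a)"
    have "((\<lambda>x. (x + A) ^ card F * exp (- (c + \<epsilon> / 2 * x\<^sup>2))) \<longlongrightarrow> 0) at_top"
      using \<epsilon> by real_asymp
    then have "\<forall>\<^sub>F x in at_top. (x + A) ^ card F * exp (- (c + \<epsilon> / 2 * x\<^sup>2)) < 1"
      by (rule order_tendstoD) simp
    then obtain X where X: "\<And>x. X \<le> x \<Longrightarrow> (x + A) ^ card F * exp (- (c + \<epsilon> / 2 * x\<^sup>2)) < 1"
      by (auto simp: eventually_at_top_linorder)
    have "norm z \<le> X" if "z \<in> K" for z
    proof (rule ccontr)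
      assume "\<not> norm z \<le> X"
      then have "(norm z + A) ^ card F * exp (- (c + \<epsilon> / 2 * (norm z)\<^sup>2)) < 1"
        by (intro X) auto
      then have "(norm z + A) ^ card F < exp (c + \<epsilon> / 2 * (norm z)\<^sup>2)"
        by (simp add: exp_minus field_simps)
      moreover have "norm (P z) \<le> (norm z + A) ^ card F"
      proof -
        have "norm (P z) = (\<Prod>a\<in>F. norm (z - a))" by (simp add: P_def prod_norm)
        also have "\<dots> \<le> (\<Prod>a\<in>F. norm z + A)"
        proof (rule prod_mono)
          fix a assume "a \<in> F"
          then have "norm a \<le> A" unfolding A_def using fin by (intro member_le_sum) (auto simp: F_def)
          then show "0 \<le> norm (z - a) \<and> norm (z - a) \<le> norm z + A"
            using norm_triangle_ineq4[of z a] by simp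
        qed
        finally show ?thesis by simp
      qed
      ultimately show False using that by (simp add: K_def)
    qed
    then show ?thesis by (auto simp: bounded_iff)
  qed
  ultimately have "compact K" by (simp add: compact_eq_bounded_closed)
  have "c \<le> k z0" using neg[OF z0(1)] f0 by (simp add: c_def)
  then have z0K: "z0 \<in> K" using Kk z0 by blast
  obtain s where s: "s \<in> K" "\<And>z. z \<in> K \<Longrightarrow> \<phi> z + ereal (k z) \<le> \<phi> s + ereal (k s)"
    using usc_attains_max_on_compact[OF usc \<Omega> kc \<open>compact K\<close>] z0K K\<Omega> by blast
  have s\<Omega>: "s \<in> \<Omega>" using K\<Omega> s(1) by blast
  have cs: "ereal c \<le> \<phi> s + ereal (k s)" using s(2)[OF z0K] by (simp add: f0 c_def)
  then obtain f where f: "\<phi> s = ereal f" using neg[OF s\<Omega>] by (cases "\<phi> s") auto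
  have max: "\<phi> z + ereal (k z) \<le> ereal (f + k s)" if "z \<in> \<Omega>" for z
  proof (cases "c \<le> k z")
    case True
    then show ?thesis using s(2)[OF Kk[OF that True]] f by simp
  next
    case False
    then show ?thesis using neg[OF that] cs f by (cases "\<phi> z") auto
  qed
  obtain R where R: "R > 0" "ball s R \<subseteq> \<Omega>" using \<Omega> s\<Omega> openE by blast
  define r where "r = R / 2"
  have r: "0 < r" "r < R" using R by (auto simp: r_def)
  obtain g where g: "g holomorphic_on ball s R" "\<And>z. z \<in> ball s R \<Longrightarrow> P z = exp (g z)"
    by (rule contractible_imp_holomorphic_log[OF Phol, of "ball s R"])
      (use R P0 in \<open>auto simp: convex_imp_contractible subset_iff\<close>)
  have ln: "ln (norm (P z)) = Re (g z)" if "z \<in> ball s R" for z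
    using g(2)[OF that] by simp
  \<comment> \<open>on the circle \<open>(norm z)\<^sup>2 = (norm s)\<^sup>2 + r\<^sup>2 + 2 Re (cnj s (z - s))\<close>, so that all terms of the upper bound
    for \<open>\<phi> - \<epsilon> (norm z)\<^sup>2\<close> become real parts of holomorphic functions\<close>
  define G where "G z = g z + of_real \<epsilon> * cnj s * (z - s) + of_real (\<epsilon> / 2 * ((norm s)\<^sup>2 + r\<^sup>2) - (f + k s))" for z
  have Ghol: "G holomorphic_on ball s R"
    unfolding G_def by (intro holomorphic_intros g)
  have sph: "z \<in> \<Omega>" "z \<in> ball s R" if "z \<in> sphere s r" for z
    using that r R by auto
  have ReG: "Re (G z) = k z + \<epsilon> * (norm z)\<^sup>2 - (f + k s)" if z: "z \<in> sphere s r" for z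
  proof -
    have "r\<^sup>2 = (norm (z - s))\<^sup>2" using z by (simp add: dist_norm norm_minus_commute)
    then have "(norm z)\<^sup>2 = (norm s)\<^sup>2 + r\<^sup>2 + 2 * Re (cnj s * (z - s))"
      by (simp only: cmod_power2) (simp add: power2_eq_square algebra_simps)
    then have n: "Re (cnj s * (z - s)) = ((norm z)\<^sup>2 - (norm s)\<^sup>2 - r\<^sup>2) / 2" by simp
    have Re_mult_real: "Re (of_real x * w) = x * Re w" for x w by simp
    have "Re (G z) = ln (norm (P z)) + \<epsilon> * Re (cnj s * (z - s)) + (\<epsilon> / 2 * ((norm s)\<^sup>2 + r\<^sup>2) - (f + k s))"
      by (simp only: G_def plus_complex.sel Re_complex_of_real ln[OF sph(2)[OF z]] mult.assoc Re_mult_real)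
    then show ?thesis unfolding n by (simp add: k_def field_simps)
  qed
  have "circle_mean (\<lambda>z. \<phi> z - ereal (\<epsilon> * (norm z)\<^sup>2)) s r \<le> ereal (- Re (G s))"
  proof (rule circle_mean_le_of_bound[OF _ r Ghol])
    fix z assume z: "z \<in> sphere s r"
    show "\<phi> z - ereal (\<epsilon> * (norm z)\<^sup>2) \<le> 0"
      using neg[OF sph(1)[OF z]] \<epsilon> by (cases "\<phi> z") (auto intro: order_trans[OF less_imp_le])
    show "\<phi> z - ereal (\<epsilon> * (norm z)\<^sup>2) \<le> ereal (- Re (G z))"
      using max[OF sph(1)[OF z]] unfolding ReG[OF z] by (cases "\<phi> z") auto
  qed
  moreover have "\<phi> s - ereal (\<epsilon> * (norm s)\<^sup>2) \<le> circle_mean (\<lambda>z. \<phi> z - ereal (\<epsilon> * (norm z)\<^sup>2)) s r"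
  proof -
    have "cball s r \<subseteq> \<Omega>" using r R by (intro order_trans[OF _ R(2)]) auto
    then show ?thesis using sub r s\<Omega> unfolding subharmonic_on_def by blast
  qed
  ultimately have "\<phi> s - ereal (\<epsilon> * (norm s)\<^sup>2) \<le> ereal (- Re (G s))" by (rule order_trans[rotated])
  then have "f - \<epsilon> * (norm s)\<^sup>2 \<le> - Re (G s)" by (simp add: f)
  also have "Re (G s) = k s + \<epsilon> / 2 * (norm s)\<^sup>2 + \<epsilon> / 2 * ((norm s)\<^sup>2 + r\<^sup>2) - (f + k s)"
    using ln[of s] R by (simp add: G_def k_def)
  finally have "\<epsilon> / 2 * r\<^sup>2 \<le> 0" by (simp add: algebra_simps)
  moreover have "\<epsilon> / 2 * r\<^sup>2 > 0" using \<epsilon> r by simp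
  ultimately show False by simp
qed

text \<open>The function that is identically \<open>-\<infinity>\<close> satisfies the definition of subharmonicity; it is the Lelong number
  that tells it apart.\<close>

lemma lelong_number_minus_infinity:
  assumes \<Omega>: "open \<Omega>" "z \<in> \<Omega>" and \<phi>: "\<And>w. w \<in> \<Omega> \<Longrightarrow> \<phi> w = -\<infinity>"
  shows "lelong_number \<phi> z = \<infinity>"
proof -
  have "\<forall>\<^sub>F w in at z. \<phi> w / ereal (ln (norm (w - z))) = \<infinity>"
    unfolding eventually_at_topological
  proof (intro exI conjI ballI impI)
    show "open (\<Omega> \<inter> ball z 1)" "z \<in> \<Omega> \<inter> ball z 1" using \<Omega> by auto
    fix w assume w: "w \<in> \<Omega> \<inter> ball z 1" "w \<noteq> z"
    then have "ln (norm (w - z)) < 0"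
      by (simp add: dist_norm norm_minus_commute)
    then show "\<phi> w / ereal (ln (norm (w - z))) = \<infinity>"
      using \<phi>[of w] w by (simp add: divide_ereal_def)
  qed
  then have "lelong_number \<phi> z = Liminf (at z) (\<lambda>w. \<infinity>)"
    unfolding lelong_number_def by (rule Liminf_eq)
  then show ?thesis by (simp add: Liminf_const)
qed

lemma bergman_infinite_dimensional_if_strictly_subharmonic:
  fixes \<phi> :: "complex \<Rightarrow> ereal"
  assumes \<Omega>: "open \<Omega>" and p: "1 \<le> p" "p < 2"
    and sub: "subharmonic_on \<Omega> \<phi>" and neg: "\<And>z. z \<in> \<Omega> \<Longrightarrow> \<phi> z < 0"
    and \<epsilon>: "0 < \<epsilon>" "subharmonic_on \<Omega> (\<lambda>z. \<phi> z - ereal (\<epsilon> * (norm z)\<^sup>2))"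
    and a: "a \<in> \<Omega>" "lelong_number \<phi> a = 0"
  shows "infinite_dimensional (bergman \<Omega> p)"
proof -
  obtain z0 where z0: "z0 \<in> \<Omega>" "\<phi> z0 \<noteq> -\<infinity>"
    using lelong_number_minus_infinity[OF \<Omega> a(1), of \<phi>] a(2) by fastforce
  have "upper_semicontinuous_on \<Omega> \<phi>" using sub by (simp add: subharmonic_on_def)
  then have "infinite (- \<Omega>)"
    using no_negative_strictly_subharmonic_cofinite[OF \<Omega> _ _ neg \<epsilon> z0] by blast
  then show ?thesis
    using a(1) by (intro bergman_infinite_dimensional_if_infinite_complement[OF \<Omega> _ _ p]) auto
qed

section \<open>Bergman spaces of planar domains\<close>

theorem theorem2p1:
  fixes \<Omega> :: "complex set"
  assumes "open \<Omega>" and "connected \<Omega>" and "\<Omega> \<noteq> {}"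
  shows
    "(\<forall>p::real. 2 \<le> p \<longrightarrow>
        bergman \<Omega> p = {0} \<or>
        (infinite_dimensional (bergman \<Omega> p) \<and>
         complex_banach_space (bergman \<Omega> p) (bergman_norm \<Omega> p))) \<and>
     (\<forall>p q::real. 2 < p \<and> 1 / p + 1 / q = 1 \<and> riesz_capacity (2 - q) (- \<Omega>) > 0 \<longrightarrow>
        bergman \<Omega> p \<noteq> {0}) \<and>
     ((\<exists>\<phi> :: complex \<Rightarrow> ereal.
         subharmonic_on \<Omega> \<phi> \<and> (\<forall>z\<in>\<Omega>. \<phi> z < 0) \<and>
         (\<exists>\<epsilon>::real. 0 < \<epsilon> \<and> subharmonic_on \<Omega> (\<lambda>z. \<phi> z - ereal (\<epsilon> * (norm z)\<^sup>2))) \<and>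
         (\<exists>U. open U \<and> U \<noteq> {} \<and> U \<subseteq> {z\<in>\<Omega>. lelong_number \<phi> z = 0})) \<longrightarrow>
      (\<forall>p::real. 1 \<le> p \<and> p < 2 \<longrightarrow> infinite_dimensional (bergman \<Omega> p)))"
proof (intro conjI allI impI)
  fix p :: real
  assume p: "2 \<le> p"
  then show "bergman \<Omega> p = {0} \<or> (infinite_dimensional (bergman \<Omega> p) \<and>
      complex_banach_space (bergman \<Omega> p) (bergman_norm \<Omega> p))"
    using bergman_trivial_or_infinite_dimensional[OF assms(1,3) p] bergman_banach[OF assms(1), of p] by auto
next
  fix p q :: real
  assume "2 < p \<and> 1 / p + 1 / q = 1 \<and> 0 < riesz_capacity (2 - q) (- \<Omega>)"
  then show "bergman \<Omega> p \<noteq> {0}"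
    using bergman_nontrivial_if_positive_capacity[OF assms(1,3)] by blast
next
  fix p :: real
  assume ex: "\<exists>\<phi> :: complex \<Rightarrow> ereal.
      subharmonic_on \<Omega> \<phi> \<and> (\<forall>z\<in>\<Omega>. \<phi> z < 0) \<and>
      (\<exists>\<epsilon>::real. 0 < \<epsilon> \<and> subharmonic_on \<Omega> (\<lambda>z. \<phi> z - ereal (\<epsilon> * (norm z)\<^sup>2))) \<and>
      (\<exists>U. open U \<and> U \<noteq> {} \<and> U \<subseteq> {z\<in>\<Omega>. lelong_number \<phi> z = 0})"
    and p: "1 \<le> p \<and> p < 2"
  from ex obtain \<phi> :: "complex \<Rightarrow> ereal" and \<epsilon> U where
    "subharmonic_on \<Omega> \<phi>" "\<forall>z\<in>\<Omega>. \<phi> z < 0" "0 < \<epsilon>"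
    "subharmonic_on \<Omega> (\<lambda>z. \<phi> z - ereal (\<epsilon> * (norm z)\<^sup>2))"
    "U \<noteq> {}" "U \<subseteq> {z\<in>\<Omega>. lelong_number \<phi> z = 0}"
    by blast
  moreover from this obtain a where "a \<in> \<Omega>" "lelong_number \<phi> a = 0"
    by blast
  ultimately show "infinite_dimensional (bergman \<Omega> p)"
    using p by (intro bergman_infinite_dimensional_if_strictly_subharmonic[OF assms(1), of p \<phi> \<epsilon> a]) auto
qed

end
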